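(* Let $(X,\varphi,\mathbb{Z}^d)$ and $(Y,\psi,\mathbb{Z}^d)$ be two free minimal Cantor systems which are bounded orbit injection equivalent, with bounded orbit injections $\theta_1$ (from $(X,\varphi,\mathbb{Z}^d)$) and $\theta_2$ (from $(Y,\psi,\mathbb{Z}^d)$) into a common free minimal Cantor system $(Z,\alpha,\mathbb{Z}^d)$, and let $x_0\in X$. Let $h_{\theta_1}:(G(\varphi),G(\varphi)_+)\to(G(\alpha),G(\alpha)_+)$ and $h_{\theta_2}:(G(\psi),G(\psi)_+)\to(G(\alpha),G(\alpha)_+)$ be the induced isomorphisms. Suppose $h_{\theta_1}[1_X]-h_{\theta_2}[1_Y]\in \mathrm{Inf}(G(\alpha))$. Then there is an orbit equivalence $\theta$ from $(X,\varphi,\mathbb{Z}^d)$ to $(Y,\psi,\mathbb{Z}^d)$ such that the cocycle function $\eta:X\times\mathbb{Z}^d\to\mathbb{Z}^d$ satisfying $$\varphi^w(x)=y\iff\psi^{\eta(x,w)}(\theta(x))=\theta(y)$$ has the property that for any $w\in\mathbb{Z}^d$, $\eta(\cdot,w)$ is continuous on $X\setminus\{x_0,\varphi^{-w}(x_0)\}$.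
   Context: $d$ is a positive integer. A dynamical system $(X,\varphi,\mathbb{Z}^d)$ is a compact space $X$ with an action $\varphi$ of $\mathbb{Z}^d$ by homeomorphisms $\varphi^z$. It is a Cantor system if $X$ is a Cantor set, free if the action is free, and minimal if every orbit is dense. Orbit injection: for free dynamical systems $(X,\varphi,\mathbb{Z}^d)$ and $(Y,\psi,\mathbb{Z}^d)$, a map $\theta:X\to Y$ is an orbit injection if it is a continuous open injection such that for all $x,y\in X$: there is $w\in\mathbb{Z}^d$ with $\varphi^w(x)=y$ if and only if there is $v\in\mathbb{Z}^d$ with $\psi^v(\theta(x))=\theta(y)$. Its cocycle is the (unique) function $\eta:X\times\mathbb{Z}^d\to\mathbb{Z}^d$ with $\psi^{\eta(x,w)}(\theta(x))=\theta(\varphi^w(x))$. The orbit injection is bounded if $\eta$ is continuous. Two free minimal Cantor systems are bounded orbit injection equivalent if there are bounded orbit injections from both of them into a common free minimal Cantor system. An orbit equivalence from $(X,\varphi,\mathbb{Z}^d)$ to $(Y,\psi,\mathbb{Z}^d)$ is a homeomorphism $\theta:X\to Y$ mapping $\varphi$-orbits onto $\psi$-orbits. Ordered group: $G(\varphi)=C(X,\mathbb{Z})/B(\varphi)$, where $B(\varphi)$ is the subgroup of $C(X,\mathbb{Z})$ generated by the functions $1_A-1_{\varphi^vA}$ with $A\subseteq X$ clopen and $v\in\mathbb{Z}^d$; and $G(\varphi)_+=\{[f]: f\in C(X,\mathbb{Z}),\ f\ge 0\}$. For elements of an ordered group $(G,G_+)$, $g_2\ge g_1$ means $g_2-g_1\in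 G_+$, and $g_2>g_1$ means $g_2\ge g_1$ and $g_2\neq g_1$. The infinitesimal subgroup is $\mathrm{Inf}(G)=\{g\in G: ng<h\text{ for all }n\in\mathbb{Z}\text{ and all }h\in G_+\setminus\{0\}\}$. For a bounded orbit injection $\theta$ from $(X,\varphi,\mathbb{Z}^d)$ to $(Z,\alpha,\mathbb{Z}^d)$, $h_\theta:G(\varphi)\to G(\alpha)$ denotes the (well-defined) ordered group isomorphism determined by $h_\theta[1_A]=[1_{\theta(A)}]$ for clopen $A\subseteq X$. *)

theory Defs
  imports "HOL-Analysis.Analysis" "HOL-Algebra.Coset" "HOL-Algebra.Generated_Groups"
begin

text \<open>
  The group of integer vectors of length \<open>d\<close> is the type \<open>int ^ 'd\<close> with \<open>d = CARD('d)\<close>; as a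
  finite product of discrete spaces its library topology is discrete. A space is a type of class
  \<open>topological_space\<close>. Only the action is passed to the definitions, since the space is its type.
\<close>

definition dynamical_system :: "(int ^ 'd::finite \<Rightarrow> 'a::topological_space \<Rightarrow> 'a) \<Rightarrow> bool" where
  "dynamical_system \<phi> \<longleftrightarrow>
     compact (UNIV :: 'a set) \<and>
     (\<forall>v. homeomorphic_map euclidean euclidean (\<phi> v)) \<and>
     \<phi> 0 = id \<and> (\<forall>v w. \<phi> (v + w) = \<phi> v \<circ> \<phi> w)"

text \<open>The space of functions \<open>nat \<Rightarrow> bool\<close> carries the product topology of the discrete two-point
  space.\<close>

definition cantor_set :: "'a::topological_space set \<Rightarrow> bool" where
  "cantor_set S \<longleftrightarrow> S homeomorphic (UNIV :: (nat \<Rightarrow> bool) set)"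

definition free_action :: "(int ^ 'd::finite \<Rightarrow> 'a::topological_space \<Rightarrow> 'a) \<Rightarrow> bool" where
  "free_action \<phi> \<longleftrightarrow> (\<forall>v x. \<phi> v x = x \<longrightarrow> v = 0)"

definition action_orbit :: "(int ^ 'd::finite \<Rightarrow> 'a::topological_space \<Rightarrow> 'a) \<Rightarrow> 'a \<Rightarrow> 'a set" where
  "action_orbit \<phi> x = range (\<lambda>v. \<phi> v x)"

definition minimal_action :: "(int ^ 'd::finite \<Rightarrow> 'a::topological_space \<Rightarrow> 'a) \<Rightarrow> bool" where
  "minimal_action \<phi> \<longleftrightarrow> (\<forall>x. closure (action_orbit \<phi> x) = UNIV)"

definition free_minimal_cantor_system ::
    "(int ^ 'd::finite \<Rightarrow> 'a::topological_space \<Rightarrow> 'a) \<Rightarrow> bool" where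
  "free_minimal_cantor_system \<phi> \<longleftrightarrow>
     dynamical_system \<phi> \<and> cantor_set (UNIV :: 'a set) \<and> free_action \<phi> \<and> minimal_action \<phi>"

definition orbit_injection ::
    "(int ^ 'd::finite \<Rightarrow> 'a::topological_space \<Rightarrow> 'a) \<Rightarrow>
     (int ^ 'd \<Rightarrow> 'b::topological_space \<Rightarrow> 'b) \<Rightarrow> ('a \<Rightarrow> 'b) \<Rightarrow> bool" where
  "orbit_injection \<phi> \<psi> \<theta> \<longleftrightarrow>
     continuous_on UNIV \<theta> \<and> open_map euclidean euclidean \<theta> \<and> inj \<theta> \<and>
     (\<forall>x y. (\<exists>w. \<phi> w x = y) \<longleftrightarrow> (\<exists>v. \<psi> v (\<theta> x) = \<theta> y))"

definition cocycle ::
    "(int ^ 'd::finite \<Rightarrow> 'a::topological_space \<Rightarrow> 'a) \<Rightarrow>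
     (int ^ 'd \<Rightarrow> 'b::topological_space \<Rightarrow> 'b) \<Rightarrow> ('a \<Rightarrow> 'b) \<Rightarrow>
     'a \<Rightarrow> int ^ 'd \<Rightarrow> int ^ 'd" where
  "cocycle \<phi> \<psi> \<theta> x w = (THE v. \<psi> v (\<theta> x) = \<theta> (\<phi> w x))"

definition bounded_orbit_injection ::
    "(int ^ 'd::finite \<Rightarrow> 'a::topological_space \<Rightarrow> 'a) \<Rightarrow>
     (int ^ 'd \<Rightarrow> 'b::topological_space \<Rightarrow> 'b) \<Rightarrow> ('a \<Rightarrow> 'b) \<Rightarrow> bool" where
  "bounded_orbit_injection \<phi> \<psi> \<theta> \<longleftrightarrow>
     orbit_injection \<phi> \<psi> \<theta> \<and> continuous_on UNIV (\<lambda>(x, w). cocycle \<phi> \<psi> \<theta> x w)"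

definition orbit_equivalence ::
    "(int ^ 'd::finite \<Rightarrow> 'a::topological_space \<Rightarrow> 'a) \<Rightarrow>
     (int ^ 'd \<Rightarrow> 'b::topological_space \<Rightarrow> 'b) \<Rightarrow> ('a \<Rightarrow> 'b) \<Rightarrow> bool" where
  "orbit_equivalence \<phi> \<psi> \<theta> \<longleftrightarrow>
     homeomorphic_map euclidean euclidean \<theta> \<and>
     (\<forall>x. \<theta> ` action_orbit \<phi> x = action_orbit \<psi> (\<theta> x))"

text \<open>
  The abelian groups below are additive in the mathematics but use the multiplicative records of
  HOL-Algebra: \<open>\<otimes>\<close> is addition, \<open>inv\<close> negation, \<open>\<one>\<close> zero and \<open>[^]\<close> an integer multiple.
\<close>

definition cont_int_group :: "('a::topological_space \<Rightarrow> int) monoid" where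
  "cont_int_group =
     \<lparr>carrier = {f. continuous_on UNIV f}, mult = (\<lambda>f g x. f x + g x), one = (\<lambda>x. 0)\<rparr>"

definition coboundary_subgroup ::
    "(int ^ 'd::finite \<Rightarrow> 'a::topological_space \<Rightarrow> 'a) \<Rightarrow> ('a \<Rightarrow> int) set" where
  "coboundary_subgroup \<phi> =
     generate cont_int_group
       {(\<lambda>x. indicator A x - indicator (\<phi> v ` A) x) | A v. open A \<and> closed A}"

definition dyn_group ::
    "(int ^ 'd::finite \<Rightarrow> 'a::topological_space \<Rightarrow> 'a) \<Rightarrow> ('a \<Rightarrow> int) set monoid" where
  "dyn_group \<phi> = cont_int_group Mod coboundary_subgroup \<phi>"

definition dyn_class ::
    "(int ^ 'd::finite \<Rightarrow> 'a::topological_space \<Rightarrow> 'a) \<Rightarrow> ('a \<Rightarrow> int) \<Rightarrow> ('a \<Rightarrow> int) set" where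
  "dyn_class \<phi> f = coboundary_subgroup \<phi> #>\<^bsub>cont_int_group\<^esub> f"

definition dyn_pos ::
    "(int ^ 'd::finite \<Rightarrow> 'a::topological_space \<Rightarrow> 'a) \<Rightarrow> ('a \<Rightarrow> int) set set" where
  "dyn_pos \<phi> = {dyn_class \<phi> f | f. f \<in> carrier cont_int_group \<and> (\<forall>x. f x \<ge> 0)}"

definition og_less_eq :: "('g, 'm) monoid_scheme \<Rightarrow> 'g set \<Rightarrow> 'g \<Rightarrow> 'g \<Rightarrow> bool" where
  "og_less_eq G P g1 g2 \<longleftrightarrow> g2 \<otimes>\<^bsub>G\<^esub> inv\<^bsub>G\<^esub> g1 \<in> P"

definition og_less :: "('g, 'm) monoid_scheme \<Rightarrow> 'g set \<Rightarrow> 'g \<Rightarrow> 'g \<Rightarrow> bool" where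
  "og_less G P g1 g2 \<longleftrightarrow> og_less_eq G P g1 g2 \<and> g2 \<noteq> g1"

definition infinitesimals :: "('g, 'm) monoid_scheme \<Rightarrow> 'g set \<Rightarrow> 'g set" where
  "infinitesimals G P =
     {g \<in> carrier G. \<forall>n::int. \<forall>h \<in> P - {\<one>\<^bsub>G\<^esub>}. og_less G P (g [^]\<^bsub>G\<^esub> n) h}"

definition og_iso ::
    "('g, 'm) monoid_scheme \<Rightarrow> 'g set \<Rightarrow> ('h, 'n) monoid_scheme \<Rightarrow> 'h set \<Rightarrow> ('g \<Rightarrow> 'h) set" where
  "og_iso G P H Q = {h \<in> iso G H. h ` P = Q}"

text \<open>Extensionality (a fixed value outside the carrier) makes the isomorphism unique as a HOL
  function.\<close>

definition induced_iso ::
    "(int ^ 'd::finite \<Rightarrow> 'a::topological_space \<Rightarrow> 'a) \<Rightarrow>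
     (int ^ 'd \<Rightarrow> 'b::topological_space \<Rightarrow> 'b) \<Rightarrow> ('a \<Rightarrow> 'b) \<Rightarrow>
     ('a \<Rightarrow> int) set \<Rightarrow> ('b \<Rightarrow> int) set" where
  "induced_iso \<phi> \<alpha> \<theta> =
     (THE h. h \<in> og_iso (dyn_group \<phi>) (dyn_pos \<phi>) (dyn_group \<alpha>) (dyn_pos \<alpha>) \<and>
             h \<in> extensional (carrier (dyn_group \<phi>)) \<and>
             (\<forall>A. open A \<and> closed A \<longrightarrow>
                  h (dyn_class \<phi> (indicator A)) = dyn_class \<alpha> (indicator (\<theta> ` A))))"

end

theory Submission
  imports Defs
begin

text \<open>
  The heart of the proof is a comparison theorem for clopen sets \<open>U\<close>, \<open>V\<close>: if
  \<open>[1\<^sub>V] - [1\<^sub>U]\<close> is the class of some \<open>f \<ge> 0\<close>, \<open>f \<noteq> 0\<close>, then \<open>U\<close> embeds into \<open>V\<close> by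
  an injection that is locally a translation of the action. The coboundary
  \<open>1\<^sub>V - 1\<^sub>U - f\<close> is realised by a partial bijection of a clopen set \<open>C\<close> of tokens, so that
  \<open>U + f + C\<close> and \<open>V + C\<close> have the same fibre counts. Following tokens until they leave \<open>C\<close> embeds
  \<open>U + f\<close> into \<open>V\<close> up to the tokens staying in \<open>C\<close> for \<open>L\<close> steps; these have density
  \<open>O(1/L)\<close>, whereas by minimality \<open>f\<close> leaves a part of \<open>V\<close> of positive density free.
  Such a sparse remainder is placed into the free part by greedy matching, because cubes in
  \<open>\<int>\<^sup>d\<close> are doubling.

  When \<open>[1\<^sub>A] - [1\<^sub>B]\<close> is infinitesimal, comparison allows a back-and-forth construction: clopen
  neighbourhoods of a point \<open>a \<in> A\<close> and of a point \<open>b \<in> B\<close> in the orbit of \<open>a\<close> shrink to these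
  points while their complements are matched. The limit is a homeomorphism \<open>A \<rightarrow> B\<close> that preserves
  orbits and is locally a translation away from \<open>a\<close>. With \<open>A\<close>, \<open>B\<close> the images of \<open>X\<close>, \<open>Y\<close> and
  \<open>a\<close> the image of \<open>x0\<close> it pulls back to the orbit equivalence.
\<close>

subsection \<open>Piecewise translations\<close>

text \<open>No invariant measure is used: density means the proportion of points in a large cube of
  an orbit, uniformly in the starting point. Comparison needs a nonzero surplus \<open>f\<close>, so
  an infinitesimal difference alone does not suffice. In the back-and-forth step the surplus is a
  clopen piece of the neighbourhood that is kept unmatched; the neighbourhood left on the other side
  must contain its prescribed point, and both must stay infinitesimally close so that the step can
  be repeated. In the comparison, \<open>L\<close> is fixed before any displacement bound, since the
  displacements of the iterates depend on it, and the cube radius is fixed last. This order works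
  because the cubes to be compared differ in size by a factor \<open>6 ^ d\<close> at most, whatever
  the radius. A further obstacle is that the induced isomorphisms are definite descriptions.
  Evaluating them at the class of an indicator takes existence and uniqueness, hence an explicit
  inverse, modulo coboundaries, of extension by zero. The cocycle has two exceptional points because
  the matching must be a local translation at both \<open>x\<close> and
  \<open>\<phi> w x\<close>.\<close>

definition pw_translation ::
    "('g \<Rightarrow> 'p \<Rightarrow> 'p) \<Rightarrow> 'p::topological_space set \<Rightarrow> ('p \<Rightarrow> 'p) \<Rightarrow> bool" where
  "pw_translation act A g \<longleftrightarrow>
     (\<forall>p\<in>A. \<exists>s U. open U \<and> p \<in> U \<and> U \<subseteq> A \<and> (\<forall>q\<in>U. g q = act s q))"

lemma pw_translationI:
  assumes "\<And>p. p \<in> A \<Longrightarrow> \<exists>s U. open U \<and> p \<in> U \<and> U \<subseteq> A \<and> (\<forall>q\<in>U. g q = act s q)"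
  shows "pw_translation act A g"
  using assms by (auto simp: pw_translation_def)

lemma pw_translationE:
  assumes "pw_translation act A g" "p \<in> A"
  obtains s U where "open U" "p \<in> U" "U \<subseteq> A" "\<And>q. q \<in> U \<Longrightarrow> g q = act s q"
  using assms unfolding pw_translation_def by meson

lemma pw_translation_imp_open:
  assumes "pw_translation act A g"
  shows "open A"
  by (rule topological_space_class.openI) (meson assms pw_translationE)

lemma pw_translation_subset:
  assumes "pw_translation act A g" "open B" "B \<subseteq> A"
  shows "pw_translation act B g"
proof (rule pw_translationI)
  fix p assume p: "p \<in> B"
  with assms obtain s U where "open U" "p \<in> U" "U \<subseteq> A" "\<And>q. q \<in> U \<Longrightarrow> g q = act s q"
    by (meson pw_translationE subsetD)
  with assms p have "open (U \<inter> B) \<and> p \<in> U \<inter> B \<and> U \<inter> B \<subseteq> B \<and> (\<forall>q\<in>U \<inter> B. g q = act s q)"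
    by auto
  then show "\<exists>s U. open U \<and> p \<in> U \<and> U \<subseteq> B \<and> (\<forall>q\<in>U. g q = act s q)"
    by blast
qed

lemma pw_translation_cong:
  assumes "pw_translation act A g" "\<And>p. p \<in> A \<Longrightarrow> h p = g p"
  shows "pw_translation act A h"
proof (rule pw_translationI)
  fix p assume "p \<in> A"
  with assms obtain s U where "open U" "p \<in> U" "U \<subseteq> A" "\<And>q. q \<in> U \<Longrightarrow> g q = act s q"
    by (meson pw_translationE)
  moreover from this have "\<And>q. q \<in> U \<Longrightarrow> h q = act s q"
    using assms by auto
  ultimately show "\<exists>s U. open U \<and> p \<in> U \<and> U \<subseteq> A \<and> (\<forall>q\<in>U. h q = act s q)"
    by blast
qed

lemma pw_translation_UN:
  assumes "\<And>i. i \<in> I \<Longrightarrow> pw_translation act (A i) g"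
  shows "pw_translation act (\<Union>i\<in>I. A i) g"
proof (rule pw_translationI)
  fix p assume "p \<in> (\<Union>i\<in>I. A i)"
  then obtain i where i: "i \<in> I" "p \<in> A i"
    by auto
  with assms obtain s U where "open U" "p \<in> U" "U \<subseteq> A i" "\<And>q. q \<in> U \<Longrightarrow> g q = act s q"
    by (meson pw_translationE)
  with i show "\<exists>s U. open U \<and> p \<in> U \<and> U \<subseteq> (\<Union>i\<in>I. A i) \<and> (\<forall>q\<in>U. g q = act s q)"
    by (metis UN_upper order_trans)
qed

lemma pw_translation_Un:
  assumes "pw_translation act A g" "pw_translation act B g"
  shows "pw_translation act (A \<union> B) g"
  using pw_translation_UN[of "{A, B}" act id g] assms by auto

lemma pw_translation_if:
  assumes "pw_translation act A g" "pw_translation act B h" "A \<inter> B = {}"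
  shows "pw_translation act (A \<union> B) (\<lambda>p. if p \<in> A then g p else h p)"
  by (rule pw_translation_Un)
    (rule pw_translation_cong[OF assms(1)] pw_translation_cong[OF assms(2)]; use assms(3) in auto)+

text \<open>Compactness leaves finitely many translations. Displacement bounds and the decomposition
  of piecewise translations into coboundary generators rest on this.\<close>

lemma pw_translation_finite:
  assumes "pw_translation act A g" "compact A"
  obtains S where "finite S" "\<And>p. p \<in> A \<Longrightarrow> \<exists>s\<in>S. g p = act s p"
proof -
  have "\<forall>p\<in>A. \<exists>s U. open U \<and> p \<in> U \<and> (\<forall>q\<in>U. g q = act s q)"
    using assms(1) by (meson pw_translationE)
  then obtain s U where sU: "\<And>p. p \<in> A \<Longrightarrow> open (U p) \<and> p \<in> U p \<and> (\<forall>q\<in>U p. g q = act (s p) q)"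
    by metis
  then obtain C where C: "C \<subseteq> A" "finite C" "A \<subseteq> (\<Union>p\<in>C. U p)"
    using compactE_image[OF assms(2), of A U] by (metis UN_I subsetI)
  show ?thesis
  proof
    show "finite (s ` C)"
      using C by simp
    show "\<exists>t\<in>s ` C. g p = act t p" if "p \<in> A" for p
      using that C sU by (metis UN_E image_eqI subsetD)
  qed
qed

section \<open>Actions by homeomorphisms, exit maps and matchings\<close>

text \<open>The acting group is abstract because two actions are needed: that of
  \<open>int ^ 'd\<close> on the base space and that of \<open>(int ^ 'd) \<times> int\<close> on
  the tokens.\<close>

locale top_action =
  fixes act :: "'g::ab_group_add \<Rightarrow> 'p::topological_space \<Rightarrow> 'p"
  assumes act_zero [simp]: "act 0 p = p"
    and act_add: "act (s + t) p = act s (act t p)"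
    and open_act_image: "open U \<Longrightarrow> open (act s ` U)"
begin

lemma act_minus_left [simp]: "act (- s) (act s p) = p"
  by (metis act_add act_zero add.left_inverse)

lemma act_minus_right [simp]: "act s (act (- s) p) = p"
  by (metis act_add act_zero add.right_inverse)

lemma act_inject [simp]: "act s p = act s q \<longleftrightarrow> p = q"
  by (metis act_minus_left)

lemma act_vimage: "act s -` U = act (- s) ` U"
  by (auto simp: image_iff) (metis act_minus_left)

lemma open_act_vimage: "open U \<Longrightarrow> open (act s -` U)"
  by (simp add: act_vimage open_act_image)

lemma closed_act_image: "closed U \<Longrightarrow> closed (act s ` U)"
proof -
  assume "closed U"
  then have "open (act (- s) -` (- U))"
    by (intro open_act_vimage) (simp add: closed_def)
  also have "act (- s) -` (- U) = - (act s ` U)"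
    by (simp add: act_vimage[of "- s"] vimage_Compl)
  finally show ?thesis
    by (simp add: closed_def)
qed

abbreviation pwt where "pwt \<equiv> pw_translation act"

lemma pwt_act: "open A \<Longrightarrow> pwt A (act s)"
  by (rule pw_translationI) blast

lemma pwt_id: "open A \<Longrightarrow> pwt A id"
  by (rule pw_translation_cong[OF pwt_act[of _ 0]]) auto

lemma pwt_open_vimage:
  assumes "pwt A g" "open W"
  shows "open {p\<in>A. g p \<in> W}"
proof (rule topological_space_class.openI)
  fix p assume p: "p \<in> {p\<in>A. g p \<in> W}"
  then have "p \<in> A"
    by simp
  with assms(1) obtain s U where U: "open U" "p \<in> U" "U \<subseteq> A" "\<And>q. q \<in> U \<Longrightarrow> g q = act s q"
    by (meson pw_translationE)
  then have "open (U \<inter> act s -` W)" "p \<in> U \<inter> act s -` W" "U \<inter> act s -` W \<subseteq> {p\<in>A. g p \<in> W}"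
    using p assms(2) by (auto simp: open_act_vimage)
  then show "\<exists>T. open T \<and> p \<in> T \<and> T \<subseteq> {p\<in>A. g p \<in> W}"
    by blast
qed

lemma pwt_continuous_on:
  assumes "pwt A g"
  shows "continuous_on A g"
  unfolding continuous_on_open_vimage[OF pw_translation_imp_open[OF assms]]
  using pwt_open_vimage[OF assms] by (simp add: vimage_def Int_def conj_commute)

lemma pwt_open_image:
  assumes "pwt A g"
  shows "open (g ` A)"
proof (rule topological_space_class.openI)
  fix x assume "x \<in> g ` A"
  then obtain p where p: "p \<in> A" "x = g p"
    by auto
  with assms obtain s U where U: "open U" "p \<in> U" "U \<subseteq> A" "\<And>q. q \<in> U \<Longrightarrow> g q = act s q"
    by (meson pw_translationE)
  then have "open (act s ` U)" "x \<in> act s ` U"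
    using p by (auto simp: open_act_image)
  moreover have "act s ` U \<subseteq> g ` A"
    using U(3,4) by (metis image_cong image_mono)
  ultimately show "\<exists>T. open T \<and> x \<in> T \<and> T \<subseteq> g ` A"
    by blast
qed

lemma pwt_compact_image: "pwt A g \<Longrightarrow> compact A \<Longrightarrow> compact (g ` A)"
  by (simp add: compact_continuous_image pwt_continuous_on)

lemma pwt_comp:
  assumes "pwt A g" "pwt B h" "g ` A \<subseteq> B"
  shows "pwt A (\<lambda>p. h (g p))"
proof (rule pw_translationI)
  fix p assume p: "p \<in> A"
  with assms obtain s U where U: "open U" "p \<in> U" "U \<subseteq> A" "\<And>q. q \<in> U \<Longrightarrow> g q = act s q"
    by (meson pw_translationE)
  from p assms have "g p \<in> B"
    by auto
  with assms obtain t V where V: "open V" "g p \<in> V" "V \<subseteq> B" "\<And>q. q \<in> V \<Longrightarrow> h q = act t q"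
    by (meson pw_translationE)
  have "open (U \<inter> act s -` V)" "p \<in> U \<inter> act s -` V" "U \<inter> act s -` V \<subseteq> A"
    "\<forall>q\<in>U \<inter> act s -` V. h (g q) = act (t + s) q"
    using U V by (auto simp: open_act_vimage act_add)
  then show "\<exists>s U. open U \<and> p \<in> U \<and> U \<subseteq> A \<and> (\<forall>q\<in>U. h (g q) = act s q)"
    by blast
qed

lemma pwt_inv_into:
  assumes "pwt A g" "inj_on g A"
  shows "pwt (g ` A) (inv_into A g)"
proof (rule pw_translationI)
  fix x assume "x \<in> g ` A"
  then obtain p where p: "p \<in> A" "x = g p"
    by auto
  with assms obtain s U where U: "open U" "p \<in> U" "U \<subseteq> A" "\<And>q. q \<in> U \<Longrightarrow> g q = act s q"
    by (meson pw_translationE)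
  have "g ` U = act s ` U"
    using U by auto
  then have "open (g ` U)" "x \<in> g ` U"
    using U p open_act_image by (metis, blast)
  moreover have "g ` U \<subseteq> g ` A"
    using U(3) by (rule image_mono)
  moreover have "\<forall>q\<in>g ` U. inv_into A g q = act (- s) q"
    using U(3,4) assms(2) by (metis act_minus_left imageE inv_into_f_f subsetD)
  ultimately show "\<exists>s U. open U \<and> x \<in> U \<and> U \<subseteq> g ` A \<and> (\<forall>q\<in>U. inv_into A g q = act s q)"
    by blast
qed

text \<open>\<open>m\<close> iterates \<open>g\<close> until it leaves \<open>C\<close>; \<open>X'\<close> consists of the points that stay in \<open>C\<close> for \<open>L\<close>
  steps.\<close>

lemma exit_map:
  assumes g: "pwt (X \<union> C) g" "inj_on g (X \<union> C)" "g ` (X \<union> C) \<subseteq> Y \<union> C"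
    and disj: "X \<inter> C = {}"
    and X: "open X" "compact X" and C: "open C" "closed C"
  obtains X' m where "X' \<subseteq> X" "open X'" "compact X'"
    "pwt (X - X') m" "inj_on m (X - X')" "m ` (X - X') \<subseteq> Y"
    "\<And>k. k \<in> {1..L} \<Longrightarrow> pwt X' (g ^^ k)"
    "inj_on (\<lambda>(k, p). (g ^^ k) p) ({1..L} \<times> X')"
    "\<And>k. k \<in> {1..L} \<Longrightarrow> (g ^^ k) ` X' \<subseteq> C"
proof -
  define E where "E k = {p\<in>X. \<forall>j\<in>{1..k}. (g ^^ j) p \<in> C}" for k
  have E0 [simp]: "E 0 = X"
    by (auto simp: E_def)
  have E_Suc: "E (Suc k) = {p\<in>E k. (g ^^ Suc k) p \<in> C}" for k
    by (auto simp: E_def atLeastAtMostSuc_conv simp del: funpow.simps)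
  have E_mono: "E k \<subseteq> E j" if "j \<le> k" for j k
    using that by (auto simp: E_def)
  have E_X: "E k \<subseteq> X" for k
    by (auto simp: E_def)
  have EXC: "(g ^^ k) p \<in> X \<union> C" if "p \<in> E k" for k p
    using that by (cases "k = 0") (auto simp: E_def)
  have E_main: "open (E k) \<and> compact (E k) \<and> pwt (E k) (g ^^ k)" for k
  proof (induction k)
    case 0
    then show ?case
      using X pwt_id[of X] by (simp add: id_def)
  next
    case (Suc k)
    have "pwt (E k) (\<lambda>p. g ((g ^^ k) p))"
      using pwt_comp[OF _ g(1), of "E k" "g ^^ k"] Suc EXC[of _ k] by blast
    then have p: "pwt (E k) (g ^^ Suc k)"
      by (simp add: comp_def)
    have o: "open (E (Suc k))"
      unfolding E_Suc using pwt_open_vimage[OF p C(1)] by simp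
    have "open {q\<in>E k. (g ^^ Suc k) q \<in> - C}"
      by (rule pwt_open_vimage[OF p]) (use C in auto)
    moreover have "E (Suc k) = E k - {q\<in>E k. (g ^^ Suc k) q \<in> - C}"
      unfolding E_Suc by auto
    ultimately have "compact (E (Suc k))"
      using Suc by (metis compact_diff)
    with o p show ?case
      using pw_translation_subset[OF p o] E_mono[of k "Suc k"] by (simp del: funpow.simps)
  qed
  \<comment> \<open>The next iterate is a local translation on all of \<open>E k\<close>, not just
    on \<open>E (Suc k)\<close>; the points that exit at step \<open>Suc k\<close> are covered as
    well.\<close>
  have E_pwt: "pwt (E k) (g ^^ Suc k)" for k
  proof -
    have "pwt (E k) (\<lambda>p. g ((g ^^ k) p))"
      using pwt_comp[OF _ g(1), of "E k" "g ^^ k"] E_main[of k] EXC[of _ k] by blast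
    then show ?thesis
      by (simp add: comp_def)
  qed
  \<comment> \<open>Injectivity of \<open>g\<close> cancels a common power. The memberships in
    \<open>E\<close> keep the cancelled iterates inside \<open>X \<union> C\<close>, where
    \<open>g\<close> is injective.\<close>
  have peel: "(g ^^ j) p = (g ^^ (j + l)) q \<Longrightarrow> p \<in> E (j - 1) \<Longrightarrow> q \<in> E (j + l - 1) \<Longrightarrow> p = (g ^^ l) q"
    for j l p q
  proof (induction j)
    case (Suc j)
    have "p \<in> E j" "q \<in> E (j + l)"
      using Suc.prems(2,3) by simp_all
    then have "(g ^^ j) p \<in> X \<union> C" "(g ^^ (j + l)) q \<in> X \<union> C"
      using EXC by blast+
    moreover have "g ((g ^^ j) p) = g ((g ^^ (j + l)) q)"
      using Suc.prems(1) by simp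
    ultimately have "(g ^^ j) p = (g ^^ (j + l)) q"
      using g(2) by (meson inj_onD)
    moreover have "p \<in> E (j - 1)" "q \<in> E (j + l - 1)"
      using \<open>p \<in> E j\<close> \<open>q \<in> E (j + l)\<close> E_mono[of "j - 1" j] E_mono[of "j + l - 1" "j + l"] by auto
    ultimately show ?case
      by (rule Suc.IH)
  qed auto
  have uniq: "j = k \<and> p = q"
    if "(g ^^ j) p = (g ^^ k) q" "p \<in> E (j - 1)" "q \<in> E (k - 1)" "1 \<le> j" "1 \<le> k" "j \<le> k" for j k p q
  proof -
    define l where "l = k - j"
    have k: "k = j + l"
      using that by (simp add: l_def)
    have p: "p = (g ^^ l) q"
      using peel[of j p l q] that by (simp add: k)
    \<comment> \<open>As \<open>j \<ge> 1\<close>, a positive \<open>l\<close> is at most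
      \<open>k - 1\<close>, so \<open>(g ^^ l) q\<close> lies in \<open>C\<close>; but it equals
      \<open>p\<close>, which lies in \<open>X\<close>.\<close>
    have "l = 0"
    proof (rule ccontr)
      assume "l \<noteq> 0"
      then have "(g ^^ l) q \<in> C"
        using that(3,4) k by (auto simp: E_def)
      moreover have "p \<in> X"
        using that E_X by auto
      ultimately show False
        using p disj by auto
    qed
    then show ?thesis
      using p k by simp
  qed
  \<comment> \<open>First exit time. Outside \<open>E L\<close> it lies between 1 and
    \<open>L\<close>, because \<open>E 0 = X\<close>.\<close>
  define \<kappa> where "\<kappa> p = (LEAST k. p \<notin> E k)" for p
  define m where "m p = (g ^^ \<kappa> p) p" for p
  have kappa: "p \<notin> E (\<kappa> p)" "1 \<le> \<kappa> p" "p \<in> E (\<kappa> p - 1)" if "p \<in> X - E L" for p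
  proof -
    show 1: "p \<notin> E (\<kappa> p)"
      unfolding \<kappa>_def by (rule LeastI[of _ L]) (use that in auto)
    then show 2: "1 \<le> \<kappa> p"
      using that E0 by (metis DiffD1 One_nat_def Suc_leI gr0I)
    show "p \<in> E (\<kappa> p - 1)"
      using not_less_Least[of "\<kappa> p - 1" "\<lambda>k. p \<notin> E k"] 2 unfolding \<kappa>_def by auto
  qed
  have kappa_eq: "\<kappa> q = Suc k" if "q \<in> E k - E (Suc k)" for q k
    unfolding \<kappa>_def
  proof (rule Least_equality)
    show "q \<notin> E (Suc k)"
      using that by auto
    show "Suc k \<le> j" if "q \<notin> E j" for j
      using that \<open>q \<in> E k - E (Suc k)\<close> E_mono[of j k] by (meson DiffD1 not_less_eq_eq subsetD)
  qed
  have closedE: "open (E k - E (Suc k))" for k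
  proof -
    have "open {q\<in>E k. (g ^^ Suc k) q \<in> - C}"
      by (rule pwt_open_vimage[OF E_pwt]) (use C in auto)
    moreover have "{q\<in>E k. (g ^^ Suc k) q \<in> - C} = E k - E (Suc k)"
      unfolding E_Suc by auto
    ultimately show ?thesis
      by simp
  qed
  show ?thesis
  proof (rule that[of "E L" m])
    show "E L \<subseteq> X" "open (E L)" "compact (E L)"
      using E_main E_X by auto
    show "pwt (X - E L) m"
    proof -
      have "X - E L = (\<Union>k<L. E k - E (Suc k))"
      proof
        show "X - E L \<subseteq> (\<Union>k<L. E k - E (Suc k))"
        proof
          fix p assume p: "p \<in> X - E L"
          have "\<kappa> p \<le> L"
            unfolding \<kappa>_def by (rule Least_le) (use p in auto)
          then show "p \<in> (\<Union>k<L. E k - E (Suc k))"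
            using kappa[OF p] by (intro UN_I[of "\<kappa> p - 1"]) auto
        qed
        show "(\<Union>k<L. E k - E (Suc k)) \<subseteq> X - E L"
        proof
          fix p assume "p \<in> (\<Union>k<L. E k - E (Suc k))"
          then obtain k where "k < L" "p \<in> E k" "p \<notin> E (Suc k)"
            by auto
          then show "p \<in> X - E L"
            using E_X[of k] E_mono[of "Suc k" L] by auto
        qed
      qed
      moreover have "pwt (\<Union>k<L. E k - E (Suc k)) m"
      proof (rule pw_translation_UN)
        fix k assume "k \<in> {..<L}"
        have "pwt (E k - E (Suc k)) (g ^^ Suc k)"
          by (rule pw_translation_subset[OF E_pwt closedE]) auto
        then show "pwt (E k - E (Suc k)) m"
          by (rule pw_translation_cong) (simp add: m_def kappa_eq del: funpow.simps)
      qed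
      ultimately show ?thesis
        by simp
    qed
    show "inj_on m (X - E L)"
    proof (rule inj_onI)
      fix p q assume "p \<in> X - E L" "q \<in> X - E L" "m p = m q"
      then show "p = q"
        using kappa[of p] kappa[of q] uniq[of "\<kappa> p" p "\<kappa> q" q] uniq[of "\<kappa> q" q "\<kappa> p" p]
        unfolding m_def by (metis nat_le_linear)
    qed
    show "m ` (X - E L) \<subseteq> Y"
    proof
      fix x assume "x \<in> m ` (X - E L)"
      then obtain p where p: "p \<in> X - E L" "x = m p"
        by auto
      note k = kappa[OF p(1)]
      obtain k where kk: "\<kappa> p = Suc k"
        using k(2) by (cases "\<kappa> p") auto
      have "g ((g ^^ k) p) \<in> Y \<union> C"
        using g(3) EXC[of p k] k(3) kk by auto
      moreover have "(g ^^ Suc k) p \<notin> C"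
        using k(1,3) kk E_Suc[of k] by auto
      ultimately show "x \<in> Y"
        using p by (simp add: m_def kk)
    qed
    show "pwt (E L) (g ^^ k)" if "k \<in> {1..L}" for k
      by (rule pw_translation_subset[of _ "E k"]) (use E_main E_mono that in auto)
    show "inj_on (\<lambda>(k, p). (g ^^ k) p) ({1..L} \<times> E L)"
    proof (rule inj_onI, clarify)
      fix j k p q
      assume a: "j \<in> {1..L}" "k \<in> {1..L}" "p \<in> E L" "q \<in> E L" "(g ^^ j) p = (g ^^ k) q"
      then have "p \<in> E (j - 1)" "q \<in> E (k - 1)"
        using E_mono[of "j - 1" L] E_mono[of "k - 1" L] by (simp_all add: subset_iff le_diff_conv)
      then show "j = k \<and> p = q"
        using a uniq[of j p k q] uniq[of k q j p] by (metis atLeastAtMost_iff nat_le_linear)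
    qed
    show "(g ^^ k) ` E L \<subseteq> C" if "k \<in> {1..L}" for k
      using that by (auto simp: E_def)
  qed
qed

text \<open>The translations of \<open>S\<close> are treated one at a time, each matching all it
  still can. Later rounds only shrink the unmatched part of \<open>U\<close> and the free part of
  \<open>V\<close>, so maximality for earlier translations persists. Closedness of the image is
  carried along to keep the next round clopen.\<close>

lemma greedy_matching:
  assumes "finite S" "open U" "closed U" "open V" "closed V" 
  shows "\<exists>P m. P \<subseteq> U \<and> open P \<and> closed P \<and> pwt P m \<and> inj_on m P \<and> m ` P \<subseteq> V \<and> closed (m ` P) \<and>
    (\<forall>p\<in>P. \<exists>s\<in>S. m p = act s p) \<and> (\<forall>p\<in>U - P. \<forall>s\<in>S. act s p \<notin> V - m ` P)"
  using assms(1)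
proof (induction S rule: finite_induct)
  case empty
  show ?case
    by (rule exI[of _ "{}"]) (auto simp: pw_translation_def)
next
  case (insert s S)
  then obtain P m where P: "P \<subseteq> U" "open P" "closed P" "pwt P m" "inj_on m P" "m ` P \<subseteq> V"
    "closed (m ` P)" "\<forall>p\<in>P. \<exists>s\<in>S. m p = act s p" "\<forall>p\<in>U - P. \<forall>s\<in>S. act s p \<notin> V - m ` P"
    by blast
  \<comment> \<open>The unmatched points whose \<open>s\<close>-translate is still free; their
    images avoid the earlier ones by definition.\<close>
  define Q where "Q = (U - P) \<inter> act s -` (V - m ` P)"
  define h where "h p = (if p \<in> P then m p else act s p)" for p
  have openQ: "open Q"
    unfolding Q_def using P assms by (intro open_Int open_Diff open_act_vimage)
  have "closed (V - m ` P)"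
    using P assms pwt_open_image by (intro closed_Diff) auto
  then have "closed (act s -` (V - m ` P))"
    by (simp add: act_vimage closed_act_image)
  then have closedQ: "closed Q"
    unfolding Q_def using P assms by (intro closed_Int closed_Diff) auto
  have hP: "h ` P = m ` P"
    by (auto simp: h_def)
  have hQ: "h ` Q = act s ` Q"
    by (rule image_cong) (auto simp: h_def Q_def)
  have disj: "h ` P \<inter> h ` Q = {}"
    unfolding hP hQ by (auto simp: Q_def) (metis imageI)
  show ?case
  proof (intro exI conjI)
    show "P \<union> Q \<subseteq> U" "open (P \<union> Q)" "closed (P \<union> Q)"
      using P openQ closedQ by (auto simp: Q_def)
    show "pwt (P \<union> Q) h"
      unfolding h_def by (rule pw_translation_if) (use P pwt_act[OF openQ] in \<open>auto simp: Q_def\<close>)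
    show "inj_on h (P \<union> Q)"
      unfolding h_def[abs_def]
      by (rule inj_on_disjoint_Un[OF P(5)]) (use disj in \<open>simp_all add: hP hQ inj_on_def\<close>)
    show "h ` (P \<union> Q) \<subseteq> V"
      unfolding image_Un hP hQ using P by (auto simp: Q_def)
    show "closed (h ` (P \<union> Q))"
      unfolding image_Un hP hQ using P closedQ by (simp add: closed_act_image closed_Un)
    show "\<forall>p\<in>P \<union> Q. \<exists>s\<in>insert s S. h p = act s p"
      using P by (auto simp: h_def Q_def)
    show "\<forall>p\<in>U - (P \<union> Q). \<forall>t\<in>insert s S. act t p \<notin> V - h ` (P \<union> Q)"
    proof (intro ballI)
      fix p t assume pt: "p \<in> U - (P \<union> Q)" "t \<in> insert s S"
      show "act t p \<notin> V - h ` (P \<union> Q)"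
        using pt P(9) unfolding image_Un hP by (cases "t = s") (auto simp: Q_def)
    qed
  qed
qed

end

subsection \<open>Cubes, integer-valued functions and fibre counts\<close>

definition cube :: "nat \<Rightarrow> (int ^ 'd::finite) set" where
  "cube n = {w. \<forall>i. \<bar>w $ i\<bar> \<le> int n}"

lemma cube_eq_image: "(cube n :: (int ^ 'd::finite) set) = vec_lambda ` (PiE UNIV (\<lambda>_. {- int n..int n}))"
proof
  show "(cube n :: (int ^ 'd) set) \<subseteq> vec_lambda ` (PiE UNIV (\<lambda>_. {- int n..int n}))"
  proof
    fix w :: "int ^ 'd" assume w: "w \<in> cube n"
    have "- int n \<le> w $ i \<and> w $ i \<le> int n" for i
      using w by (auto simp: cube_def abs_le_iff dest: spec[of _ i])
    then show "w \<in> vec_lambda ` (PiE UNIV (\<lambda>_. {- int n..int n}))"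
      by (intro image_eqI[of _ _ "vec_nth w"]) auto
  qed
  show "vec_lambda ` (PiE UNIV (\<lambda>_. {- int n..int n})) \<subseteq> (cube n :: (int ^ 'd) set)"
    by (auto simp: cube_def abs_le_iff PiE_iff minus_le_iff)
qed

lemma finite_cube [simp]: "finite (cube n)"
  unfolding cube_eq_image by (intro finite_imageI finite_PiE) auto

lemma card_cube: "card (cube n :: (int ^ 'd::finite) set) = (2 * n + 1) ^ CARD('d)"
proof -
  have "inj_on vec_lambda (PiE (UNIV :: 'd set) (\<lambda>_. {- int n..int n}))"
    by (auto simp: inj_on_def vec_lambda_inject)
  then have "card (cube n :: (int ^ 'd) set) = card (PiE (UNIV :: 'd set) (\<lambda>_. {- int n..int n}))"
    unfolding cube_eq_image by (rule card_image)
  also have "\<dots> = (2 * n + 1) ^ CARD('d)"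
    by (simp add: card_PiE nat_add_distrib nat_mult_distrib)
  finally show ?thesis .
qed

lemma cube_add: "u \<in> cube m \<Longrightarrow> v \<in> cube n \<Longrightarrow> u + v \<in> cube (m + n)"
  unfolding cube_def by (auto intro: order_trans[OF abs_triangle_ineq] add_mono)

lemma cube_uminus: "u \<in> cube m \<Longrightarrow> - u \<in> cube m"
  by (simp add: cube_def)

lemma cube_mono: "m \<le> n \<Longrightarrow> cube m \<subseteq> cube n"
  by (auto simp: cube_def intro: order_trans)

lemma finite_subset_cube:
  assumes "finite (S :: (int ^ 'd::finite) set)"
  obtains D where "S \<subseteq> cube D"
proof -
  have "\<exists>D. \<forall>s\<in>S. s \<in> cube D"
    using assms
  proof (induction rule: finite_induct)
    case (insert s S)
    then obtain D where D: "\<forall>s\<in>S. s \<in> cube D"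
      by auto
    define E where "E = nat (\<Sum>i\<in>UNIV. \<bar>s $ i\<bar>)"
    have "\<bar>s $ i\<bar> \<le> int E" for i
      unfolding E_def using member_le_sum[of i UNIV "\<lambda>i. \<bar>s $ i\<bar>"]
      by (simp add: sum_nonneg)
    then have "s \<in> cube E"
      by (simp add: cube_def)
    then have "\<forall>t\<in>insert s S. t \<in> cube (D + E)"
      using D cube_mono[of D "D + E"] cube_mono[of E "D + E"] by auto
    then show ?case ..
  qed auto
  then show ?thesis
    using that by auto
qed

section \<open>Locally constant functions and the group of continuous integer-valued
  functions\<close>

lemma open_discrete_vec: "open (S :: (int ^ 'd::finite) set)"
  unfolding open_vec_def
proof (intro ballI)
  fix x assume x: "x \<in> S"
  show "\<exists>A. (\<forall>i. open (A i) \<and> x $ i \<in> A i) \<and> (\<forall>y. (\<forall>i. y $ i \<in> A i) \<longrightarrow> y \<in> S)"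
    by (rule exI[of _ "\<lambda>i. {x $ i}"]) (use x in \<open>auto simp: open_discrete vec_eq_iff[symmetric]\<close>)
qed

lemma continuous_on_open_discrete:
  fixes f :: "'a::topological_space \<Rightarrow> 'b::topological_space"
  assumes "open A" "\<And>x. x \<in> A \<Longrightarrow> \<exists>U. open U \<and> x \<in> U \<and> (\<forall>y\<in>U \<inter> A. f y = f x)"
  shows "continuous_on A f"
  unfolding continuous_on_open_vimage[OF assms(1)]
proof (intro allI impI)
  fix B :: "'b set" assume "open B"
  show "open (f -` B \<inter> A)"
  proof (rule topological_space_class.openI)
    fix x assume x: "x \<in> f -` B \<inter> A"
    then obtain U where "open U" "x \<in> U" "\<forall>y\<in>U \<inter> A. f y = f x"
      using assms(2) by blast
    then have "open (U \<inter> A)" "x \<in> U \<inter> A" "U \<inter> A \<subseteq> f -` B \<inter> A"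
      using x assms(1) by auto
    then show "\<exists>T. open T \<and> x \<in> T \<and> T \<subseteq> f -` B \<inter> A"
      by blast
  qed
qed

lemma clopen_vimage_int:
  assumes "continuous_on UNIV (f :: 'a::topological_space \<Rightarrow> int)"
  shows "open {x. f x \<in> S}" "closed {x. f x \<in> S}"
proof -
  have "open (f -` T)" for T
    using assms open_vimage by (metis open_discrete)
  from this[of S] this[of "- S"] show "open {x. f x \<in> S}" "closed {x. f x \<in> S}"
    by (simp_all add: vimage_def closed_def Collect_neg_eq)
qed

lemma compact_int_finite:
  assumes "compact (I :: int set)"
  shows "finite I"
proof -
  obtain C where "C \<subseteq> I" "finite C" "I \<subseteq> (\<Union>i\<in>C. {i})"
    by (rule compactE_image[OF assms, of I "\<lambda>i. {i}"]) (auto simp: open_discrete)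
  then show ?thesis
    by (simp add: finite_subset)
qed

lemma hausdorff_int: "Hausdorff_space (euclidean :: int topology)"
  unfolding Hausdorff_space_def
proof (intro allI impI)
  fix x y :: int assume "x \<in> topspace euclidean \<and> y \<in> topspace euclidean \<and> x \<noteq> y"
  then show "\<exists>U V. openin euclidean U \<and> openin euclidean V \<and> x \<in> U \<and> y \<in> V \<and> disjnt U V"
    by (intro exI[of _ "{x}"] exI[of _ "{y}"]) (auto simp: open_discrete)
qed

lemma finite_range_int:
  assumes "compact (UNIV :: 'a::topological_space set)" "continuous_on UNIV (f :: 'a \<Rightarrow> int)"
  shows "finite (range f)"
  by (intro compact_int_finite compact_continuous_image assms)

text \<open>The integers are discrete, so \<open>h\<close> may be arbitrary; negation is the case of
  an \<open>h\<close> that ignores its second argument.\<close>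

lemma continuous_int_binop:
  fixes f g :: "'a::topological_space \<Rightarrow> int" and h :: "int \<Rightarrow> int \<Rightarrow> int"
  assumes "continuous_on UNIV f" "continuous_on UNIV g"
  shows "continuous_on UNIV (\<lambda>x. h (f x) (g x))"
proof (rule continuous_on_open_discrete)
  fix x
  show "\<exists>U. open U \<and> x \<in> U \<and> (\<forall>y\<in>U \<inter> UNIV. h (f y) (g y) = h (f x) (g x))"
    using clopen_vimage_int(1)[OF assms(1), of "{f x}"] clopen_vimage_int(1)[OF assms(2), of "{g x}"]
    by (intro exI[of _ "{y. f y \<in> {f x}} \<inter> {y. g y \<in> {g x}}"]) auto
qed auto

interpretation cont_int: comm_group cont_int_group
  rewrites "carrier cont_int_group = {f :: 'a::topological_space \<Rightarrow> int. continuous_on UNIV f}"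
    and "\<And>f g. f \<otimes>\<^bsub>cont_int_group\<^esub> g = (\<lambda>x :: 'a. f x + g x)"
    and "\<one>\<^bsub>cont_int_group\<^esub> = (\<lambda>x :: 'a. 0)"
proof -
  show "comm_group (cont_int_group :: ('a \<Rightarrow> int) monoid)"
  proof (rule comm_groupI)
    fix f :: "'a \<Rightarrow> int" assume "f \<in> carrier cont_int_group"
    then show "\<exists>g\<in>carrier cont_int_group. g \<otimes>\<^bsub>cont_int_group\<^esub> f = \<one>\<^bsub>cont_int_group\<^esub>"
      by (intro bexI[of _ "\<lambda>x. - f x"]) (use continuous_int_binop[of f f "\<lambda>a b. - a"] in \<open>auto simp: cont_int_group_def\<close>)
  qed (auto simp: cont_int_group_def intro: continuous_int_binop)
qed (auto simp: cont_int_group_def)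

lemma cont_int_inv:
  assumes "continuous_on UNIV f"
  shows "inv\<^bsub>cont_int_group\<^esub> f = (\<lambda>x. - f x)"
  by (rule cont_int.inv_equality) (use assms continuous_int_binop[of f f "\<lambda>a b. - a"] in auto)

lemma continuous_indicator_clopen:
  assumes "open A" "closed A"
  shows "continuous_on UNIV (indicator A :: 'a::topological_space \<Rightarrow> int)"
proof (rule continuous_on_open_discrete)
  fix x
  show "\<exists>U. open U \<and> x \<in> U \<and> (\<forall>y\<in>U \<inter> UNIV. indicator A y = (indicator A x :: int))"
    by (rule exI[of _ "if x \<in> A then A else - A"]) (use assms in \<open>auto simp: indicator_def\<close>)
qed auto

text \<open>A clopen set \<open>P\<close> of finitely many layers of \<open>'c \<times> int\<close> encodes the function
  \<open>fibre_count P\<close>; translations of the layers make equality of such functions up to coboundaries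
  a matter of partial bijections.\<close>

definition fibre_count :: "('c \<times> int) set \<Rightarrow> 'c \<Rightarrow> nat" where
  "fibre_count P z = card {i. (z, i) \<in> P}"

lemma finite_fibre: "finite (snd ` P) \<Longrightarrow> finite {i. (z, i) \<in> P}"
  by (rule finite_subset[of _ "snd ` P"]) force+

lemma fibre_count_Un:
  assumes "finite (snd ` P)" "finite (snd ` Q)" "P \<inter> Q = {}"
  shows "fibre_count (P \<union> Q) z = fibre_count P z + fibre_count Q z"
proof -
  have "{i. (z, i) \<in> P \<union> Q} = {i. (z, i) \<in> P} \<union> {i. (z, i) \<in> Q}"
    by auto
  then show ?thesis
    unfolding fibre_count_def using assms finite_fibre
    by (simp, subst card_Un_disjoint) auto
qed

lemma fibre_count_layer: "int (fibre_count (A \<times> {k}) z) = indicator A z"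
  by (auto simp: fibre_count_def indicator_def)

section \<open>Tokens on layers over a free minimal action\<close>

text \<open>The second factor shifts layers, so rearranging the tokens of one fibre also counts as a
  local translation.\<close>

definition layer_act :: "('g \<Rightarrow> 'c \<Rightarrow> 'c) \<Rightarrow> 'g \<times> int \<Rightarrow> 'c \<times> int \<Rightarrow> 'c \<times> int" where
  "layer_act \<alpha> = (\<lambda>(v, k) (z, i). (\<alpha> v z, i + k))"

lemma layer_act_apply [simp]: "layer_act \<alpha> (v, k) (z, i) = (\<alpha> v z, i + k)"
  by (simp add: layer_act_def)

text \<open>Separation is expressed through \<open>Hausdorff_space\<close> because the space is a
  type of the bare class \<open>topological_space\<close>.\<close>

locale free_minimal_action = top_action \<alpha>
  for \<alpha> :: "int ^ 'd::finite \<Rightarrow> 'c::topological_space \<Rightarrow> 'c" +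
  assumes free: "\<alpha> v x = x \<Longrightarrow> v = 0"
    and minimal: "open U \<Longrightarrow> U \<noteq> {} \<Longrightarrow> \<exists>v. \<alpha> v x \<in> U"
    and compact_UNIV: "compact (UNIV :: 'c set)"
    and hausdorff: "Hausdorff_space (euclidean :: 'c topology)"
begin

lemma act_inject_left [simp]: "\<alpha> v z = \<alpha> w z \<longleftrightarrow> v = w"
proof
  assume "\<alpha> v z = \<alpha> w z"
  then have "\<alpha> (- w + v) z = z"
    by (metis act_add act_minus_left)
  then show "v = w"
    using free by fastforce
qed auto

lemma compact_imp_closed_base: "compact K \<Longrightarrow> closed (K :: 'c set)"
  using compactin_imp_closedin[OF hausdorff] by simp

lemma clopen_imp_compact: "closed (K :: 'c set) \<Longrightarrow> compact K"
  using closed_Int_compact[OF _ compact_UNIV] by auto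

lemma compact_imp_closed_layers: "compact K \<Longrightarrow> closed (K :: ('c \<times> int) set)"
proof -
  have "Hausdorff_space (prod_topology euclidean euclidean :: ('c \<times> int) topology)"
    unfolding Hausdorff_space_prod_topology using hausdorff hausdorff_int by blast
  then show "compact K \<Longrightarrow> closed K"
    using compactin_imp_closedin[of "euclidean :: ('c \<times> int) topology" K] by simp
qed

lemma finite_layers: "compact (K :: ('c \<times> int) set) \<Longrightarrow> finite (snd ` K)"
  by (intro compact_int_finite compact_continuous_image continuous_on_snd continuous_on_id)

lemma clopen_layer:
  assumes "open A" "closed (A :: 'c set)"
  shows "open (A \<times> {k :: int})" "compact (A \<times> {k})"
  using assms by (auto intro!: open_Times compact_Times clopen_imp_compact simp: open_discrete)

sublocale T: top_action "layer_act \<alpha>"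
proof
  show "layer_act \<alpha> 0 p = p" for p
    by (cases p) (simp add: zero_prod_def)
  show "layer_act \<alpha> (s + t) p = layer_act \<alpha> s (layer_act \<alpha> t p)" for s t p
    by (cases p, cases s, cases t) (simp add: act_add)
  show "open (layer_act \<alpha> s ` U)" if "open U" for s and U :: "('c \<times> int) set"
  proof (rule topological_space_class.openI)
    fix x assume "x \<in> layer_act \<alpha> s ` U"
    moreover obtain v k where s: "s = (v, k)"
      by (cases s)
    ultimately obtain z i where z: "(z, i) \<in> U" "x = (\<alpha> v z, i + k)"
      by (auto simp: layer_act_def)
    obtain A B where AB: "open A" "open B" "(z, i) \<in> A \<times> B" "A \<times> B \<subseteq> U"
      by (rule open_prod_elim[OF \<open>open U\<close> z(1)])
    have "open ((\<alpha> v ` A) \<times> {i + k})"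
      by (intro open_Times open_act_image AB(1) open_discrete)
    moreover have "x \<in> (\<alpha> v ` A) \<times> {i + k}"
      using z AB by auto
    moreover have "(\<alpha> v ` A) \<times> {i + k} \<subseteq> layer_act \<alpha> s ` U"
    proof clarify
      fix y assume "y \<in> A"
      then have "(y, i) \<in> U"
        using AB by auto
      then show "(\<alpha> v y, i + k) \<in> layer_act \<alpha> s ` U"
        by (rule rev_image_eqI) (simp add: s)
    qed
    ultimately show "\<exists>T. open T \<and> x \<in> T \<and> T \<subseteq> layer_act \<alpha> s ` U"
      by blast
  qed
qed

text \<open>Every slice of a clopen set is clopen, and compactness leaves finitely many nonempty
  layers; a finite intersection of slice conditions fixes the whole fibre.\<close>

lemma locally_constant_fibre:
  assumes "open (P :: ('c \<times> int) set)" "compact P"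
  shows "\<exists>U. open U \<and> z \<in> U \<and> (\<forall>y\<in>U. {i :: int. (y, i) \<in> P} = {i. (z, i) \<in> P})"
proof -
  define U where "U = (\<Inter>i\<in>snd ` P. {y. (y, i) \<in> P \<longleftrightarrow> (z, i) \<in> P})"
  have "open {y. (y, i) \<in> P \<longleftrightarrow> (z, i) \<in> P}" for i
  proof -
    have c: "continuous_on UNIV (\<lambda>y :: 'c. (y, i))"
      by (intro continuous_intros)
    have "open ((\<lambda>y. (y, i)) -` (if (z, i) \<in> P then P else - P))"
      using assms compact_imp_closed_layers by (intro open_vimage c) (auto simp: open_Compl)
    also have "(\<lambda>y. (y, i)) -` (if (z, i) \<in> P then P else - P) = {y. (y, i) \<in> P \<longleftrightarrow> (z, i) \<in> P}"
      by auto
    finally show ?thesis .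
  qed
  then have "open U"
    unfolding U_def using assms finite_layers by (intro open_INT) auto
  moreover have "z \<in> U"
    by (auto simp: U_def)
  moreover have "{i. (y, i) \<in> P} = {i. (z, i) \<in> P}" if "y \<in> U" for y
    using that by (force simp: U_def)
  ultimately show ?thesis
    by blast
qed

text \<open>The bijection of two fibres is chosen as a function of the two finite sets, not of the
  base point. Since the fibres are locally constant, so is the choice, and \<open>g\<close> is
  locally a pure shift of layers.\<close>

lemma fibre_bijection:
  assumes P: "open P" "compact P" and Q: "open Q" "compact Q"
    and eq: "\<And>z. fibre_count P z = fibre_count Q z"
  obtains g where "T.pwt P g" "bij_betw g P Q"
proof -
  define F :: "('c \<times> int) set \<Rightarrow> 'c \<Rightarrow> int set" where "F P z = {i. (z, i) \<in> P}" for P z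
  define \<beta> :: "int set \<Rightarrow> int set \<Rightarrow> int \<Rightarrow> int" where "\<beta> S S' = (SOME b. bij_betw b S S')" for S S'
  define g where "g = (\<lambda>(z, i). (z, \<beta> (F P z) (F Q z) i))"
  have bij: "bij_betw (\<beta> (F P z) (F Q z)) (F P z) (F Q z)" for z
  proof -
    have "finite (F P z)" "finite (F Q z)"
      unfolding F_def by (intro finite_fibre finite_layers P Q)+
    moreover have "card (F P z) = card (F Q z)"
      using eq by (simp add: F_def fibre_count_def)
    ultimately obtain b where "bij_betw b (F P z) (F Q z)"
      using finite_same_card_bij by blast
    then show ?thesis
      unfolding \<beta>_def by (rule someI[of "\<lambda>b. bij_betw b (F P z) (F Q z)"])
  qed
  have "T.pwt P g"
  proof (rule pw_translationI)
    fix p assume p: "p \<in> P"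
    obtain z i where zi: "p = (z, i)"
      by (cases p)
    obtain U where U: "open U" "z \<in> U" "\<And>y. y \<in> U \<Longrightarrow> F P y = F P z"
      unfolding F_def using locally_constant_fibre[OF P] by metis
    obtain V where V: "open V" "z \<in> V" "\<And>y. y \<in> V \<Longrightarrow> F Q y = F Q z"
      unfolding F_def using locally_constant_fibre[OF Q] by metis
    let ?W = "(U \<inter> V) \<times> {i}"
    have "open ?W"
      using U V by (intro open_Times open_discrete) auto
    moreover have "p \<in> ?W"
      using U V zi by auto
    moreover have "?W \<subseteq> P"
      using U p zi unfolding F_def by auto
    moreover have "\<forall>q\<in>?W. g q = layer_act \<alpha> (0, \<beta> (F P z) (F Q z) i - i) q"
    proof clarify
      fix y assume "y \<in> U" "y \<in> V"
      then have "F P y = F P z" "F Q y = F Q z"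
        by (simp_all only: U(3) V(3))
      then show "g (y, i) = layer_act \<alpha> (0, \<beta> (F P z) (F Q z) i - i) (y, i)"
        by (simp add: g_def)
    qed
    ultimately show "\<exists>s U. open U \<and> p \<in> U \<and> U \<subseteq> P \<and> (\<forall>q\<in>U. g q = layer_act \<alpha> s q)"
      by blast
  qed
  moreover have "bij_betw g P Q"
  proof (rule bij_betw_imageI)
    show "inj_on g P"
      using bij by (auto simp: inj_on_def g_def bij_betw_def F_def)
    show "g ` P = Q"
    proof
      show "g ` P \<subseteq> Q"
        using bij by (auto simp: g_def bij_betw_def F_def)
      show "Q \<subseteq> g ` P"
      proof
        fix q assume q: "q \<in> Q"
        obtain z j where zj: "q = (z, j)"
          by (cases q)
        then have "j \<in> \<beta> (F P z) (F Q z) ` F P z"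
          using bij[of z] q by (simp add: bij_betw_def F_def)
        then obtain i where "i \<in> F P z" "j = \<beta> (F P z) (F Q z) i"
          by auto
        then show "q \<in> g ` P"
          using zj by (intro image_eqI[of _ _ "(z, i)"]) (auto simp: g_def F_def)
      qed
    qed
  qed
  ultimately show ?thesis
    by (rule that)
qed

text \<open>Taking \<open>M\<close> large puts the representation on layers not used otherwise.\<close>

lemma coboundary_representation:
  assumes "b \<in> coboundary_subgroup \<alpha>"
  shows "\<exists>C g. (\<forall>p\<in>C. M \<le> snd p) \<and> (\<forall>p\<in>C. M \<le> snd (g p)) \<and> open C \<and> compact C \<and>
    T.pwt C g \<and> inj_on g C \<and> (\<forall>z. b z = int (fibre_count C z) - int (fibre_count (g ` C) z))"
proof -
  have gen: "\<exists>C g. (\<forall>p\<in>C. M \<le> snd p) \<and> (\<forall>p\<in>C. M \<le> snd (g p)) \<and> open C \<and> compact C \<and>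
      T.pwt C g \<and> inj_on g C \<and>
      (\<forall>z. indicator A z - indicator (\<alpha> v ` A) z = int (fibre_count C z) - int (fibre_count (g ` C) z))"
    if "open A" "closed A" for A v M
  proof (intro exI conjI)
    show "open (A \<times> {M})" "compact (A \<times> {M})"
      using clopen_layer that by auto
    then show "T.pwt (A \<times> {M}) (layer_act \<alpha> (v, 0))"
      by (rule_tac T.pwt_act)
    show "inj_on (layer_act \<alpha> (v, 0)) (A \<times> {M})"
      by (auto simp: inj_on_def)
    have "layer_act \<alpha> (v, 0) ` (A \<times> {M}) = (\<alpha> v ` A) \<times> {M}"
      by (force simp: image_iff)
    then show "\<forall>z. indicator A z - indicator (\<alpha> v ` A) z =
        int (fibre_count (A \<times> {M}) z) - int (fibre_count (layer_act \<alpha> (v, 0) ` (A \<times> {M})) z)"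
      by (simp add: fibre_count_layer)
  qed auto
  show ?thesis
    using assms unfolding coboundary_subgroup_def
  proof (induction b arbitrary: M rule: generate.induct)
    case one
    show ?case
      by (rule exI[of _ "{}"]) (simp add: fibre_count_def pw_translation_def cont_int_group_def)
  next
    case (incl b)
    then show ?case
      using gen by fastforce
  next
    case (inv b)
    then obtain A v where A: "open A" "closed A" "b = (\<lambda>x. indicator A x - indicator (\<alpha> v ` A) x)"
      by auto
    have "continuous_on UNIV b"
      unfolding A(3) using A open_act_image closed_act_image
      by (rule_tac continuous_int_binop[of "indicator A" "indicator (\<alpha> v ` A)" "(-)"])
        (auto intro: continuous_indicator_clopen)
    \<comment> \<open>The negative of a generator is again a generator, for the translated set and
      the vector \<open>- v\<close>.\<close>
    then have "inv\<^bsub>cont_int_group\<^esub> b = (\<lambda>x. indicator (\<alpha> v ` A) x - indicator (\<alpha> (- v) ` \<alpha> v ` A) x)"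
      by (simp add: cont_int_inv A(3) image_image)
    then show ?case
      using gen[of "\<alpha> v ` A" M "- v"] A by (simp add: open_act_image closed_act_image)
  next
    case (eng b1 b2)
    obtain C1 g1 where 1: "\<forall>p\<in>C1. M \<le> snd p" "\<forall>p\<in>C1. M \<le> snd (g1 p)" "open C1" "compact C1"
      "T.pwt C1 g1" "inj_on g1 C1"
      "\<forall>z. b1 z = int (fibre_count C1 z) - int (fibre_count (g1 ` C1) z)"
      using eng.IH(1)[of M] by (elim exE conjE) (rule that)
    have fin1: "finite (snd ` C1)" "finite (snd ` (g1 ` C1))"
      using 1 finite_layers T.pwt_compact_image by auto
    \<comment> \<open>A layer above everything that the first representation occupies, in its domain
      or its image. The induction hypothesis for \<open>b2\<close> is used from there on, which
      makes both unions disjoint.\<close>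
    define N where "N = Max (insert M (snd ` C1 \<union> snd ` (g1 ` C1))) + 1"
    have N: "M < N" "\<And>p. p \<in> C1 \<Longrightarrow> snd p < N" "\<And>p. p \<in> C1 \<Longrightarrow> snd (g1 p) < N"
      using fin1 unfolding N_def by (auto simp: zle_add1_eq_le intro!: Max_ge)
    obtain C2 g2 where 2: "\<forall>p\<in>C2. N \<le> snd p" "\<forall>p\<in>C2. N \<le> snd (g2 p)" "open C2" "compact C2"
      "T.pwt C2 g2" "inj_on g2 C2"
      "\<forall>z. b2 z = int (fibre_count C2 z) - int (fibre_count (g2 ` C2) z)"
      using eng.IH(2)[of N] by (elim exE conjE) (rule that)
    have fin2: "finite (snd ` C2)" "finite (snd ` (g2 ` C2))"
      using 2 finite_layers T.pwt_compact_image by auto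
    define g where "g p = (if p \<in> C1 then g1 p else g2 p)" for p
    have disj: "C1 \<inter> C2 = {}" "g1 ` C1 \<inter> g2 ` C2 = {}"
    proof -
      have "p \<notin> C2" if "p \<in> C1" for p
        using N(2)[OF that] 2(1) by force
      then show "C1 \<inter> C2 = {}"
        by auto
      have "g1 p \<noteq> g2 q" if "p \<in> C1" "q \<in> C2" for p q
        using N(3)[OF that(1)] 2(2) that(2) by force
      then show "g1 ` C1 \<inter> g2 ` C2 = {}"
        unfolding disjoint_iff by (intro allI impI notI) (elim imageE, blast)
    qed
    have g: "g ` C1 = g1 ` C1" "g ` C2 = g2 ` C2"
      using disj by (auto simp: g_def image_iff)
    show ?case
    proof (intro exI conjI)
      show "\<forall>p\<in>C1 \<union> C2. M \<le> snd p" "\<forall>p\<in>C1 \<union> C2. M \<le> snd (g p)"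
        using 1(1,2) 2(1,2) N(1) by (auto simp: g_def intro: order_trans less_imp_le)
      show "open (C1 \<union> C2)" "compact (C1 \<union> C2)"
        using 1 2 by auto
      show "T.pwt (C1 \<union> C2) g"
        unfolding g_def by (rule pw_translation_if) (use 1 2 disj in auto)
      show "inj_on g (C1 \<union> C2)"
        unfolding g_def[abs_def] by (rule inj_on_disjoint_Un[OF 1(6) 2(6) disj(2)])
      show "\<forall>z. (b1 \<otimes>\<^bsub>cont_int_group\<^esub> b2) z =
          int (fibre_count (C1 \<union> C2) z) - int (fibre_count (g ` (C1 \<union> C2)) z)"
        unfolding image_Un g using 1(7) 2(7) disj fin1 fin2
        by (simp add: fibre_count_Un cont_int_group_def)
    qed
  qed
qed

end

subsection \<open>Comparison of clopen sets\<close>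

context free_minimal_action
begin

section \<open>Counting tokens over cubes of an orbit\<close>

definition cube_count :: "('c \<times> int) set \<Rightarrow> 'c \<Rightarrow> nat \<Rightarrow> nat" where
  "cube_count P z n = card {(w, i). w \<in> cube n \<and> (\<alpha> w z, i) \<in> P}"

lemma finite_cube_count:
  assumes "finite (snd ` P)"
  shows "finite {(w, i). w \<in> cube n \<and> (\<alpha> w z, i) \<in> P}"
  by (rule finite_subset[of _ "cube n \<times> snd ` P"]) (use assms in force)+

lemma cube_count_le:
  assumes "finite (snd ` P)"
  shows "cube_count P z n \<le> card (snd ` P) * card (cube n :: (int ^ 'd) set)"
proof -
  have "cube_count P z n \<le> card ((cube n :: (int ^ 'd) set) \<times> snd ` P)"
    unfolding cube_count_def by (rule card_mono) (use assms in force)+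
  then show ?thesis
    by (simp add: card_cartesian_product mult.commute)
qed

lemma cube_count_mono:
  assumes "finite (snd ` Q)" "P \<subseteq> Q"
  shows "cube_count P z n \<le> cube_count Q z n"
  unfolding cube_count_def using assms by (intro card_mono finite_cube_count) auto

lemma cube_count_Diff:
  assumes "finite (snd ` P)" "finite (snd ` Q)"
  shows "cube_count P z n \<le> cube_count (P - Q) z n + cube_count Q z n"
proof -
  have "finite (snd ` (P - Q))"
    by (rule finite_subset[OF _ assms(1)]) auto
  have "cube_count P z n \<le> card ({(w, i). w \<in> cube n \<and> (\<alpha> w z, i) \<in> P - Q} \<union> {(w, i). w \<in> cube n \<and> (\<alpha> w z, i) \<in> Q})"
    unfolding cube_count_def
    by (rule card_mono)
      (use finite_cube_count[OF \<open>finite (snd ` (P - Q))\<close>] finite_cube_count[OF assms(2)] in auto)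
  also have "\<dots> \<le> cube_count (P - Q) z n + cube_count Q z n"
    unfolding cube_count_def by (rule card_Un_le)
  finally show ?thesis .
qed

text \<open>Displacement by at most \<open>D\<close> moves tokens over the cube of radius
  \<open>n\<close> to tokens over the cube of radius \<open>n + D\<close>, and joint injectivity
  makes the \<open>card K\<close> copies disjoint. With \<open>K\<close> the exponents of
  \<open>L\<close> iterates this yields the density bound of order \<open>1/L\<close>.\<close>

lemma cube_count_packing:
  assumes inj: "inj_on (\<lambda>(k, p). g k p) (K \<times> P)"
    and g: "\<And>k p. k \<in> K \<Longrightarrow> p \<in> P \<Longrightarrow> g k p \<in> Q"
    and s: "\<And>k p. k \<in> K \<Longrightarrow> p \<in> P \<Longrightarrow> \<exists>s\<in>cube D \<times> UNIV. g k p = layer_act \<alpha> s p"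
    and fin: "finite (snd ` Q)"
  shows "card K * cube_count P z n \<le> cube_count Q z (n + D)"
proof -
  obtain s where s: "\<And>k p. k \<in> K \<Longrightarrow> p \<in> P \<Longrightarrow> fst (s k p) \<in> cube D \<and> g k p = layer_act \<alpha> (s k p) p"
    using s by (metis mem_Times_iff)
  define A where "A = {(w, i). w \<in> cube n \<and> (\<alpha> w z, i) \<in> P}"
  define B where "B = {(w, i). w \<in> cube (n + D) \<and> (\<alpha> w z, i) \<in> Q}"
  \<comment> \<open>The map \<open>g\<close> in the coordinates of the orbit of \<open>z\<close>.
    Freeness makes these coordinates unique, so \<open>f\<close> inherits injectivity.\<close>
  define f where "f = (\<lambda>(k, w, i). (w + fst (s k (\<alpha> w z, i)), i + snd (s k (\<alpha> w z, i))))"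
  have g_eq: "g k (\<alpha> w z, i) = (\<alpha> (fst (f (k, w, i))) z, snd (f (k, w, i)))"
    if "k \<in> K" "(w, i) \<in> A" for k w i
  proof -
    have "g k (\<alpha> w z, i) = layer_act \<alpha> (s k (\<alpha> w z, i)) (\<alpha> w z, i)"
      using s[of k "(\<alpha> w z, i)"] that by (auto simp: A_def)
    also have "\<dots> = (\<alpha> (fst (s k (\<alpha> w z, i))) (\<alpha> w z), i + snd (s k (\<alpha> w z, i)))"
      by (metis layer_act_apply prod.collapse)
    finally show ?thesis
      by (simp add: f_def act_add[symmetric] add.commute)
  qed
  have "inj_on f (K \<times> A)"
  proof (rule inj_onI)
    fix x y assume x: "x \<in> K \<times> A" and y: "y \<in> K \<times> A" and eq: "f x = f y"
    obtain k w i where x': "x = (k, w, i)"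
      by (cases x) auto
    obtain l v j where y': "y = (l, v, j)"
      by (cases y) auto
    have "g k (\<alpha> w z, i) = g l (\<alpha> v z, j)"
      using g_eq[of k w i] g_eq[of l v j] x y eq x' y' by simp
    moreover have "(k, \<alpha> w z, i) \<in> K \<times> P" "(l, \<alpha> v z, j) \<in> K \<times> P"
      using x y x' y' by (auto simp: A_def)
    ultimately have "(k, \<alpha> w z, i) = (l, \<alpha> v z, j)"
      using inj unfolding inj_on_def by fastforce
    then show "x = y"
      by (simp add: x' y')
  qed
  moreover have "f ` (K \<times> A) \<subseteq> B"
  proof clarify
    fix k w i v j assume k: "k \<in> K" "(w, i) \<in> A" and eq: "(v, j) = f (k, w, i)"
    then have "g k (\<alpha> w z, i) = (\<alpha> v z, j)"
      using g_eq[OF k] by (simp flip: eq)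
    moreover have "g k (\<alpha> w z, i) \<in> Q"
      using g k by (auto simp: A_def)
    moreover have "v \<in> cube (n + D)"
      using eq k s[of k "(\<alpha> w z, i)"] by (auto simp: f_def A_def intro: cube_add)
    ultimately show "(v, j) \<in> B"
      by (simp add: B_def)
  qed
  moreover have "finite B"
    unfolding B_def by (rule finite_cube_count[OF fin])
  ultimately have "card (K \<times> A) \<le> card B"
    by (rule card_inj_on_le)
  then show ?thesis
    by (simp add: cube_count_def card_cartesian_product A_def B_def)
qed

lemma cube_count_inj:
  assumes "inj_on g P" "g ` P \<subseteq> Q"
    and "\<And>p. p \<in> P \<Longrightarrow> \<exists>s\<in>cube D \<times> UNIV. g p = layer_act \<alpha> s p"
    and "finite (snd ` Q)"
  shows "cube_count P z n \<le> cube_count Q z (n + D)"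
  using cube_count_packing[of "\<lambda>_. g" "{()}" P Q D z n] assms by (auto simp: inj_on_def)

text \<open>The bound is stated for all \<open>E \<ge> D\<close> so that several bounds can be
  merged into one larger radius.\<close>

lemma bounded_displacement:
  assumes "T.pwt P g" "compact P"
  obtains D where "\<And>p E. p \<in> P \<Longrightarrow> D \<le> E \<Longrightarrow> \<exists>s\<in>cube E \<times> UNIV. g p = layer_act \<alpha> s p"
proof -
  obtain S where S: "finite S" "\<And>p. p \<in> P \<Longrightarrow> \<exists>s\<in>S. g p = layer_act \<alpha> s p"
    using pw_translation_finite[OF assms] by blast
  obtain D where D: "fst ` S \<subseteq> cube D"
    using finite_subset_cube[of "fst ` S"] S by blast
  then have "\<exists>s\<in>cube E \<times> UNIV. g p = layer_act \<alpha> s p" if pE: "p \<in> P" "D \<le> E" for p E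
  proof -
    obtain s where s: "s \<in> S" "g p = layer_act \<alpha> s p"
      using S(2)[OF pE(1)] by blast
    then have "s \<in> cube E \<times> UNIV"
      using D cube_mono[OF pE(2)] by (auto simp: mem_Times_iff)
    with s show ?thesis
      by blast
  qed
  then show ?thesis
    by (rule that)
qed

lemma layer_translation:
  assumes "T.pwt (U \<times> {0}) m" "m ` (U \<times> {0}) \<subseteq> V \<times> {0}"
  shows "pwt U (\<lambda>z. fst (m (z, 0)))"
proof (rule pw_translationI)
  fix z assume z: "z \<in> U"
  then obtain s W where W: "open W" "(z, 0) \<in> W" "W \<subseteq> U \<times> {0}" "\<And>q. q \<in> W \<Longrightarrow> m q = layer_act \<alpha> s q"
    using assms(1) by (auto elim!: pw_translationE[of _ _ _ "(z, 0)"])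
  obtain A B where AB: "open A" "open B" "(z, 0) \<in> A \<times> B" "A \<times> B \<subseteq> W"
    by (rule open_prod_elim[OF W(1,2)])
  have "A \<subseteq> U"
    using AB(3,4) W(3) by blast
  moreover have "fst (m (y, 0)) = \<alpha> (fst s) y" if "y \<in> A" for y
  proof -
    have "(y, 0) \<in> W"
      using AB(3,4) that by blast
    then have "m (y, 0) = layer_act \<alpha> (fst s, snd s) (y, 0)"
      using W(4) by simp
    also have "\<dots> = (\<alpha> (fst s) y, 0 + snd s)"
      by (rule layer_act_apply)
    finally show ?thesis
      by simp
  qed
  ultimately show "\<exists>s W. open W \<and> z \<in> W \<and> W \<subseteq> U \<and> (\<forall>q\<in>W. fst (m (q, 0)) = \<alpha> s q)"
    using AB by blast
qed

text \<open>By minimality and compactness some radius \<open>R\<close> works for every point: a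
  shift in the cube of radius \<open>R\<close> reaches the support of \<open>f\<close>. Sending each
  \<open>w\<close> to such a nearby hit is at most \<open>card (cube R)\<close> to one.\<close>

lemma support_density:
  assumes f: "continuous_on UNIV f" "\<And>z. 0 \<le> f z" "f \<noteq> (\<lambda>_. 0 :: int)"
    and fin: "finite (snd ` {(z, i). 1 \<le> i \<and> i \<le> f z})"
  obtains R where
    "\<And>z n. card (cube n :: (int ^ 'd) set) \<le>
      card (cube R :: (int ^ 'd) set) * cube_count {(z, i). 1 \<le> i \<and> i \<le> f z} z (n + R)"
proof -
  define W where "W = {z. f z \<in> {1..}}"
  have "open W"
    unfolding W_def by (rule clopen_vimage_int[OF f(1)])
  obtain z0 where "f z0 \<noteq> 0"
    using f(3) by auto
  then have "W \<noteq> {}"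
    using f(2)[of z0] by (auto simp: W_def intro!: exI[of _ z0])
  then have "(UNIV :: 'c set) \<subseteq> (\<Union>v\<in>UNIV. \<alpha> v -` W)"
    using minimal[OF \<open>open W\<close>] by auto
  then obtain S where S: "finite S" "UNIV \<subseteq> (\<Union>v\<in>S. \<alpha> v -` W)"
    using compactE_image[OF compact_UNIV, of UNIV "\<lambda>v. \<alpha> v -` W"] open_act_vimage[OF \<open>open W\<close>] by metis
  obtain R where R: "S \<subseteq> cube R"
    using finite_subset_cube[OF S(1)] by blast
  have "\<exists>v\<in>cube R. \<alpha> v z \<in> W" for z
    using S R by blast
  then obtain u where u: "\<And>z. u z \<in> cube R" "\<And>z. \<alpha> (u z) z \<in> W"
    by metis
  have "card (cube n :: (int ^ 'd) set) \<le>
      card (cube R :: (int ^ 'd) set) * cube_count {(z, i). 1 \<le> i \<and> i \<le> f z} z (n + R)" for z n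
  proof -
    \<comment> \<open>Recording the shift next to the hit makes \<open>w\<close> recoverable. The
      entry 1 is the lowest layer below the graph of \<open>f\<close>.\<close>
    define h :: "int ^ 'd \<Rightarrow> (int ^ 'd) \<times> (int ^ 'd) \<times> int"
      where "h w = (u (\<alpha> w z), u (\<alpha> w z) + w, 1)" for w
    have "inj_on h (cube n)"
      by (rule inj_onI) (auto simp: h_def)
    moreover have "h ` cube n \<subseteq> cube R \<times> {(w, i). w \<in> cube (n + R) \<and> (\<alpha> w z, i) \<in> {(z, i). 1 \<le> i \<and> i \<le> f z}}"
      using u unfolding h_def by (auto simp: W_def act_add add.commute[of n] intro: cube_add)
    ultimately have "card (cube n :: (int ^ 'd) set) \<le>
        card ((cube R :: (int ^ 'd) set) \<times> {(w, i). w \<in> cube (n + R) \<and> (\<alpha> w z, i) \<in> {(z, i). 1 \<le> i \<and> i \<le> f z}})"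
      by (rule card_inj_on_le) (intro finite_cartesian_product finite_cube finite_cube_count fin)
    then show ?thesis
      by (simp add: card_cartesian_product cube_count_def)
  qed
  then show ?thesis
    by (rule that)
qed

text \<open>If the greedy matching left some \<open>p \<in> U\<close> over, all points of \<open>V\<close> in the cube of radius \<open>n\<close>
  around \<open>p\<close> would be matched to points of \<open>U\<close> in the cube of radius \<open>2n\<close>.\<close>

lemma sparse_embedding:
  assumes U: "open U" "compact U" "U \<subseteq> UNIV \<times> {0}" and V: "open V" "compact V" "V \<subseteq> UNIV \<times> {0}"
    and count: "\<And>z. cube_count U z (n + n) < cube_count V z n"
  obtains m where "T.pwt U m" "inj_on m U" "m ` U \<subseteq> V"
proof -
  have finU: "finite (snd ` U)" and finV: "finite (snd ` V)"
    using U V finite_layers by auto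
  \<comment> \<open>The layer component of the shifts is 0 because \<open>U\<close> and
    \<open>V\<close> both lie in layer 0.\<close>
  obtain P m where P: "P \<subseteq> U" "open P" "closed P" "T.pwt P m" "inj_on m P" "m ` P \<subseteq> V"
    "\<forall>p\<in>P. \<exists>s\<in>cube n \<times> {0}. m p = layer_act \<alpha> s p"
    "\<forall>p\<in>U - P. \<forall>s\<in>cube n \<times> {0}. layer_act \<alpha> s p \<notin> V - m ` P"
    using T.greedy_matching[of "cube n \<times> {0}" U V] U V compact_imp_closed_layers
    by (metis (no_types, lifting) finite.emptyI finite_SigmaI finite_cube finite_insert)
  have "P = U"
  proof (rule ccontr)
    assume "P \<noteq> U"
    then obtain p where p: "p \<in> U - P"
      using P(1) by auto
    then obtain z where z: "p = (z, 0)"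
      using U(3) by auto
    have finmP: "finite (snd ` m ` P)"
      by (rule finite_subset[OF _ finV]) (use P(6) in auto)
    have sub: "{(w, i). w \<in> cube n \<and> (\<alpha> w z, i) \<in> V} \<subseteq> {(w, i). w \<in> cube n \<and> (\<alpha> w z, i) \<in> m ` P}"
    proof clarify
      fix w i assume w: "w \<in> cube n" "(\<alpha> w z, i) \<in> V"
      then have "i = 0"
        using V(3) by auto
      then show "(\<alpha> w z, i) \<in> m ` P"
        using P(8)[rule_format, OF p, of "(w, 0)"] w z by auto
    qed
    have "cube_count V z n \<le> cube_count (m ` P) z n"
      unfolding cube_count_def by (rule card_mono[OF finite_cube_count[OF finmP] sub])
    also have "\<dots> \<le> cube_count U z (n + n)"
    proof (rule cube_count_inj)
      show "inj_on (inv_into P m) (m ` P)"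
        by (rule inj_on_inv_into) simp
      show "inv_into P m ` (m ` P) \<subseteq> U"
        using P(1,5) by auto
      show "\<exists>s\<in>cube n \<times> UNIV. inv_into P m q = layer_act \<alpha> s q" if q: "q \<in> m ` P" for q
      proof -
        obtain p where p: "p \<in> P" "q = m p"
          using q by blast
        obtain s where s: "s \<in> cube n \<times> {0}" "m p = layer_act \<alpha> s p"
          using P(7) p by blast
        have "inv_into P m q = layer_act \<alpha> (- s) q"
          using p(1) P(5) T.act_minus_left[of s p] unfolding p(2) by (metis inv_into_f_f s(2))
        moreover have "- s \<in> cube n \<times> UNIV"
          using s by (auto simp: cube_uminus)
        ultimately show ?thesis
          by (intro bexI[of _ "- s"])
      qed
    qed (rule finU)
    finally show False
      using count[of z] by simp
  qed
  then show ?thesis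
    using that P by blast
qed

lemma comparison:
  assumes U: "open U" "closed U" and V: "open V" "closed V"
    and f: "continuous_on UNIV f" "\<And>z. 0 \<le> f z" "f \<noteq> (\<lambda>_. 0)"
    and b: "(\<lambda>z. indicator V z - indicator U z - f z) \<in> coboundary_subgroup \<alpha>"
  obtains g where "pwt U g" "inj_on g U" "g ` U \<subseteq> V"
proof -
  have finf: "finite (range f)"
    by (rule finite_range_int[OF compact_UNIV f(1)])
  \<comment> \<open>Layer 0 holds \<open>U0\<close> and \<open>V0\<close>, and the layers below
    \<open>M\<close> hold the token set \<open>F\<close> of \<open>f\<close>; the coboundary is
    represented from layer \<open>M\<close> upwards, clear of both.\<close>
  define M where "M = Max (insert 1 (range f)) + 1"
  have "1 \<le> Max (insert 1 (range f))" "f z \<le> Max (insert 1 (range f))" for z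
    by (rule Max_ge; use finf in simp)+
  then have M: "1 < M" "f z < M" for z
    by (simp_all add: M_def zle_add1_eq_le)
  define U0 where "U0 = U \<times> {0 :: int}"
  define V0 where "V0 = V \<times> {0 :: int}"
  define F where "F = {(z, i :: int). 1 \<le> i \<and> i \<le> f z}"
  have U0: "open U0" "compact U0" and V0: "open V0" "compact V0"
    unfolding U0_def V0_def by (intro clopen_layer U V)+
  have F_eq: "F = (\<Union>i\<in>{1..M}. {z. f z \<in> {i..}} \<times> {i})"
  proof
    show "F \<subseteq> (\<Union>i\<in>{1..M}. {z. f z \<in> {i..}} \<times> {i})"
    proof clarify
      fix z i assume "(z, i) \<in> F"
      then show "(z, i) \<in> (\<Union>i\<in>{1..M}. {z. f z \<in> {i..}} \<times> {i})"
        using M(2)[of z] by (auto simp: F_def)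
    qed
  qed (auto simp: F_def)
  have F: "open F" "compact F"
    unfolding F_eq using clopen_vimage_int[OF f(1)]
    by (intro open_UN compact_UN ballI clopen_layer finite_atLeastAtMost_int; blast)+
  obtain C c where C: "\<forall>p\<in>C. M \<le> snd p" "\<forall>p\<in>C. M \<le> snd (c p)" "open C" "compact C"
    "T.pwt C c" "inj_on c C"
    "\<forall>z. indicator V z - indicator U z - f z = int (fibre_count C z) - int (fibre_count (c ` C) z)"
    using coboundary_representation[OF b, of M] by (elim exE conjE) (rule that)
  define X where "X = U0 \<union> F"
  have X: "open X" "compact X"
    unfolding X_def using U0 F by auto
  have disjX: "X \<inter> C = {}" "X \<inter> c ` C = {}" "V0 \<inter> c ` C = {}" "V0 \<inter> C = {}"
  proof -
    have "snd p < M" if "p \<in> X \<union> V0" for p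
      using that M by (auto simp: X_def U0_def V0_def F_def intro: order_le_less_trans)
    moreover have "M \<le> snd p" if "p \<in> C \<union> c ` C" for p
      using that C(1,2) by blast
    ultimately have "p \<notin> X \<union> V0" if "p \<in> C \<union> c ` C" for p
      using that linorder_not_le by blast
    then show "X \<inter> C = {}" "X \<inter> c ` C = {}" "V0 \<inter> c ` C = {}" "V0 \<inter> C = {}"
      by blast+
  qed
  have cC: "open (c ` C)" "compact (c ` C)"
    by (rule T.pwt_open_image[OF C(5)], rule T.pwt_compact_image[OF C(5,4)])
  \<comment> \<open>The coboundary relation with its negative terms moved across, so that both sides
    count tokens.\<close>
  have fc: "fibre_count (X \<union> C) z = fibre_count (V0 \<union> c ` C) z" for z
  proof -
    have "int (fibre_count F z) = f z"
    proof -
      have "{i. (z, i) \<in> F} = {1..f z}"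
        by (auto simp: F_def)
      then show ?thesis
        using f(2)[of z] by (simp add: fibre_count_def)
    qed
    moreover have "U0 \<inter> F = {}"
      by (auto simp: U0_def F_def)
    then have "fibre_count (X \<union> C) z = fibre_count U0 z + fibre_count F z + fibre_count C z"
      unfolding X_def[symmetric] using disjX
      by (simp add: fibre_count_Un finite_layers U0 F C X) (simp add: X_def fibre_count_Un finite_layers U0 F)
    moreover have "fibre_count (V0 \<union> c ` C) z = fibre_count V0 z + fibre_count (c ` C) z"
      using disjX by (simp add: fibre_count_Un finite_layers V0 cC)
    moreover have "int (fibre_count U0 z) = indicator U z" "int (fibre_count V0 z) = indicator V z"
      unfolding U0_def V0_def by (rule fibre_count_layer)+
    ultimately have "int (fibre_count (X \<union> C) z) = int (fibre_count (V0 \<union> c ` C) z)"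
      using C(7)[rule_format, of z] by simp
    then show ?thesis
      by simp
  qed
  obtain e where e: "T.pwt (X \<union> C) e" "bij_betw e (X \<union> C) (V0 \<union> c ` C)"
    using fibre_bijection[of "X \<union> C" "V0 \<union> c ` C"] fc X C V0 cC by (metis compact_Un open_Un)
  \<comment> \<open>Undoing \<open>c\<close> turns the fibrewise bijection \<open>e\<close> into a
    map from \<open>X \<union> C\<close> to \<open>V0 \<union> C\<close>, which can be iterated as
    long as it stays in \<open>C\<close>.\<close>
  define r where "r p = (if p \<in> V0 then id p else inv_into C c p)" for p
  have r: "T.pwt (V0 \<union> c ` C) r"
    unfolding r_def
    by (rule pw_translation_if[OF T.pwt_id[OF V0(1)] T.pwt_inv_into[OF C(5,6)] disjX(3)])
  have r_img: "r ` V0 = V0" "r ` (c ` C) = C"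
  proof -
    show "r ` V0 = V0"
      by (simp add: r_def)
    have "r ` (c ` C) = inv_into C c ` (c ` C)"
      by (rule image_cong) (use disjX in \<open>auto simp: r_def\<close>)
    then show "r ` (c ` C) = C"
      using C(6) by simp
  qed
  have r_inj: "inj_on r (V0 \<union> c ` C)"
    unfolding r_def[abs_def]
    by (rule inj_on_disjoint_Un) (use C(6) disjX(4) in \<open>auto intro: inj_on_inv_into\<close>)
  define g where "g p = r (e p)" for p
  have g: "T.pwt (X \<union> C) g" "inj_on g (X \<union> C)" "g ` (X \<union> C) \<subseteq> V0 \<union> C"
  proof -
    have im: "e ` (X \<union> C) = V0 \<union> c ` C"
      using e(2) by (simp add: bij_betw_def)
    show "T.pwt (X \<union> C) g"
      unfolding g_def by (rule T.pwt_comp[OF e(1) r]) (simp add: im)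
    have "inj_on (r \<circ> e) (X \<union> C)"
      using e(2) r_inj im by (intro comp_inj_on) (auto simp: bij_betw_def)
    then show "inj_on g (X \<union> C)"
      by (simp add: comp_def g_def[abs_def])
    have "g ` (X \<union> C) = r ` (V0 \<union> c ` C)"
      unfolding g_def[abs_def] im[symmetric] by (simp add: image_image)
    then show "g ` (X \<union> C) \<subseteq> V0 \<union> C"
      by (simp add: image_Un r_img)
  qed
  obtain R where R: "\<And>z n. card (cube n :: (int ^ 'd) set) \<le> card (cube R :: (int ^ 'd) set) * cube_count F z (n + R)"
    using support_density[OF f] finite_layers[OF F(2)] unfolding F_def by metis
  define \<gamma> where "\<gamma> = card (snd ` C)"
  define \<rho> where "\<rho> = card (cube R :: (int ^ 'd) set)"
  \<comment> \<open>\<open>K * G\<close> is \<open>(6 * (n + 1)) ^ d\<close>, which bounds all the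
    cubes used in the upper estimates; \<open>K\<close> itself does not depend on the radius
    \<open>n\<close>.\<close>
  define K :: nat where "K = 6 ^ CARD('d)"
  \<comment> \<open>One more than the bound that a failure of the final strict inequality would put
    on \<open>L\<close>. It involves none of the later \<open>D\<close>, \<open>D'\<close> and
    \<open>n\<close>.\<close>
  define L where "L = 2 * \<rho> * \<gamma> * K + 1"
  obtain X' m where X': "X' \<subseteq> X" "open X'" "compact X'"
    and m: "T.pwt (X - X') m" "inj_on m (X - X')" "m ` (X - X') \<subseteq> V0"
    and it: "\<And>k. k \<in> {1..L} \<Longrightarrow> T.pwt X' (g ^^ k)" "inj_on (\<lambda>(k, p). (g ^^ k) p) ({1..L} \<times> X')"
      "\<And>k. k \<in> {1..L} \<Longrightarrow> (g ^^ k) ` X' \<subseteq> C"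
    using T.exit_map[OF g disjX(1) X C(3) compact_imp_closed_layers[OF C(4)], of L] by metis
  have XX': "open (X - X')" "compact (X - X')"
    using X X' compact_imp_closed_layers by (auto intro: compact_diff)
  obtain D' where D': "\<And>p E. p \<in> X - X' \<Longrightarrow> D' \<le> E \<Longrightarrow> \<exists>s\<in>cube E \<times> UNIV. m p = layer_act \<alpha> s p"
    using bounded_displacement[OF m(1) XX'(2)] by metis
  have "\<forall>k\<in>{1..L}. \<exists>D. \<forall>p E. p \<in> X' \<longrightarrow> D \<le> E \<longrightarrow> (\<exists>s\<in>cube E \<times> UNIV. (g ^^ k) p = layer_act \<alpha> s p)"
    using bounded_displacement[OF it(1) X'(3)] by metis
  then obtain Dk where Dk: "\<And>k p E. k \<in> {1..L} \<Longrightarrow> p \<in> X' \<Longrightarrow> Dk k \<le> E \<Longrightarrow> \<exists>s\<in>cube E \<times> UNIV. (g ^^ k) p = layer_act \<alpha> s p"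
    by metis
  \<comment> \<open>The sum dominates each summand, so one radius serves all \<open>L\<close>
    iterates.\<close>
  define D where "D = (\<Sum>k\<in>{1..L}. Dk k)"
  have packX': "L * cube_count X' z n \<le> \<gamma> * card (cube (n + D) :: (int ^ 'd) set)" for z n
  proof -
    have "card {1..L} * cube_count X' z n \<le> cube_count C z (n + D)"
    proof (rule cube_count_packing[where g = "\<lambda>k. g ^^ k"])
      show "\<exists>s\<in>cube D \<times> UNIV. (g ^^ k) p = layer_act \<alpha> s p" if "k \<in> {1..L}" "p \<in> X'" for k p
        using that by (intro Dk) (auto simp: D_def intro: member_le_sum)
    qed (use it finite_layers C in \<open>auto simp: image_subset_iff\<close>)
    also have "\<dots> \<le> \<gamma> * card (cube (n + D) :: (int ^ 'd) set)"
      unfolding \<gamma>_def by (rule cube_count_le[OF finite_layers[OF C(4)]])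
    finally show ?thesis
      by simp
  qed
  \<comment> \<open>From \<open>n \<ge> 2 * (D' + R)\<close> the cube of radius
    \<open>n - D' - R\<close> has at least \<open>G\<close> points; from \<open>n \<ge> D\<close>
    the radius \<open>n + n + D\<close> stays within the range of the estimate
    \<open>K\<close>.\<close>
  define n where "n = 2 * (D + D' + R)"
  define G :: nat where "G = (n + 1) ^ CARD('d)"
  have G: "0 < G"
    by (simp add: G_def)
  have K: "card (cube k :: (int ^ 'd) set) \<le> K * G" if "2 * k + 1 \<le> 6 * (n + 1)" for k
    unfolding K_def G_def card_cube power_mult_distrib[symmetric] using that by (rule power_mono) simp
  \<comment> \<open>\<open>U'\<close> is the part of \<open>U\<close> still trapped in
    \<open>C\<close> after \<open>L\<close> steps, and \<open>V'\<close> is what the exits of the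
    rest of \<open>U\<close> leave free.\<close>
  define U' where "U' = U0 \<inter> X'"
  define V' where "V' = V0 - m ` (U0 - X')"
  have U': "open U'" "compact U'"
    unfolding U'_def using U0 X' compact_imp_closed_layers by (auto intro: compact_Int_closed)
  have UX': "open (U0 - X')" "compact (U0 - X')" "U0 - X' \<subseteq> X - X'"
    using U0 X' compact_imp_closed_layers by (auto intro: compact_diff simp: X_def)
  have mU: "T.pwt (U0 - X') m" "inj_on m (U0 - X')"
    using pw_translation_subset[OF m(1)] inj_on_subset[OF m(2)] UX' by auto
  have V': "open V'" "compact V'"
    unfolding V'_def using V0 T.pwt_open_image[OF mU(1)] T.pwt_compact_image[OF mU(1) UX'(2)] compact_imp_closed_layers
    by (auto intro: compact_diff)
  have U'_count: "L * cube_count U' z (n + n) \<le> \<gamma> * K * G" for z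
  proof -
    have "L * cube_count U' z (n + n) \<le> L * cube_count X' z (n + n)"
      by (intro mult_left_mono cube_count_mono finite_layers X') (auto simp: U'_def)
    also have "\<dots> \<le> \<gamma> * card (cube (n + n + D) :: (int ^ 'd) set)"
      by (rule packX')
    also have "\<dots> \<le> \<gamma> * (K * G)"
      by (intro mult_left_mono K) (auto simp: n_def)
    finally show ?thesis
      by (simp add: mult.assoc)
  qed
  \<comment> \<open>The tokens of \<open>F\<close> are dense, and those outside \<open>X'\<close>
    exit into \<open>V0\<close>. Injectivity of \<open>m\<close> separates their exits from those of
    \<open>U0 - X'\<close>, so they land in \<open>V'\<close>. Multiplying by \<open>L\<close> lets
    the packing bound on \<open>X'\<close> enter without division.\<close>
  have V'_count: "L * G \<le> \<rho> * (L * cube_count V' z n) + \<rho> * (\<gamma> * K * G)" for z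
  proof -
    have "G \<le> card (cube (n - D' - R) :: (int ^ 'd) set)"
      unfolding G_def card_cube by (rule power_mono) (auto simp: n_def)
    also have "\<dots> \<le> \<rho> * cube_count F z (n - D' - R + R)"
      unfolding \<rho>_def by (rule R)
    also have "n - D' - R + R = n - D'"
      by (simp add: n_def)
    also have "cube_count F z (n - D') \<le> cube_count (F - X') z (n - D') + cube_count X' z (n - D')"
      by (intro cube_count_Diff finite_layers F X')
    also have "cube_count (F - X') z (n - D') \<le> cube_count V' z (n - D' + D')"
    proof (rule cube_count_inj)
      show "inj_on m (F - X')"
        by (rule inj_on_subset[OF m(2)]) (auto simp: X_def)
      have disj: "(F - X') \<inter> (U0 - X') = {}"
        by (auto simp: F_def U0_def)
      have "m ` (F - X') \<inter> m ` (U0 - X') = m ` ((F - X') \<inter> (U0 - X'))"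
        by (rule inj_on_image_Int[OF m(2), symmetric]) (auto simp: X_def)
      then show "m ` (F - X') \<subseteq> V'"
        using m(3) unfolding disj by (auto simp: V'_def X_def)
      show "\<exists>s\<in>cube D' \<times> UNIV. m p = layer_act \<alpha> s p" if "p \<in> F - X'" for p
        using D'[of p D'] that by (auto simp: X_def)
      show "finite (snd ` V')"
        by (rule finite_layers[OF V'(2)])
    qed
    also have "n - D' + D' = n"
      by (simp add: n_def)
    finally have "G \<le> \<rho> * (cube_count V' z n + cube_count X' z (n - D'))"
      by simp
    then have "L * G \<le> L * (\<rho> * (cube_count V' z n + cube_count X' z (n - D')))"
      by (rule mult_left_mono) simp
    also have "\<dots> = \<rho> * (L * cube_count V' z n) + \<rho> * (L * cube_count X' z (n - D'))"
      by (simp add: algebra_simps)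
    also have "L * cube_count X' z (n - D') \<le> \<gamma> * (K * G)"
    proof -
      have "\<gamma> * card (cube (n - D' + D) :: (int ^ 'd) set) \<le> \<gamma> * (K * G)"
        by (intro mult_left_mono K) (auto simp: n_def)
      then show ?thesis
        using packX'[of z "n - D'"] by (rule order_trans[rotated])
    qed
    finally show ?thesis
      by (simp add: mult.assoc)
  qed
  \<comment> \<open>Otherwise both estimates combine to
    \<open>L \<le> 2 * \<rho> * \<gamma> * K\<close>.\<close>
  have count: "cube_count U' z (n + n) < cube_count V' z n" for z
  proof (rule ccontr)
    assume "\<not> ?thesis"
    then have "L * cube_count V' z n \<le> L * cube_count U' z (n + n)"
      by simp
    also have "\<dots> \<le> \<gamma> * K * G"
      by (rule U'_count)
    finally have "\<rho> * (L * cube_count V' z n) \<le> \<rho> * (\<gamma> * K * G)"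
      by (rule mult_left_mono) simp
    then have "L * G \<le> \<rho> * (\<gamma> * K * G) + \<rho> * (\<gamma> * K * G)"
      using V'_count[of z] by linarith
    also have "\<dots> = (2 * \<rho> * \<gamma> * K) * G"
      by (simp add: algebra_simps)
    finally have "L \<le> 2 * \<rho> * \<gamma> * K"
      using G by simp
    then show False
      by (simp add: L_def)
  qed
  obtain m' where m': "T.pwt U' m'" "inj_on m' U'" "m' ` U' \<subseteq> V'"
  proof (rule sparse_embedding[OF U' _ V' _ count])
    show "U' \<subseteq> UNIV \<times> {0}" "V' \<subseteq> UNIV \<times> {0}"
      by (auto simp: U'_def V'_def U0_def V0_def)
  qed
  define h where "h p = (if p \<in> U' then m' p else m p)" for p
  have UU: "U0 = U' \<union> (U0 - X')" "U' \<inter> (U0 - X') = {}"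
    by (auto simp: U'_def)
  have hU: "h ` U' = m' ` U'" "h ` (U0 - X') = m ` (U0 - X')"
    using UU(2) by (auto simp: h_def intro!: image_cong)
  have "T.pwt (U' \<union> (U0 - X')) h"
    unfolding h_def by (rule pw_translation_if) (use m' mU UU in auto)
  then have h1: "T.pwt U0 h"
    using UU(1) by simp
  have "inj_on h (U' \<union> (U0 - X'))"
    unfolding h_def[abs_def]
    by (rule inj_on_disjoint_Un[OF m'(2) mU(2)]) (use m'(3) in \<open>auto simp: V'_def\<close>)
  then have h2: "inj_on h U0"
    using UU(1) by simp
  have "m ` (U0 - X') \<subseteq> V0"
    using m(3) UX'(3) by blast
  moreover have "m' ` U' \<subseteq> V0"
    using m'(3) by (auto simp: V'_def)
  ultimately have "h ` (U' \<union> (U0 - X')) \<subseteq> V0"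
    unfolding image_Un hU by blast
  then have h3: "h ` U0 \<subseteq> V0"
    using UU(1) by simp
  show ?thesis
  proof (rule that)
    show "pwt U (\<lambda>z. fst (h (z, 0)))"
      using h1 h3 unfolding U0_def V0_def by (rule layer_translation)
    have hz: "h (z, 0) = (fst (h (z, 0)), 0)" "fst (h (z, 0)) \<in> V" if "z \<in> U" for z
      using h3 that unfolding U0_def V0_def by (auto simp: image_subset_iff mem_Times_iff prod_eq_iff)
    show "inj_on (\<lambda>z. fst (h (z, 0))) U"
    proof (rule inj_onI)
      fix y z assume "y \<in> U" "z \<in> U" "fst (h (y, 0)) = fst (h (z, 0))"
      then have "h (y, 0) = h (z, 0)"
        using hz(1) by metis
      then show "y = z"
        using h2 \<open>y \<in> U\<close> \<open>z \<in> U\<close> by (auto simp: U0_def inj_on_def)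
    qed
    show "(\<lambda>z. fst (h (z, 0))) ` U \<subseteq> V"
      using hz by auto
  qed
qed

end

subsection \<open>Coboundaries and the back-and-forth construction\<close>

context free_minimal_action
begin

section \<open>The subgroup of coboundaries\<close>

lemma coboundary_generator_continuous:
  assumes "open A" "closed A"
  shows "continuous_on UNIV (\<lambda>x. indicator A x - indicator (\<alpha> v ` A) x :: int)"
  using assms open_act_image closed_act_image
  by (rule_tac continuous_int_binop[of "indicator A" "indicator (\<alpha> v ` A)" "(-)"])
    (auto intro: continuous_indicator_clopen)

lemma coboundary_generator:
  "open A \<Longrightarrow> closed A \<Longrightarrow> (\<lambda>x. indicator A x - indicator (\<alpha> v ` A) x) \<in> coboundary_subgroup \<alpha>"
  unfolding coboundary_subgroup_def by (rule generate.incl) blast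

lemma subgroup_coboundary: "subgroup (coboundary_subgroup \<alpha>) cont_int_group"
  unfolding coboundary_subgroup_def
  by (rule cont_int.generate_is_subgroup) (use coboundary_generator_continuous in \<open>auto simp: cont_int_group_def\<close>)

lemma coboundary_continuous: "b \<in> coboundary_subgroup \<alpha> \<Longrightarrow> continuous_on UNIV b"
  using subgroup.subset[OF subgroup_coboundary] by (auto simp: cont_int_group_def)

lemma coboundary_zero: "(\<lambda>x. 0) \<in> coboundary_subgroup \<alpha>"
  using subgroup.one_closed[OF subgroup_coboundary] by (simp add: cont_int_group_def)

lemma coboundary_add:
  "b \<in> coboundary_subgroup \<alpha> \<Longrightarrow> c \<in> coboundary_subgroup \<alpha> \<Longrightarrow> (\<lambda>x. b x + c x) \<in> coboundary_subgroup \<alpha>"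
  using subgroup.m_closed[OF subgroup_coboundary] by (simp add: cont_int_group_def)

lemma coboundary_minus: "b \<in> coboundary_subgroup \<alpha> \<Longrightarrow> (\<lambda>x. - b x) \<in> coboundary_subgroup \<alpha>"
  using subgroup.m_inv_closed[OF subgroup_coboundary, of b] cont_int_inv[OF coboundary_continuous, of b]
  by simp

lemma coboundary_diff:
  "b \<in> coboundary_subgroup \<alpha> \<Longrightarrow> c \<in> coboundary_subgroup \<alpha> \<Longrightarrow> (\<lambda>x. b x - c x) \<in> coboundary_subgroup \<alpha>"
  using coboundary_add[OF _ coboundary_minus, of b c] by simp

lemma coboundary_sum:
  "finite S \<Longrightarrow> (\<And>s. s \<in> S \<Longrightarrow> b s \<in> coboundary_subgroup \<alpha>) \<Longrightarrow> (\<lambda>x. \<Sum>s\<in>S. b s x) \<in> coboundary_subgroup \<alpha>"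
  by (induction S rule: finite_induct) (auto intro: coboundary_zero coboundary_add)

text \<open>By freeness the local translation at \<open>p\<close> is determined by the value of
  \<open>g\<close> at \<open>p\<close>, so agreement with \<open>\<alpha> s\<close> at a point
  spreads to a neighbourhood.\<close>

lemma translation_piece:
  assumes "pwt A g"
  shows "open {p\<in>A. g p = \<alpha> s p}"
proof (rule topological_space_class.openI)
  fix p assume p: "p \<in> {p\<in>A. g p = \<alpha> s p}"
  then obtain t U where U: "open U" "p \<in> U" "U \<subseteq> A" "\<And>q. q \<in> U \<Longrightarrow> g q = \<alpha> t q"
    using assms by (auto elim: pw_translationE)
  then have "t = s"
    using p by fastforce
  then have "U \<subseteq> {p\<in>A. g p = \<alpha> s p}"
    using U by auto
  then show "\<exists>T. open T \<and> p \<in> T \<and> T \<subseteq> {p\<in>A. g p = \<alpha> s p}"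
    using U by blast
qed

text \<open>Finitely many pieces, on each of which \<open>g\<close> is one translation, give a sum
  of generators. Each piece is open and is the complement in \<open>A\<close> of the other pieces,
  hence clopen; injectivity keeps the images disjoint.\<close>

lemma pw_translation_coboundary:
  assumes A: "open A" "closed A" and g: "pwt A g" "inj_on g A"
  shows "(\<lambda>z. indicator A z - indicator (g ` A) z) \<in> coboundary_subgroup \<alpha>"
proof -
  obtain S where S: "finite S" "\<And>p. p \<in> A \<Longrightarrow> \<exists>s\<in>S. g p = \<alpha> s p"
    using pw_translation_finite[OF g(1) clopen_imp_compact[OF A(2)]] by blast
  define P where "P s = {p\<in>A. g p = \<alpha> s p}" for s
  have P_open: "open (P s)" for s
    unfolding P_def by (rule translation_piece[OF g(1)])
  have P_closed: "closed (P s)" if "s \<in> S" for s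
  proof -
    have "P s = A - (\<Union>t\<in>S - {s}. P t)"
      using S that by (auto simp: P_def)
    also have "closed \<dots>"
      by (intro closed_Diff A open_UN ballI P_open)
    finally show ?thesis .
  qed
  have indA: "indicator A z = (\<Sum>s\<in>S. indicator (P s) z :: int)" for z
  proof (cases "z \<in> A")
    case True
    then obtain s where s: "s \<in> S" "g z = \<alpha> s z"
      using S(2) by blast
    have "(\<Sum>t\<in>S. indicator (P t) z :: int) = (\<Sum>t\<in>S. if t = s then 1 else 0)"
      by (rule sum.cong) (use s True in \<open>auto simp: P_def indicator_def\<close>)
    then show ?thesis
      using s S(1) True by simp
  next
    case False
    then show ?thesis
      by (simp add: P_def)
  qed
  have indgA: "indicator (g ` A) z = (\<Sum>s\<in>S. indicator (\<alpha> s ` P s) z :: int)" for z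
  proof (cases "z \<in> g ` A")
    case True
    then obtain y where y: "y \<in> A" "z = g y"
      by auto
    then obtain s where s: "s \<in> S" "g y = \<alpha> s y"
      using S(2) by blast
    have mem: "z \<in> \<alpha> t ` P t \<longleftrightarrow> t = s" for t
    proof
      assume "z \<in> \<alpha> t ` P t"
      then obtain x where x: "x \<in> A" "g x = \<alpha> t x" "z = \<alpha> t x"
        by (auto simp: P_def)
      then have "x = y"
        using g(2) y by (metis inj_onD)
      then show "t = s"
        using x s y by simp
    next
      assume "t = s"
      then show "z \<in> \<alpha> t ` P t"
        using s y by (auto simp: P_def)
    qed
    have "(\<Sum>t\<in>S. indicator (\<alpha> t ` P t) z :: int) = (\<Sum>t\<in>S. if t = s then 1 else 0)"
      by (rule sum.cong) (simp_all add: indicator_def mem)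
    then show ?thesis
      using s S(1) True by simp
  next
    case False
    have "z \<notin> \<alpha> s ` P s" for s
    proof
      assume "z \<in> \<alpha> s ` P s"
      then obtain x where "x \<in> A" "g x = z"
        by (auto simp: P_def)
      then show False
        using False by auto
    qed
    then show ?thesis
      using False by simp
  qed
  have "(\<lambda>z. \<Sum>s\<in>S. indicator (P s) z - indicator (\<alpha> s ` P s) z) \<in> coboundary_subgroup \<alpha>"
    by (intro coboundary_sum S coboundary_generator P_open P_closed)
  then show ?thesis
    by (simp add: indA indgA sum_subtractf)
qed

text \<open>If the indicator were a coboundary, so would be minus its double. Read as
  \<open>0 - 1 - 1\<close> on \<open>C\<close>, this is the hypothesis of \<open>comparison\<close>
  with \<open>V\<close> empty and surplus \<open>indicator C\<close>, which would embed
  \<open>C\<close> into the empty set.\<close>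

lemma indicator_not_coboundary:
  assumes "open C" "closed C" "C \<noteq> {}"
  shows "indicator C \<notin> coboundary_subgroup \<alpha>"
proof
  assume "indicator C \<in> coboundary_subgroup \<alpha>"
  then have "(\<lambda>z. - (indicator C z + indicator C z)) \<in> coboundary_subgroup \<alpha>"
    by (intro coboundary_minus coboundary_add)
  moreover have "(\<lambda>z. - (indicator C z + indicator C z)) = (\<lambda>z. indicator {} z - indicator C z - (indicator C z :: int))"
    by auto
  ultimately have b: "(\<lambda>z. indicator {} z - indicator C z - indicator C z) \<in> coboundary_subgroup \<alpha>"
    by simp
  have nonzero: "indicator C \<noteq> (\<lambda>_. 0 :: int)"
    using assms(3) by (metis all_not_in_conv indicator_simps(1) zero_neq_one)
  obtain g where "pwt C g" "g ` C \<subseteq> {}"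
    by (rule comparison[OF assms(1,2) open_empty closed_empty
          continuous_indicator_clopen[OF assms(1,2)] _ nonzero b]) (auto simp: indicator_def)
  then show False
    using assms(3) by auto
qed

text \<open>An open singleton would, by minimality and compactness, make the whole space finite,
  although free orbits are infinite.\<close>

lemma infinite_open:
  assumes "open (U :: 'c set)" "a \<in> U"
  obtains b where "b \<in> U" "b \<noteq> a"
proof -
  have "U \<noteq> {a}"
  proof
    assume U: "U = {a}"
    have "(UNIV :: 'c set) \<subseteq> (\<Union>v\<in>UNIV. \<alpha> v -` {a})"
      using minimal[OF assms(1)] U by auto
    then obtain S where S: "finite S" "UNIV \<subseteq> (\<Union>v\<in>S. \<alpha> v -` {a})"
      using compactE_image[OF compact_UNIV, of UNIV "\<lambda>v. \<alpha> v -` {a}"] open_act_vimage[OF assms(1)] U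
      by (metis (no_types, lifting))
    have "finite (\<alpha> v -` {a})" for v
      by (simp add: act_vimage)
    then have "finite (UNIV :: 'c set)"
      using S by (meson finite_UN_I finite_subset)
    then have "finite (range (\<lambda>v. \<alpha> v a))"
      by (rule finite_subset[rotated]) simp
    moreover have "inj (\<lambda>v. \<alpha> v a)"
      by (simp add: inj_def)
    ultimately have "finite (UNIV :: (int ^ 'd) set)"
      by (rule finite_imageD)
    \<comment> \<open>Constant vectors embed the integers, since an index type is never
      empty.\<close>
    moreover have "inj (\<lambda>k :: int. \<chi> i :: 'd. k)"
      by (simp add: inj_def vec_eq_iff)
    ultimately have "finite (UNIV :: int set)"
      by (metis finite_subset finite_imageD subset_UNIV)
    then show False
      by simp
  qed
  then show ?thesis
    using assms(2) that by blast
qed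

text \<open>The condition \<open>inf_close A B\<close> is the instance \<open>n = 1\<close> of \<open>[1\<^sub>A] - [1\<^sub>B]\<close> being infinitesimal, with
  \<open>h\<close> the class of the indicator of a nonempty clopen set \<open>C\<close>.\<close>

definition inf_close :: "'c set \<Rightarrow> 'c set \<Rightarrow> bool" where
  "inf_close A B \<longleftrightarrow>
     (\<forall>C. open C \<longrightarrow> closed C \<longrightarrow> C \<noteq> {} \<longrightarrow>
        (\<exists>f. continuous_on UNIV f \<and> (\<forall>z. 0 \<le> f z) \<and> f \<noteq> (\<lambda>_. 0) \<and>
           (\<lambda>z. indicator C z + indicator B z - indicator A z - f z) \<in> coboundary_subgroup \<alpha>))"

lemma inf_closeE:
  assumes "inf_close A B" "open C" "closed C" "C \<noteq> {}"
  obtains f where "continuous_on UNIV f" "\<forall>z. 0 \<le> f z" "f \<noteq> (\<lambda>_. 0)"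
    "(\<lambda>z. indicator C z + indicator B z - indicator A z - f z) \<in> coboundary_subgroup \<alpha>"
  using assms(1)[unfolded inf_close_def, rule_format, OF assms(2-4)] that by (elim exE conjE)

text \<open>Closeness depends on the difference of the two classes alone, so it survives the removal
  of matched pieces from both sets.\<close>

lemma inf_close_cong:
  assumes AB: "inf_close A B"
    and b: "(\<lambda>z. (indicator A z - indicator B z) - (indicator A' z - indicator B' z)) \<in> coboundary_subgroup \<alpha>"
  shows "inf_close A' B'"
  unfolding inf_close_def
proof (intro allI impI)
  fix C :: "'c set" assume "open C" "closed C" "C \<noteq> {}"
  then obtain f where f: "continuous_on UNIV f" "\<forall>z. 0 \<le> f z" "f \<noteq> (\<lambda>_. 0)"
    "(\<lambda>z. indicator C z + indicator B z - indicator A z - f z) \<in> coboundary_subgroup \<alpha>"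
    by (rule inf_closeE[OF AB])
  have "(\<lambda>z. (indicator C z + indicator B z - indicator A z - f z) +
      ((indicator A z - indicator B z) - (indicator A' z - indicator B' z))) \<in> coboundary_subgroup \<alpha>"
    by (rule coboundary_add[OF f(4) b])
  moreover have "(\<lambda>z. (indicator C z + indicator B z - indicator A z - f z) +
      ((indicator A z - indicator B z) - (indicator A' z - indicator B' z))) =
      (\<lambda>z. indicator C z + indicator B' z - indicator A' z - f z)"
    by auto
  ultimately show "\<exists>f. continuous_on UNIV f \<and> (\<forall>z. 0 \<le> f z) \<and> f \<noteq> (\<lambda>_. 0) \<and>
      (\<lambda>z. indicator C z + indicator B' z - indicator A' z - f z) \<in> coboundary_subgroup \<alpha>"
    using f by auto
qed

end

section \<open>Matching the complements of shrinking neighbourhoods\<close>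

text \<open>The sequences of neighbourhoods along which the back-and-forth construction shrinks.
  They are not assumed to decrease; each is intersected with the current set.\<close>

locale cantor_action = free_minimal_action \<alpha>
  for \<alpha> :: "int ^ 'd::finite \<Rightarrow> 'c::topological_space \<Rightarrow> 'c" +
  assumes clopen_base: "\<exists>N :: nat \<Rightarrow> 'c set. (\<forall>n. open (N n) \<and> closed (N n) \<and> z \<in> N n) \<and>
    (\<forall>U. open U \<longrightarrow> z \<in> U \<longrightarrow> (\<exists>n. N n \<subseteq> U))"
begin

lemma closed_singleton_base: "closed {z :: 'c}"
  by (rule compact_imp_closed_base) simp

text \<open>To keep \<open>b0\<close> unmatched, a neighbourhood \<open>E\<close> of it is set aside
  in \<open>B\<close>, chosen so small that a translate of \<open>E\<close> fits into
  \<open>A'\<close> with a nonempty remainder \<open>C\<close>. Thus \<open>B - E\<close> exceeds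
  \<open>A - A'\<close> by \<open>C\<close> up to an infinitesimal, which is the surplus that
  \<open>comparison\<close> needs.\<close>

lemma half_step:
  assumes A: "open A" "closed A" and B: "open B" "closed B" "b0 \<in> B"
    and A': "open A'" "closed A'" "A' \<subseteq> A" "A' \<noteq> {}"
    and close: "inf_close A B" "inf_close B A"
  obtains B' g where "open B'" "closed B'" "B' \<subseteq> B" "b0 \<in> B'" "pwt (A - A') g"
    "bij_betw g (A - A') (B - B')" "inf_close A' B'" "inf_close B' A'"
proof -
  obtain w where w: "\<alpha> w b0 \<in> A'"
    using minimal[OF A'(1,4)] by blast
  \<comment> \<open>A second point of \<open>A'\<close>, to be kept out of the translate of
    \<open>E\<close>; it witnesses that \<open>C\<close> is nonempty.\<close>
  obtain a where a: "a \<in> A'" "a \<noteq> \<alpha> w b0"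
    using infinite_open[OF A'(1) w] by metis
  have "open (- {a})"
    using closed_singleton_base by (simp add: open_Compl)
  then obtain N where N: "open N" "closed N" "\<alpha> w b0 \<in> N" "N \<subseteq> - {a}"
    using clopen_base[of "\<alpha> w b0"] a(2) by (metis ComplI singletonD)
  define E where "E = \<alpha> (- w) ` (A' \<inter> N) \<inter> B"
  have E: "open E" "closed E" "b0 \<in> E" "E \<subseteq> B"
  proof -
    show "open E" "closed E"
      unfolding E_def using A' B N by (auto intro!: open_Int closed_Int open_act_image closed_act_image)
    have "b0 = \<alpha> (- w) (\<alpha> w b0)"
      by simp
    then show "b0 \<in> E"
      unfolding E_def using w N(3) B(3) by blast
    show "E \<subseteq> B"
      by (simp add: E_def)
  qed
  have wE: "\<alpha> w ` E \<subseteq> A' \<inter> N"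
    by (auto simp: E_def)
  define C where "C = A' - \<alpha> w ` E"
  have "open C" "closed C"
    unfolding C_def using A' E by (auto intro!: open_Diff closed_Diff open_act_image closed_act_image)
  moreover have "a \<in> C"
    using a wE N(4) by (auto simp: C_def)
  ultimately obtain f where f: "continuous_on UNIV f" "\<forall>z. 0 \<le> f z" "f \<noteq> (\<lambda>_. 0)"
    "(\<lambda>z. indicator C z + indicator B z - indicator A z - f z) \<in> coboundary_subgroup \<alpha>"
    using inf_closeE[OF close(1)] by blast
  have "(\<lambda>z. (indicator C z + indicator B z - indicator A z - f z) -
      (indicator E z - indicator (\<alpha> w ` E) z)) \<in> coboundary_subgroup \<alpha>"
    by (intro coboundary_diff f coboundary_generator E)
  \<comment> \<open>\<open>A'\<close> splits into \<open>C\<close> and the translate of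
    \<open>E\<close>. Trading that translate for \<open>E\<close> itself, a coboundary, turns the
    surplus relation for \<open>C\<close> into one between \<open>B - E\<close> and
    \<open>A - A'\<close>.\<close>
  moreover have "(indicator C z + indicator B z - indicator A z - f z) - (indicator E z - indicator (\<alpha> w ` E) z) =
      indicator (B - E) z - indicator (A - A') z - f z" for z
  proof -
    have "indicator A' z = indicator C z + (indicator (\<alpha> w ` E) z :: int)"
      using wE by (auto simp: C_def indicator_def)
    moreover have "indicator (B - E) z = indicator B z - (indicator E z :: int)"
      using E(4) by (auto simp: indicator_def)
    moreover have "indicator (A - A') z = indicator A z - (indicator A' z :: int)"
      using A'(3) by (auto simp: indicator_def)
    ultimately show ?thesis
      by simp
  qed
  ultimately have b: "(\<lambda>z. indicator (B - E) z - indicator (A - A') z - f z) \<in> coboundary_subgroup \<alpha>"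
    by simp
  have AA': "open (A - A')" "closed (A - A')" and BE: "open (B - E)" "closed (B - E)"
    using A A' B E by auto
  obtain g where g: "pwt (A - A') g" "inj_on g (A - A')" "g ` (A - A') \<subseteq> B - E"
    by (rule comparison[OF AA' BE f(1) _ f(3) b]) (use f(2) in auto)
  define B' where "B' = B - g ` (A - A')"
  have gB: "g ` (A - A') = B - B'"
    using g(3) by (auto simp: B'_def)
  have "closed (g ` (A - A'))"
    by (rule compact_imp_closed_base[OF pwt_compact_image[OF g(1) clopen_imp_compact[OF AA'(2)]]])
  then have B': "open B'" "closed B'"
    unfolding B'_def using B pwt_open_image[OF g(1)] by auto
  have c: "(\<lambda>z. indicator (A - A') z - indicator (B - B') z) \<in> coboundary_subgroup \<alpha>"
    using pw_translation_coboundary[OF AA' g(1,2)] unfolding gB .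
  have c_eq: "indicator (A - A') z - indicator (B - B') z =
      (indicator A z - indicator B z) - (indicator A' z - (indicator B' z :: int))" for z
  proof -
    have "indicator (B - B') z = indicator B z - (indicator B' z :: int)"
      by (auto simp: indicator_def B'_def)
    moreover have "indicator (A - A') z = indicator A z - (indicator A' z :: int)"
      using A'(3) by (auto simp: indicator_def)
    ultimately show ?thesis
      by simp
  qed
  show ?thesis
  proof (rule that[OF B'])
    show "B' \<subseteq> B" "b0 \<in> B'"
      using B(3) E(3) g(3) by (auto simp: B'_def)
    show "pwt (A - A') g"
      by (rule g)
    show "bij_betw g (A - A') (B - B')"
      using g(2) gB by (simp add: bij_betw_def)
    show "inf_close A' B'"
      by (rule inf_close_cong[OF close(1)]) (use c in \<open>simp add: c_eq\<close>)
    have "(\<lambda>z. - (indicator (A - A') z - indicator (B - B') z)) \<in> coboundary_subgroup \<alpha>"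
      by (rule coboundary_minus[OF c])
    then show "inf_close B' A'"
      by (intro inf_close_cong[OF close(2)]) (simp add: c_eq algebra_simps)
  qed
qed

definition exhaust_state :: "'c \<Rightarrow> 'c \<Rightarrow> 'c set \<Rightarrow> 'c set \<Rightarrow> bool" where
  "exhaust_state a b A B \<longleftrightarrow>
     open A \<and> closed A \<and> open B \<and> closed B \<and> a \<in> A \<and> b \<in> B \<and> inf_close A B \<and> inf_close B A"

text \<open>A half step prescribes the remainder on one side and merely bounds it on the other. Two
  of them in opposite directions, the second one inverted, put both remainders inside given
  neighbourhoods.\<close>

lemma full_step:
  assumes S: "exhaust_state a b A B"
    and N: "open N" "closed N" "a \<in> N" and M: "open M" "closed M" "b \<in> M"
  obtains A1 B1 g where "exhaust_state a b A1 B1" "A1 \<subseteq> A \<inter> N" "B1 \<subseteq> B \<inter> M"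
    "pwt (A - A1) g" "bij_betw g (A - A1) (B - B1)"
proof -
  note S = S[unfolded exhaust_state_def]
  define A' where "A' = A \<inter> N"
  have A': "open A'" "closed A'" "A' \<subseteq> A" "a \<in> A'"
    using S N by (auto simp: A'_def)
  then have "A' \<noteq> {}"
    by auto
  with S A' obtain B' g where B': "open B'" "closed B'" "B' \<subseteq> B" "b \<in> B'" "pwt (A - A') g"
    "bij_betw g (A - A') (B - B')" "inf_close A' B'" "inf_close B' A'"
    using half_step[of A B b A'] by metis
  define B1 where "B1 = B' \<inter> M"
  have B1: "open B1" "closed B1" "B1 \<subseteq> B'" "b \<in> B1"
    using B' M by (auto simp: B1_def)
  then have "B1 \<noteq> {}"
    by auto
  with A' B' B1 obtain A1 h where A1: "open A1" "closed A1" "A1 \<subseteq> A'" "a \<in> A1" "pwt (B' - B1) h"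
    "bij_betw h (B' - B1) (A' - A1)" "inf_close B1 A1" "inf_close A1 B1"
    using half_step[of B' A' a B1] by metis
  define k where "k p = (if p \<in> A - A' then g p else inv_into (B' - B1) h p)" for p
  have dom: "A - A1 = (A - A') \<union> (A' - A1)" "(A - A') \<inter> (A' - A1) = {}"
    using A1(3) A'(3) by auto
  have cod: "B - B1 = (B - B') \<union> (B' - B1)" "(B - B') \<inter> (B' - B1) = {}"
    using B1(3) B'(3) by auto
  have "h ` (B' - B1) = A' - A1" "inj_on h (B' - B1)"
    using A1(6) by (auto simp: bij_betw_def)
  then have inv: "pwt (A' - A1) (inv_into (B' - B1) h)"
    using pwt_inv_into[OF A1(5)] by simp
  show ?thesis
  proof (rule that)
    show "exhaust_state a b A1 B1"
      using A1 B1 by (simp add: exhaust_state_def)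
    show "A1 \<subseteq> A \<inter> N" "B1 \<subseteq> B \<inter> M"
      using A1 B1 A' B' by (auto simp: A'_def B1_def)
    show "pwt (A - A1) k"
      unfolding k_def dom(1) by (rule pw_translation_if[OF B'(5) inv dom(2)])
    show "bij_betw k (A - A1) (B - B1)"
      unfolding k_def[abs_def] dom(1) cod(1)
      by (rule bij_betw_disjoint_Un[OF B'(6) bij_betw_inv_into[OF A1(6)] dom(2) cod(2)])
  qed
qed

text \<open>The back-and-forth construction: \<open>A n\<close> and \<open>B n\<close> shrink to \<open>a\<close> and \<open>b\<close>, the shells
  \<open>A n - A (Suc n)\<close> and \<open>B n - B (Suc n)\<close> are matched, and \<open>a\<close> is the only possible discontinuity.\<close>

lemma exhausting_bijection:
  assumes S: "exhaust_state a b A0 B0"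
  obtains \<theta> where "bij_betw \<theta> A0 B0" "\<theta> a = b" "pwt (A0 - {a}) \<theta>" "continuous_on A0 \<theta>"
    "\<And>U. open U \<Longrightarrow> U \<subseteq> A0 \<Longrightarrow> open (\<theta> ` U)"
proof -
  obtain N where N: "\<And>n :: nat. open (N n) \<and> closed (N n) \<and> a \<in> N n"
    "\<And>U. open U \<Longrightarrow> a \<in> U \<Longrightarrow> \<exists>n. N n \<subseteq> U"
    using clopen_base[of a] by metis
  obtain M where M: "\<And>n :: nat. open (M n) \<and> closed (M n) \<and> b \<in> M n"
    "\<And>U. open U \<Longrightarrow> b \<in> U \<Longrightarrow> \<exists>n. M n \<subseteq> U"
    using clopen_base[of b] by metis
  \<comment> \<open>Dependent choice leaves its first element open; the clause for
    \<open>n = 0\<close> pins it to the given pair.\<close>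
  define P where "P n X \<longleftrightarrow> exhaust_state a b (fst X) (snd X) \<and> (n = 0 \<longrightarrow> X = (A0, B0))" for n :: nat and X
  define Q where "Q n X Y \<longleftrightarrow> fst Y \<subseteq> fst X \<inter> N n \<and> snd Y \<subseteq> snd X \<inter> M n \<and>
    (\<exists>g. pwt (fst X - fst Y) g \<and> bij_betw g (fst X - fst Y) (snd X - snd Y))" for n X Y
  have "\<exists>F. \<forall>n. P n (F n) \<and> Q n (F n) (F (Suc n))"
  proof (rule dependent_nat_choice)
    show "\<exists>X. P 0 X"
      using S by (auto simp: P_def)
    show "\<exists>Y. P (Suc n) Y \<and> Q n X Y" if "P n X" for X n
    proof -
      have "exhaust_state a b (fst X) (snd X)"
        using that by (simp add: P_def)
      from full_step[OF this, of "N n" "M n"] N(1)[of n] M(1)[of n]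
      obtain A1 B1 g where "exhaust_state a b A1 B1" "A1 \<subseteq> fst X \<inter> N n" "B1 \<subseteq> snd X \<inter> M n"
        "pwt (fst X - A1) g" "bij_betw g (fst X - A1) (snd X - B1)"
        by metis
      then show ?thesis
        by (intro exI[of _ "(A1, B1)"]) (auto simp: P_def Q_def)
    qed
  qed
  then obtain F where F: "\<And>n. P n (F n)" "\<And>n. Q n (F n) (F (Suc n))"
    by metis
  define A where "A n = fst (F n)" for n
  define B where "B n = snd (F n)" for n
  have A_0: "A 0 = A0" and B_0: "B 0 = B0"
    using F(1)[of 0] by (auto simp: P_def A_def B_def)
  have st: "open (A n)" "closed (A n)" "open (B n)" "closed (B n)" "a \<in> A n" "b \<in> B n" for n
    using F(1)[of n] by (auto simp: P_def A_def B_def exhaust_state_def)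
  have "\<exists>g. pwt (A n - A (Suc n)) g \<and> bij_betw g (A n - A (Suc n)) (B n - B (Suc n))" for n
    using F(2)[of n] by (auto simp: Q_def A_def B_def)
  then obtain g where g: "\<And>n. pwt (A n - A (Suc n)) (g n)"
    "\<And>n. bij_betw (g n) (A n - A (Suc n)) (B n - B (Suc n))"
    by metis
  have step: "A (Suc n) \<subseteq> A n \<inter> N n" "B (Suc n) \<subseteq> B n \<inter> M n" for n
    using F(2)[of n] by (auto simp: Q_def A_def B_def)
  have anti: "A n \<subseteq> A m" "B n \<subseteq> B m" if "m \<le> n" for m n
    by (rule lift_Suc_antimono_le[OF _ that], use step in blast)+
  have small: "\<exists>n. A n \<subseteq> U" if "open U" "a \<in> U" for U
    using N(2)[OF that] step(1) by blast
  have smallB: "\<exists>n. B n \<subseteq> U" if "open U" "b \<in> U" for U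
    using M(2)[OF that] step(2) by blast
  have shell: "\<exists>n. x \<in> X n - X (Suc n)"
    if "x \<in> X 0" "x \<notin> X m" for x :: 'c and X :: "nat \<Rightarrow> 'c set" and m
    using that(2)
  proof (induction m)
    case (Suc m)
    then show ?case
      by (cases "x \<in> X m") auto
  qed (use that in auto)
  have shellA: "\<exists>n. x \<in> A n - A (Suc n)" if x: "x \<in> A0" "x \<noteq> a" for x
  proof -
    obtain m where "A m \<subseteq> - {x}"
      using small[of "- {x}"] closed_singleton_base x(2) by (auto simp: open_Compl)
    then show ?thesis
      using shell[of x A m] x A_0 by auto
  qed
  have shellB: "\<exists>n. y \<in> B n - B (Suc n)" if y: "y \<in> B0" "y \<noteq> b" for y
  proof -
    obtain m where "B m \<subseteq> - {y}"
      using smallB[of "- {y}"] closed_singleton_base y(2) by (auto simp: open_Compl)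
    then show ?thesis
      using shell[of y B m] y B_0 by auto
  qed
  have uniq: "m = n" if "x \<in> A m - A (Suc m)" "x \<in> A n - A (Suc n)" for x m n
    using that anti(1)[of "Suc m" n] anti(1)[of "Suc n" m] by (metis DiffD1 DiffD2 linorder_neqE_nat Suc_leI subsetD)
  have uniqB: "m = n" if "x \<in> B m - B (Suc m)" "x \<in> B n - B (Suc n)" for x m n
    using that anti(2)[of "Suc m" n] anti(2)[of "Suc n" m] by (metis DiffD1 DiffD2 linorder_neqE_nat Suc_leI subsetD)
  \<comment> \<open>The shells are pairwise disjoint and exhaust \<open>A0 - {a}\<close>, so the
    index is unique there; \<open>a\<close> lies in every \<open>A n\<close> and gets its value by
    hand.\<close>
  define \<theta> where "\<theta> x = (if x = a then b else g (THE n. x \<in> A n - A (Suc n)) x)" for x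
  have \<theta>_a: "\<theta> a = b"
    by (simp add: \<theta>_def)
  have \<theta>_shell: "\<theta> x = g n x" if "x \<in> A n - A (Suc n)" for x n
  proof -
    have "(THE n. x \<in> A n - A (Suc n)) = n"
      by (rule the_equality) (use uniq that in blast)+
    moreover have "x \<noteq> a"
      using that st(5)[of "Suc n"] by auto
    ultimately show ?thesis
      by (simp add: \<theta>_def)
  qed
  have \<theta>_maps: "\<theta> x \<in> B n - B (Suc n)" if "x \<in> A n - A (Suc n)" for x n
    using g(2)[of n] that \<theta>_shell[OF that] by (auto simp: bij_betw_def)
  have \<theta>_inj: "inj_on \<theta> A0"
  proof (rule inj_onI)
    fix x y assume xy: "x \<in> A0" "y \<in> A0" "\<theta> x = \<theta> y"
    show "x = y"
    proof (cases "x = a \<or> y = a")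
      case True
      then show ?thesis
        using xy shellA \<theta>_maps \<theta>_a st(6) by (metis DiffD2)
    next
      case False
      then obtain m n where mn: "x \<in> A m - A (Suc m)" "y \<in> A n - A (Suc n)"
        using xy shellA by metis
      then have "m = n"
        using \<theta>_maps[of x m] \<theta>_maps[of y n] xy(3) uniqB by metis
      then show ?thesis
        using mn \<theta>_shell[of x m] \<theta>_shell[of y n] xy(3) g(2)[of n] unfolding bij_betw_def
        by (metis inj_onD)
    qed
  qed
  have \<theta>_A: "\<theta> x \<in> B n" if x: "x \<in> A n" for x n
  proof (cases "x = a")
    case False
    then obtain m where m: "x \<in> A m - A (Suc m)"
      using shellA[of x] x anti(1)[of 0 n] A_0 by auto
    then have "n \<le> m"
      using x anti(1)[of "Suc m" n] by (meson DiffD2 not_less_eq_eq subsetD)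
    then show ?thesis
      using \<theta>_maps[OF m] anti(2)[of n m] by auto
  qed (use \<theta>_a st in auto)
  have \<theta>_img: "\<theta> ` A n = B n" for n
  proof
    show "\<theta> ` A n \<subseteq> B n"
      using \<theta>_A by auto
    show "B n \<subseteq> \<theta> ` A n"
    proof
      fix y assume y: "y \<in> B n"
      show "y \<in> \<theta> ` A n"
      proof (cases "y = b")
        case True
        then show ?thesis
          using \<theta>_a st(5) by blast
      next
        case False
        then obtain m where m: "y \<in> B m - B (Suc m)"
          using shellB[of y] y anti(2)[of 0 n] B_0 by auto
        then have "n \<le> m"
          using y anti(2)[of "Suc m" n] by (meson DiffD2 not_less_eq_eq subsetD)
        obtain x where x: "x \<in> A m - A (Suc m)" "y = g m x"
          using m g(2)[of m] by (auto simp: bij_betw_def)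
        then have "y = \<theta> x"
          using \<theta>_shell by simp
        moreover have "x \<in> A n"
          using x anti(1)[OF \<open>n \<le> m\<close>] by auto
        ultimately show ?thesis
          by blast
      qed
    qed
  qed
  have pw: "pwt (A0 - {a}) \<theta>"
  proof -
    have "A0 - {a} = (\<Union>n. A n - A (Suc n))"
      using shellA st(5) anti(1)[of 0] A_0 by blast
    moreover have "pwt (\<Union>n. A n - A (Suc n)) \<theta>"
      by (rule pw_translation_UN) (rule pw_translation_cong[OF g(1)], rule \<theta>_shell)
    ultimately show ?thesis
      by simp
  qed
  show ?thesis
  proof (rule that)
    show "bij_betw \<theta> A0 B0"
      using \<theta>_inj \<theta>_img[of 0] A_0 B_0 by (simp add: bij_betw_def)
    show "\<theta> a = b" "pwt (A0 - {a}) \<theta>"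
      by fact+
    have "open A0"
      using st(1)[of 0] A_0 by simp
    show "continuous_on A0 \<theta>"
      unfolding continuous_on_open_vimage[OF \<open>open A0\<close>]
    proof (intro allI impI)
      fix W :: "'c set" assume W: "open W"
      have o: "open {p\<in>A0 - {a}. \<theta> p \<in> W}"
        by (rule pwt_open_vimage[OF pw W])
      show "open (\<theta> -` W \<inter> A0)"
      proof (cases "b \<in> W")
        case True
        then obtain n where n: "B n \<subseteq> W"
          using smallB[OF W] by blast
        \<comment> \<open>At \<open>a\<close> no local translation is available; instead all of
          \<open>A n\<close> is sent into the small set \<open>B n\<close>.\<close>
        have "\<theta> -` W \<inter> A0 = {p\<in>A0 - {a}. \<theta> p \<in> W} \<union> A n"
          using n \<theta>_A[of _ n] st(5)[of n] anti(1)[of 0 n] A_0 \<theta>_a True by auto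
        then show ?thesis
          using o st(1) by auto
      next
        case False
        then have "\<theta> -` W \<inter> A0 = {p\<in>A0 - {a}. \<theta> p \<in> W}"
          using \<theta>_a by auto
        then show ?thesis
          using o by simp
      qed
    qed
    show "open (\<theta> ` U)" if U: "open U" "U \<subseteq> A0" for U
    proof -
      have "open (U - {a})"
        using U(1) closed_singleton_base by (rule open_Diff)
      then have o: "open (\<theta> ` (U - {a}))"
        using U(2) by (intro pwt_open_image pw_translation_subset[OF pw]) auto
      show ?thesis
      proof (cases "a \<in> U")
        case True
        then obtain n where n: "A n \<subseteq> U"
          using small[OF U(1)] by blast
        \<comment> \<open>The point \<open>a\<close> is absorbed into some \<open>A n\<close> inside
          \<open>U\<close>, whose image is the open set \<open>B n\<close>.\<close>
        have "\<theta> ` U = \<theta> ` (U - {a}) \<union> \<theta> ` A n"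
          using n st(5)[of n] by blast
        then show ?thesis
          using o st(3) by (auto simp: \<theta>_img)
      next
        case False
        then show ?thesis
          using o by simp
      qed
    qed
  qed
qed

end

subsection \<open>The ordered group\<close>

text \<open>By compactness \<open>f\<close> has finite range and is the sum of its values times the
  indicators of its clopen level sets.\<close>

lemma cont_int_induct [consumes 2, case_names zero indicator minus add]:
  assumes f: "continuous_on UNIV (f :: 'a::topological_space \<Rightarrow> int)" and cpt: "compact (UNIV :: 'a set)"
    and zero: "P (\<lambda>x. 0)"
    and indicator: "\<And>A. open A \<Longrightarrow> closed A \<Longrightarrow> P (indicator A)"
    and minus: "\<And>f. continuous_on UNIV f \<Longrightarrow> P f \<Longrightarrow> P (\<lambda>x. - f x)"
    and add: "\<And>f g. continuous_on UNIV f \<Longrightarrow> continuous_on UNIV g \<Longrightarrow> P f \<Longrightarrow> P g \<Longrightarrow> P (\<lambda>x. f x + g x)"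
  shows "P f"
proof -
  \<comment> \<open>Continuity is carried along because the cases for sums and negatives assume
    it.\<close>
  define Q where "Q f \<longleftrightarrow> continuous_on UNIV f \<and> P f" for f :: "'a \<Rightarrow> int"
  have Q0: "Q (\<lambda>x. 0)"
    by (simp add: Q_def zero)
  have Qadd: "Q (\<lambda>x. f x + g x)" if "Q f" "Q g" for f g
    using that add continuous_int_binop[of f g "(+)"] by (simp add: Q_def)
  have Qminus: "Q (\<lambda>x. - f x)" if "Q f" for f
    using that minus continuous_int_binop[of f f "\<lambda>a b. - a"] by (simp add: Q_def)
  have Qnat: "Q (\<lambda>x. int n * f x)" if "Q f" for f n
  proof (induction n)
    case 0
    then show ?case
      using Q0 by simp
  next
    case (Suc n)
    then show ?case
      using Qadd[OF that Suc] by (simp add: distrib_right)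
  qed
  have Qscale: "Q (\<lambda>x. k * f x)" if "Q f" for f and k :: int
  proof (cases "0 \<le> k")
    case True
    then show ?thesis
      using Qnat[OF that, of "nat k"] by simp
  next
    case False
    then show ?thesis
      using Qminus[OF Qnat[OF that, of "nat (- k)"]] by simp
  qed
  have Qsum: "Q (\<lambda>x. \<Sum>k\<in>S. h k x)" if "finite S" "\<And>k. k \<in> S \<Longrightarrow> Q (h k)" for S :: "int set" and h
    using that by (induction S rule: finite_induct) (auto intro: Q0 Qadd)
  have fin: "finite (range f)"
    by (rule finite_range_int[OF cpt f])
  have "Q (indicator {x. f x \<in> {k}})" for k
    using clopen_vimage_int[OF f, of "{k}"] by (auto simp only: Q_def intro!: indicator continuous_indicator_clopen)
  then have "Q (\<lambda>x. \<Sum>k\<in>range f. k * indicator {x. f x \<in> {k}} x)"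
    by (intro Qsum fin Qscale)
  moreover have "(\<lambda>x. \<Sum>k\<in>range f. k * indicator {x. f x \<in> {k}} x) = f"
  proof
    fix x
    have "(\<Sum>k\<in>range f. k * indicator {x. f x \<in> {k}} x) = (\<Sum>k\<in>range f. if k = f x then f x else 0)"
      by (rule sum.cong) (auto simp: indicator_def)
    then show "(\<Sum>k\<in>range f. k * indicator {x. f x \<in> {k}} x) = f x"
      using fin by simp
  qed
  ultimately show ?thesis
    by (simp add: Q_def)
qed

context free_minimal_action
begin

lemma coboundary_induct [consumes 1, case_names zero generator minus add]:
  assumes b: "b \<in> coboundary_subgroup \<alpha>"
    and zero: "P (\<lambda>x. 0)"
    and gen: "\<And>A v. open A \<Longrightarrow> closed A \<Longrightarrow> P (\<lambda>x. indicator A x - indicator (\<alpha> v ` A) x)"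
    and minus: "\<And>b. P b \<Longrightarrow> P (\<lambda>x. - b x)"
    and add: "\<And>b c. P b \<Longrightarrow> P c \<Longrightarrow> P (\<lambda>x. b x + c x)"
  shows "P b"
  using b unfolding coboundary_subgroup_def
proof (induction b rule: generate.induct)
  case one
  then show ?case
    using zero by (simp add: cont_int_group_def)
next
  case (incl b)
  then show ?case
    using gen by auto
next
  case (inv b)
  then obtain A v where A: "open A" "closed A" "b = (\<lambda>x. indicator A x - indicator (\<alpha> v ` A) x)"
    by auto
  have "inv\<^bsub>cont_int_group\<^esub> b = (\<lambda>x. - b x)"
    unfolding A(3) by (rule cont_int_inv[OF coboundary_generator_continuous[OF A(1,2)]])
  then show ?case
    using minus[OF gen[OF A(1,2), of v]] A(3) by simp
next
  case (eng b c)
  then show ?case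
    using add by (simp add: cont_int_group_def)
qed

section \<open>Classes modulo coboundaries and their order\<close>

text \<open>For the indicator of a clopen set this is a generator; both sides are additive in
  \<open>g\<close>.\<close>

lemma coboundary_translate:
  assumes "continuous_on UNIV g"
  shows "(\<lambda>z. g z - g (\<alpha> (- v) z)) \<in> coboundary_subgroup \<alpha>"
  using assms compact_UNIV
proof (induction g rule: cont_int_induct)
  case zero
  then show ?case
    using coboundary_zero by simp
next
  case (indicator A)
  have "indicator A (\<alpha> (- v) z) = (indicator (\<alpha> v ` A) z :: int)" for z
    using act_vimage[of "- v" A] by (auto simp: indicator_def)
  then show ?case
    using coboundary_generator[OF indicator] by simp
next
  case (minus f)
  then show ?case
    using coboundary_minus[OF minus(2)] by (simp add: algebra_simps)
next
  case (add f g)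
  then show ?case
    using coboundary_add[OF add(3,4)] by (simp add: algebra_simps)
qed

lemma dyn_class_eq: "dyn_class \<alpha> f = {(\<lambda>x. b x + f x) | b. b \<in> coboundary_subgroup \<alpha>}"
  by (auto simp: dyn_class_def r_coset_def cont_int_group_def)

lemma dyn_class_self: "f \<in> dyn_class \<alpha> f"
  unfolding dyn_class_eq using coboundary_zero by force

lemma dyn_class_eq_iff: "dyn_class \<alpha> f = dyn_class \<alpha> g \<longleftrightarrow> (\<lambda>x. f x - g x) \<in> coboundary_subgroup \<alpha>"
proof
  assume "dyn_class \<alpha> f = dyn_class \<alpha> g"
  then have "f \<in> dyn_class \<alpha> g"
    using dyn_class_self by auto
  then show "(\<lambda>x. f x - g x) \<in> coboundary_subgroup \<alpha>"
    by (auto simp: dyn_class_eq)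
next
  assume d: "(\<lambda>x. f x - g x) \<in> coboundary_subgroup \<alpha>"
  show "dyn_class \<alpha> f = dyn_class \<alpha> g"
  proof
    show "dyn_class \<alpha> f \<subseteq> dyn_class \<alpha> g"
    proof
      fix h assume "h \<in> dyn_class \<alpha> f"
      then obtain b where b: "b \<in> coboundary_subgroup \<alpha>" "h = (\<lambda>x. b x + f x)"
        by (auto simp: dyn_class_eq)
      have "h = (\<lambda>x. (b x + (f x - g x)) + g x)"
        by (simp add: b(2))
      then show "h \<in> dyn_class \<alpha> g"
        unfolding dyn_class_eq using coboundary_add[OF b(1) d]
          by (intro CollectI exI[of _ "\<lambda>x. b x + (f x - g x)"]) simp
    qed
    show "dyn_class \<alpha> g \<subseteq> dyn_class \<alpha> f"
    proof
      fix h assume "h \<in> dyn_class \<alpha> g"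
      then obtain b where b: "b \<in> coboundary_subgroup \<alpha>" "h = (\<lambda>x. b x + g x)"
        by (auto simp: dyn_class_eq)
      have "h = (\<lambda>x. (b x - (f x - g x)) + f x)"
        by (simp add: b(2))
      then show "h \<in> dyn_class \<alpha> f"
        unfolding dyn_class_eq using coboundary_diff[OF b(1) d]
          by (intro CollectI exI[of _ "\<lambda>x. b x - (f x - g x)"]) simp
    qed
  qed
qed

lemma normal_coboundary: "coboundary_subgroup \<alpha> \<lhd> cont_int_group"
  by (rule cont_int.subgroup_imp_normal[OF subgroup_coboundary])

lemma group_dyn_group: "group (dyn_group \<alpha>)"
  unfolding dyn_group_def by (rule normal.factorgroup_is_group[OF normal_coboundary])

lemma carrier_dyn_group: "carrier (dyn_group \<alpha>) = {dyn_class \<alpha> f | f. continuous_on UNIV f}"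
  by (auto simp: dyn_group_def FactGroup_def RCOSETS_def dyn_class_def cont_int_group_def)

lemma dyn_class_mult:
  assumes "continuous_on UNIV f" "continuous_on UNIV g"
  shows "dyn_class \<alpha> f \<otimes>\<^bsub>dyn_group \<alpha>\<^esub> dyn_class \<alpha> g = dyn_class \<alpha> (\<lambda>x. f x + g x)"
  using normal.rcos_sum[OF normal_coboundary, of f g] assms
  by (simp add: dyn_group_def dyn_class_def FactGroup_def) (simp add: cont_int_group_def)

lemma dyn_class_one: "\<one>\<^bsub>dyn_group \<alpha>\<^esub> = dyn_class \<alpha> (\<lambda>x. 0)"
  by (simp add: dyn_group_def FactGroup_def dyn_class_eq)

lemma dyn_class_carrier: "continuous_on UNIV f \<Longrightarrow> dyn_class \<alpha> f \<in> carrier (dyn_group \<alpha>)"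
  by (auto simp: carrier_dyn_group)

lemma dyn_class_inv:
  assumes "continuous_on UNIV f"
  shows "inv\<^bsub>dyn_group \<alpha>\<^esub> dyn_class \<alpha> f = dyn_class \<alpha> (\<lambda>x. - f x)"
proof (rule group.inv_equality[OF group_dyn_group])
  have m: "continuous_on UNIV (\<lambda>x. - f x)"
    using continuous_int_binop[OF assms assms, of "\<lambda>a b. - a"] by simp
  show "dyn_class \<alpha> (\<lambda>x. - f x) \<otimes>\<^bsub>dyn_group \<alpha>\<^esub> dyn_class \<alpha> f = \<one>\<^bsub>dyn_group \<alpha>\<^esub>"
    by (simp add: dyn_class_mult[OF m assms] dyn_class_one)
  show "dyn_class \<alpha> f \<in> carrier (dyn_group \<alpha>)" "dyn_class \<alpha> (\<lambda>x. - f x) \<in> carrier (dyn_group \<alpha>)"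
    by (intro dyn_class_carrier assms m)+
qed

lemma dyn_pos_eq: "dyn_pos \<alpha> = {dyn_class \<alpha> f | f. continuous_on UNIV f \<and> (\<forall>x. 0 \<le> f x)}"
  by (simp add: dyn_pos_def cont_int_group_def)

text \<open>Positivity of the difference supplies \<open>f\<close>, and strictness of
  \<open>og_less\<close> makes it nonzero.\<close>

lemma inf_closeI:
  assumes A: "open A" "closed A" and B: "open B" "closed B"
    and less: "\<And>C. open C \<Longrightarrow> closed C \<Longrightarrow> C \<noteq> {} \<Longrightarrow>
      og_less (dyn_group \<alpha>) (dyn_pos \<alpha>) (dyn_class \<alpha> (\<lambda>z. indicator A z - indicator B z)) (dyn_class \<alpha> (indicator C))"
  shows "inf_close A B"
  unfolding inf_close_def
proof (intro allI impI)
  fix C :: "'c set" assume C: "open C" "closed C" "C \<noteq> {}"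
  let ?k = "\<lambda>z. indicator A z - indicator B z :: int"
  have k: "continuous_on UNIV ?k"
    using continuous_int_binop[OF continuous_indicator_clopen[OF A] continuous_indicator_clopen[OF B], of "(-)"] by simp
  have c: "continuous_on UNIV (indicator C :: 'c \<Rightarrow> int)"
    by (rule continuous_indicator_clopen[OF C(1,2)])
  have mk: "continuous_on UNIV (\<lambda>z. - ?k z)"
    using continuous_int_binop[OF k k, of "\<lambda>a b. - a"] by simp
  have "dyn_class \<alpha> (indicator C) \<otimes>\<^bsub>dyn_group \<alpha>\<^esub> inv\<^bsub>dyn_group \<alpha>\<^esub> (dyn_class \<alpha> ?k) =
      dyn_class \<alpha> (\<lambda>z. indicator C z + - ?k z)"
    unfolding dyn_class_inv[OF k] by (rule dyn_class_mult[OF c mk])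
  then obtain f where f: "continuous_on UNIV f" "\<forall>z. 0 \<le> f z"
    "dyn_class \<alpha> (\<lambda>z. indicator C z + - ?k z) = dyn_class \<alpha> f" and ne: "dyn_class \<alpha> (indicator C) \<noteq> dyn_class \<alpha> ?k"
    using less[OF C] by (auto simp: og_less_def og_less_eq_def dyn_pos_eq)
  have b: "(\<lambda>z. (indicator C z + - ?k z) - f z) \<in> coboundary_subgroup \<alpha>"
    using f(3) by (simp only: dyn_class_eq_iff)
  have "f \<noteq> (\<lambda>_. 0)"
  proof
    assume "f = (\<lambda>_. 0)"
    then have "(\<lambda>z. indicator C z - ?k z) \<in> coboundary_subgroup \<alpha>"
      using b by (simp add: algebra_simps)
    then show False
      using ne by (simp add: dyn_class_eq_iff)
  qed
  moreover have "(\<lambda>z. (indicator C z + - ?k z) - f z) = (\<lambda>z. indicator C z + indicator B z - indicator A z - f z)"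
    by auto
  ultimately show "\<exists>f. continuous_on UNIV f \<and> (\<forall>z. 0 \<le> f z) \<and> f \<noteq> (\<lambda>_. 0) \<and>
      (\<lambda>z. indicator C z + indicator B z - indicator A z - f z) \<in> coboundary_subgroup \<alpha>"
    using f b by auto
qed

text \<open>The multiples 1 and -1 give the two directions. The class of a nonempty clopen set may
  serve as \<open>h\<close> because \<open>indicator_not_coboundary\<close> shows it to be
  nonzero.\<close>

lemma infinitesimal_imp_inf_close:
  assumes A: "open A" "closed A" and B: "open B" "closed B"
    and inf: "dyn_class \<alpha> (indicator A) \<otimes>\<^bsub>dyn_group \<alpha>\<^esub> inv\<^bsub>dyn_group \<alpha>\<^esub> (dyn_class \<alpha> (indicator B))
      \<in> infinitesimals (dyn_group \<alpha>) (dyn_pos \<alpha>)"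
  shows "inf_close A B" "inf_close B A"
proof -
  let ?k = "\<lambda>z. indicator A z - indicator B z :: int"
  note cA = continuous_indicator_clopen[OF A] and cB = continuous_indicator_clopen[OF B]
  have k: "continuous_on UNIV ?k"
    using continuous_int_binop[OF cA cB, of "(-)"] by simp
  have mB: "continuous_on UNIV (\<lambda>z. - indicator B z :: int)"
    using continuous_int_binop[OF cB cB, of "\<lambda>a b. - a"] by simp
  have eq: "dyn_class \<alpha> (indicator A) \<otimes>\<^bsub>dyn_group \<alpha>\<^esub> inv\<^bsub>dyn_group \<alpha>\<^esub> (dyn_class \<alpha> (indicator B)) = dyn_class \<alpha> ?k"
    unfolding dyn_class_inv[OF cB] dyn_class_mult[OF cA mB] by simp
  have less: "og_less (dyn_group \<alpha>) (dyn_pos \<alpha>) (dyn_class \<alpha> ?k [^]\<^bsub>dyn_group \<alpha>\<^esub> n) (dyn_class \<alpha> (indicator C))"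
    if C: "open C" "closed C" "C \<noteq> {}" for C and n :: int
  proof -
    have "dyn_class \<alpha> (indicator C) \<in> dyn_pos \<alpha>"
      unfolding dyn_pos_eq using continuous_indicator_clopen[OF C(1,2)] by (auto simp: indicator_def)
    moreover have "dyn_class \<alpha> (indicator C) \<noteq> \<one>\<^bsub>dyn_group \<alpha>\<^esub>"
      unfolding dyn_class_one dyn_class_eq_iff using indicator_not_coboundary[OF C] by simp
    ultimately show ?thesis
      using inf unfolding eq infinitesimals_def by auto
  qed
  show "inf_close A B"
  proof (rule inf_closeI[OF A B])
    fix C :: "'c set" assume "open C" "closed C" "C \<noteq> {}"
    from less[OF this, of 1]
    show "og_less (dyn_group \<alpha>) (dyn_pos \<alpha>) (dyn_class \<alpha> ?k) (dyn_class \<alpha> (indicator C))"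
      using group.int_pow_1[OF group_dyn_group dyn_class_carrier[OF k]] by simp
  qed
  show "inf_close B A"
  proof (rule inf_closeI[OF B A])
    fix C :: "'c set" assume "open C" "closed C" "C \<noteq> {}"
    note less[OF this, of "- 1"]
    moreover have "dyn_class \<alpha> ?k [^]\<^bsub>dyn_group \<alpha>\<^esub> (- 1 :: int) = dyn_class \<alpha> (\<lambda>z. indicator B z - indicator A z)"
      using group.int_pow_neg[OF group_dyn_group dyn_class_carrier[OF k], of 1]
        group.int_pow_1[OF group_dyn_group dyn_class_carrier[OF k]] dyn_class_inv[OF k] by simp
    ultimately show "og_less (dyn_group \<alpha>) (dyn_pos \<alpha>) (dyn_class \<alpha> (\<lambda>z. indicator B z - indicator A z))
        (dyn_class \<alpha> (indicator C))"
      by simp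
  qed
qed

end

section \<open>Transfer along a bounded orbit injection\<close>

locale bounded_embedding = X: free_minimal_action \<phi> + Z: free_minimal_action \<alpha>
  for \<phi> :: "int ^ 'd::finite \<Rightarrow> 'a::topological_space \<Rightarrow> 'a"
    and \<alpha> :: "int ^ 'd \<Rightarrow> 'c::topological_space \<Rightarrow> 'c" +
  fixes \<theta> :: "'a \<Rightarrow> 'c"
  assumes bounded: "bounded_orbit_injection \<phi> \<alpha> \<theta>"
begin

abbreviation theta_inv :: "'c \<Rightarrow> 'a" where
  "theta_inv \<equiv> inv_into UNIV \<theta>"

lemma theta_inj: "inj \<theta>"
  and theta_continuous: "continuous_on UNIV \<theta>"
  and theta_open: "open U \<Longrightarrow> open (\<theta> ` U)"
  and theta_orbit: "(\<exists>w. \<phi> w x = y) \<longleftrightarrow> (\<exists>v. \<alpha> v (\<theta> x) = \<theta> y)"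
  using bounded by (auto simp: bounded_orbit_injection_def orbit_injection_def open_map_def)

lemma theta_eq [simp]: "\<theta> x = \<theta> y \<longleftrightarrow> x = y"
  using theta_inj by (simp add: inj_eq)

lemma theta_closed: "closed U \<Longrightarrow> closed (\<theta> ` U)"
  by (intro Z.compact_imp_closed_base compact_continuous_image X.clopen_imp_compact)
    (use theta_continuous in \<open>auto intro: continuous_on_subset\<close>)

lemma cocycle_iff: "cocycle \<phi> \<alpha> \<theta> x w = v \<longleftrightarrow> \<alpha> v (\<theta> x) = \<theta> (\<phi> w x)"
proof -
  obtain u where u: "\<alpha> u (\<theta> x) = \<theta> (\<phi> w x)"
    using theta_orbit[of x "\<phi> w x"] by auto
  then have "cocycle \<phi> \<alpha> \<theta> x w = u"
    unfolding cocycle_def by (intro the_equality) (simp_all flip: u)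
  with u show ?thesis
    by (metis Z.act_inject_left)
qed

text \<open>Boundedness enters here: a continuous cocycle into a discrete group is locally constant,
  so an identity between translations at one point holds nearby.\<close>

lemma cocycle_locally_constant:
  assumes "\<alpha> v (\<theta> x) = \<theta> (\<phi> w x)"
  obtains U where "open U" "x \<in> U" "\<And>y. y \<in> U \<Longrightarrow> \<alpha> v (\<theta> y) = \<theta> (\<phi> w y)"
proof
  have c: "continuous_on UNIV (\<lambda>(x, w). cocycle \<phi> \<alpha> \<theta> x w)"
    using bounded by (simp add: bounded_orbit_injection_def)
  have "continuous_on UNIV (\<lambda>x. (x, w))"
    by (intro continuous_intros)
  from continuous_on_compose2[OF c this] have "continuous_on UNIV (\<lambda>x. cocycle \<phi> \<alpha> \<theta> x w)"
    by simp
  then have "open ((\<lambda>x. cocycle \<phi> \<alpha> \<theta> x w) -` {v})"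
    by (rule open_vimage[OF open_discrete_vec])
  also have "(\<lambda>x. cocycle \<phi> \<alpha> \<theta> x w) -` {v} = {y. \<alpha> v (\<theta> y) = \<theta> (\<phi> w y)}"
    by (simp add: vimage_def cocycle_iff)
  finally show "open {y. \<alpha> v (\<theta> y) = \<theta> (\<phi> w y)}" .
qed (use assms in auto)

lemma pwt_push:
  assumes "X.pwt A g"
  shows "Z.pwt (\<theta> ` A) (\<lambda>z. \<theta> (g (theta_inv z)))"
proof (rule pw_translationI)
  fix z assume "z \<in> \<theta> ` A"
  then obtain x where x: "x \<in> A" "z = \<theta> x"
    by auto
  obtain w U where U: "open U" "x \<in> U" "U \<subseteq> A" "\<And>y. y \<in> U \<Longrightarrow> g y = \<phi> w y"
    using pw_translationE[OF assms x(1)] by metis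
  obtain v where "\<alpha> v (\<theta> x) = \<theta> (\<phi> w x)"
    using theta_orbit[of x "\<phi> w x"] by auto
  then obtain V where V: "open V" "x \<in> V" "\<And>y. y \<in> V \<Longrightarrow> \<alpha> v (\<theta> y) = \<theta> (\<phi> w y)"
    by (rule cocycle_locally_constant) auto
  have "open (\<theta> ` (U \<inter> V))" "z \<in> \<theta> ` (U \<inter> V)" "\<theta> ` (U \<inter> V) \<subseteq> \<theta> ` A"
    "\<forall>q\<in>\<theta> ` (U \<inter> V). \<theta> (g (theta_inv q)) = \<alpha> v q"
    using U V x theta_inj by (auto intro: theta_open)
  then show "\<exists>s U. open U \<and> z \<in> U \<and> U \<subseteq> \<theta> ` A \<and> (\<forall>q\<in>U. \<theta> (g (theta_inv q)) = \<alpha> s q)"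
    by blast
qed

text \<open>An \<open>\<alpha>\<close>-translation that returns to the range of
  \<open>\<theta>\<close> at a point is a \<open>\<phi>\<close>-translation there by the orbit
  condition, and near it by local constancy of the cocycle.\<close>

lemma pwt_pull:
  assumes P: "Z.pwt P g" "P \<subseteq> range \<theta>" "g ` P \<subseteq> range \<theta>"
  shows "X.pwt (\<theta> -` P) (\<lambda>x. theta_inv (g (\<theta> x)))"
proof (rule pw_translationI)
  fix x assume x: "x \<in> \<theta> -` P"
  then obtain v O' where O: "open O'" "\<theta> x \<in> O'" "O' \<subseteq> P" "\<And>q. q \<in> O' \<Longrightarrow> g q = \<alpha> v q"
    using P(1) by (auto elim!: pw_translationE)
  have "g (\<theta> x) \<in> range \<theta>"
    using P(3) x by auto
  then obtain y where y: "\<alpha> v (\<theta> x) = \<theta> y"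
    using O(2,4) by auto
  then obtain w where "\<phi> w x = y"
    using theta_orbit[of x y] by auto
  then have "\<alpha> v (\<theta> x) = \<theta> (\<phi> w x)"
    using y by simp
  then obtain V where V: "open V" "x \<in> V" "\<And>y. y \<in> V \<Longrightarrow> \<alpha> v (\<theta> y) = \<theta> (\<phi> w y)"
    by (rule cocycle_locally_constant) auto
  have "open (V \<inter> \<theta> -` O')"
    using V(1) open_vimage[OF O(1) theta_continuous] by auto
  moreover have "x \<in> V \<inter> \<theta> -` O'" "V \<inter> \<theta> -` O' \<subseteq> \<theta> -` P"
    using V O by auto
  moreover have "\<forall>y\<in>V \<inter> \<theta> -` O'. theta_inv (g (\<theta> y)) = \<phi> w y"
    using V(3) O(4) theta_inj by auto
  ultimately show "\<exists>s U. open U \<and> x \<in> U \<and> U \<subseteq> \<theta> -` P \<and> (\<forall>q\<in>U. theta_inv (g (\<theta> q)) = \<phi> s q)"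
    by blast
qed

text \<open>Extension by zero along the clopen range of \<open>\<theta>\<close>; on classes it
  induces the isomorphism \<open>induced_iso\<close>.\<close>

definition extend :: "('a \<Rightarrow> int) \<Rightarrow> 'c \<Rightarrow> int" where
  "extend f z = (if z \<in> range \<theta> then f (theta_inv z) else 0)"

lemma extend_theta [simp]: "extend f (\<theta> x) = f x"
  using theta_inj by (simp add: extend_def)

lemma extend_continuous:
  assumes "continuous_on UNIV f"
  shows "continuous_on UNIV (extend f)"
proof (rule continuous_on_open_discrete)
  fix z
  show "\<exists>U. open U \<and> z \<in> U \<and> (\<forall>y\<in>U \<inter> UNIV. extend f y = extend f z)"
  proof (cases "z \<in> range \<theta>")
    case True
    then obtain x where x: "z = \<theta> x"
      by auto
    have "open (\<theta> ` {y. f y \<in> {f x}})"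
      by (intro theta_open clopen_vimage_int assms)
    then show ?thesis
      using x by (intro exI[of _ "\<theta> ` {y. f y \<in> {f x}}"]) auto
  next
    case False
    have "open (- range \<theta>)"
      using theta_closed[of UNIV] by (simp add: open_Compl)
    then show ?thesis
      using False by (intro exI[of _ "- range \<theta>"]) (auto simp: extend_def)
  qed
qed auto

lemma extend_add: "extend (\<lambda>x. f x + g x) = (\<lambda>z. extend f z + extend g z)"
  and extend_minus: "extend (\<lambda>x. - f x) = (\<lambda>z. - extend f z)"
  and extend_diff: "extend (\<lambda>x. f x - g x) = (\<lambda>z. extend f z - extend g z)"
  and extend_zero: "extend (\<lambda>x. 0) = (\<lambda>z. 0)"
  by (auto simp: extend_def)

lemma extend_indicator: "extend (indicator A) = indicator (\<theta> ` A)"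
proof
  fix z
  show "extend (indicator A) z = indicator (\<theta> ` A) z"
    by (cases "z \<in> range \<theta>") (auto simp: extend_def indicator_def theta_inj image_iff)
qed

text \<open>A generator extends to the difference of the indicators of two sets in the range matched
  by the conjugate of \<open>\<phi> v\<close>, which is a piecewise
  \<open>\<alpha>\<close>-translation.\<close>

lemma extend_coboundary:
  assumes "b \<in> coboundary_subgroup \<phi>"
  shows "extend b \<in> coboundary_subgroup \<alpha>"
  using assms
proof (induction b rule: X.coboundary_induct)
  case zero
  then show ?case
    by (simp add: extend_zero Z.coboundary_zero)
next
  case (generator A v)
  have "Z.pwt (\<theta> ` A) (\<lambda>z. \<theta> (\<phi> v (theta_inv z)))"
    by (rule pwt_push[OF X.pwt_act[OF generator(1)]])
  moreover have "inj_on (\<lambda>z. \<theta> (\<phi> v (theta_inv z))) (\<theta> ` A)"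
    using theta_inj by (auto simp: inj_on_def)
  ultimately have "(\<lambda>z. indicator (\<theta> ` A) z - indicator ((\<lambda>z. \<theta> (\<phi> v (theta_inv z))) ` \<theta> ` A) z) \<in> coboundary_subgroup \<alpha>"
    by (intro Z.pw_translation_coboundary theta_open theta_closed generator)
  moreover have "(\<lambda>z. \<theta> (\<phi> v (theta_inv z))) ` \<theta> ` A = \<theta> ` \<phi> v ` A"
    using theta_inj by (simp add: image_image)
  ultimately show ?case
    by (simp add: extend_diff extend_indicator)
next
  case (minus b)
  then show ?case
    by (simp add: extend_minus Z.coboundary_minus)
next
  case (add b c)
  then show ?case
    by (simp add: extend_add Z.coboundary_add)
qed

end

lemma continuous_int_sum:
  fixes h :: "'i \<Rightarrow> 'a::topological_space \<Rightarrow> int"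
  assumes "finite S" "\<And>s. s \<in> S \<Longrightarrow> continuous_on UNIV (h s)"
  shows "continuous_on UNIV (\<lambda>x. \<Sum>s\<in>S. h s x)"
  using assms
proof (induction S rule: finite_induct)
  case (insert s S)
  then show ?case
    using continuous_int_binop[of "h s" "\<lambda>x. \<Sum>s\<in>S. h s x" "(+)"] by simp
qed simp

lemma iso_restrict_carrier:
  assumes "group G" "f \<in> iso G H"
  shows "restrict f (carrier G) \<in> iso G H"
  using assms monoid.m_closed[OF group.is_monoid[OF assms(1)]]
  by (auto simp: iso_def hom_def Pi_iff bij_betw_restrict_eq)

context bounded_embedding
begin

section \<open>The inverse of extension by zero and the value of the induced isomorphism\<close>

text \<open>The range of \<open>\<theta>\<close> is clopen and meets every orbit, and compactness
  makes finitely many translations suffice. A selection depending only on the set \<open>M z\<close>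
  of those that succeed at \<open>z\<close> is locally constant, as \<open>M\<close> is.\<close>

lemma return_map:
  obtains S r where "finite S" "0 \<in> S" "\<And>z. r z \<in> S" "\<And>z. \<alpha> (r z) z \<in> range \<theta>"
    "\<And>z. z \<in> range \<theta> \<Longrightarrow> r z = 0" "\<And>T. open {z. r z \<in> T}" "\<And>T. closed {z. r z \<in> T}"
proof -
  have R: "open (range \<theta>)" "closed (range \<theta>)"
    by (intro theta_open theta_closed; simp)+
  have "(UNIV :: 'c set) \<subseteq> (\<Union>v\<in>UNIV. \<alpha> v -` range \<theta>)"
    using Z.minimal[OF R(1)] by auto
  then obtain S where S: "finite S" "UNIV \<subseteq> (\<Union>v\<in>S. \<alpha> v -` range \<theta>)"
    using compactE_image[OF Z.compact_UNIV, of UNIV "\<lambda>v. \<alpha> v -` range \<theta>"] Z.open_act_vimage[OF R(1)] by metis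
  define S' where "S' = insert 0 S"
  \<comment> \<open>Preferring 0 makes the return trivial on the range, so that the retraction fixes
    extended functions exactly.\<close>
  define c :: "(int ^ 'd) set \<Rightarrow> int ^ 'd" where "c T = (if 0 \<in> T then 0 else SOME v. v \<in> T)" for T
  define M where "M z = {v\<in>S'. \<alpha> v z \<in> range \<theta>}" for z
  have ne: "M z \<noteq> {}" for z
  proof -
    have "z \<in> (\<Union>v\<in>S. \<alpha> v -` range \<theta>)"
      using S(2) by blast
    then obtain v where "v \<in> S" "\<alpha> v z \<in> range \<theta>"
      by blast
    then have "v \<in> M z"
      unfolding M_def S'_def by blast
    then show ?thesis
      by blast
  qed
  have cM: "c (M z) \<in> M z" for z
    using ne[of z] by (cases "0 \<in> M z") (simp_all add: c_def some_in_eq)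
  have loc: "\<exists>U. open U \<and> z \<in> U \<and> (\<forall>y\<in>U. M y = M z)" for z
  proof -
    define U where "U = (\<Inter>v\<in>S'. \<alpha> v -` (if \<alpha> v z \<in> range \<theta> then range \<theta> else - range \<theta>))"
    have "open U"
      unfolding U_def using R S(1)
      by (intro open_INT ballI Z.open_act_vimage) (simp_all add: S'_def open_Compl)
    moreover have "z \<in> U"
      by (simp add: U_def)
    moreover have "M y = M z" if "y \<in> U" for y
    proof -
      have "\<alpha> v y \<in> range \<theta> \<longleftrightarrow> \<alpha> v z \<in> range \<theta>" if "v \<in> S'" for v
      proof -
        have "\<alpha> v y \<in> (if \<alpha> v z \<in> range \<theta> then range \<theta> else - range \<theta>)"
          using \<open>y \<in> U\<close> that unfolding U_def by blast
        then show ?thesis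
          by (simp split: if_split_asm)
      qed
      then show ?thesis
        unfolding M_def by blast
    qed
    ultimately show ?thesis
      by blast
  qed
  have op: "open {z. c (M z) \<in> T}" for T
  proof (rule topological_space_class.openI)
    fix z assume z: "z \<in> {z. c (M z) \<in> T}"
    obtain U where U: "open U" "z \<in> U" "\<forall>y\<in>U. M y = M z"
      using loc by blast
    have "U \<subseteq> {z. c (M z) \<in> T}"
    proof
      fix y assume "y \<in> U"
      then have "M y = M z"
        using U(3) by blast
      then show "y \<in> {z. c (M z) \<in> T}"
        using z by simp
    qed
    with U(1,2) show "\<exists>U. open U \<and> z \<in> U \<and> U \<subseteq> {z. c (M z) \<in> T}"
      by blast
  qed
  show ?thesis
  proof (rule that[of S' "\<lambda>z. c (M z)"])
    show "finite S'" "0 \<in> S'"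
      using S by (auto simp: S'_def)
    show "c (M z) \<in> S'" "\<alpha> (c (M z)) z \<in> range \<theta>" for z
      using cM[of z] unfolding M_def by blast+
    show "c (M z) = 0" if "z \<in> range \<theta>" for z
      using that by (simp add: c_def M_def S'_def)
    show "open {z. c (M z) \<in> T}" for T
      by (rule op)
    show "closed {z. c (M z) \<in> T}" for T
      using op[of "- T"] by (simp add: closed_def Collect_neg_eq)
  qed
qed

text \<open>\<open>ret\<close> carries the value of \<open>g\<close> at \<open>z\<close> to the
  point of the range where \<open>z\<close> returns and adds up what arrives. Moving values along
  orbits changes a function by coboundaries only, so \<open>ret\<close> inverts
  \<open>extend\<close> on classes.\<close>

lemma retraction:
  obtains ret :: "('c \<Rightarrow> int) \<Rightarrow> 'a \<Rightarrow> int" where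
    "\<And>f. ret (extend f) = f"
    "\<And>g. continuous_on UNIV g \<Longrightarrow> continuous_on UNIV (ret g)"
    "\<And>g. \<forall>z. 0 \<le> g z \<Longrightarrow> \<forall>x. 0 \<le> ret g x"
    "\<And>g. continuous_on UNIV g \<Longrightarrow> (\<lambda>z. g z - extend (ret g) z) \<in> coboundary_subgroup \<alpha>"
    "\<And>b. b \<in> coboundary_subgroup \<alpha> \<Longrightarrow> ret b \<in> coboundary_subgroup \<phi>"
proof -
  obtain S r where S: "finite S" "0 \<in> S" and r: "\<And>z. r z \<in> S" "\<And>z. \<alpha> (r z) z \<in> range \<theta>"
    "\<And>z. z \<in> range \<theta> \<Longrightarrow> r z = 0" and r_open: "\<And>T. open {z. r z \<in> T}" and r_closed: "\<And>T. closed {z. r z \<in> T}"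
    by (rule return_map) (rule that, assumption+)
  \<comment> \<open>The restriction of \<open>g\<close> to the points that return by
    \<open>w\<close>; those arriving at \<open>\<theta> x\<close> by \<open>w\<close> come from
    \<open>\<alpha> (- w) (\<theta> x)\<close>.\<close>
  define part :: "int ^ 'd \<Rightarrow> ('c \<Rightarrow> int) \<Rightarrow> 'c \<Rightarrow> int" where "part w g z = (if r z = w then g z else 0)" for w g z
  define ret where "ret g x = (\<Sum>w\<in>S. part w g (\<alpha> (- w) (\<theta> x)))" for g x
  have part_cont: "continuous_on UNIV (part w g)" if "continuous_on UNIV g" for w g
  proof -
    have "continuous_on UNIV (indicator {z. r z \<in> {w}} :: 'c \<Rightarrow> int)"
      by (intro continuous_indicator_clopen r_open r_closed)
    from continuous_int_binop[OF this that, of "\<lambda>a b. if a = 1 then b else 0"]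
    have "continuous_on UNIV (\<lambda>z. if indicator {z. r z \<in> {w}} z = (1 :: int) then g z else 0)" .
    moreover have "(\<lambda>z. if indicator {z. r z \<in> {w}} z = (1 :: int) then g z else 0) = part w g"
      by (auto simp: part_def indicator_def)
    ultimately show ?thesis
      by (simp only:)
  qed
  have act_cont: "continuous_on UNIV (\<alpha> w)" for w
    by (rule Z.pwt_continuous_on[OF Z.pwt_act[OF open_UNIV]])
  have part_add: "part w (\<lambda>z. g z + h z) z = part w g z + part w h z" for w g h z
    by (simp add: part_def)
  have part_minus: "part w (\<lambda>z. - g z) z = - part w g z" for w g z
    by (simp add: part_def)
  have ret_add: "ret (\<lambda>z. g z + h z) = (\<lambda>x. ret g x + ret h x)" for g h
    by (simp add: fun_eq_iff ret_def part_add sum.distrib)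
  have ret_minus: "ret (\<lambda>z. - g z) = (\<lambda>x. - ret g x)" for g
    by (simp add: fun_eq_iff ret_def part_minus sum_negf)
  have ret_diff: "ret (\<lambda>z. g z - h z) = (\<lambda>x. ret g x - ret h x)" for g h
    using ret_add[of g "\<lambda>z. - h z"] by (simp add: ret_minus)
  have ret_zero: "ret (\<lambda>z. 0) = (\<lambda>x. 0)"
    by (simp add: fun_eq_iff ret_def part_def)
  have ret_sum: "ret (\<lambda>z. \<Sum>i\<in>I. h i z) = (\<lambda>x. \<Sum>i\<in>I. ret (h i) x)"
    if "finite I" for I :: "((int ^ 'd) \<times> (int ^ 'd)) set" and h
    using that by (induction I rule: finite_induct) (simp_all add: ret_zero ret_add)
  have sum_part: "(\<Sum>w\<in>S. part w g z) = g z" for g z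
  proof -
    have "(\<Sum>w\<in>S. part w g z) = (\<Sum>w\<in>S. if w = r z then g z else 0)"
      by (rule sum.cong) (auto simp: part_def)
    then show ?thesis
      using S(1) r(1)[of z] by simp
  qed
  \<comment> \<open>Off the range nothing arrives, since every point returns into the range; the
    formula for \<open>ret\<close> therefore holds on the whole space.\<close>
  have ext_ret: "extend (ret g) z = (\<Sum>w\<in>S. part w g (\<alpha> (- w) z))" for g z
  proof (cases "z \<in> range \<theta>")
    case True
    then show ?thesis
      by (auto simp: ret_def)
  next
    case False
    have "part w g (\<alpha> (- w) z) = 0" for w
    proof -
      have "r (\<alpha> (- w) z) \<noteq> w"
        using r(2)[of "\<alpha> (- w) z"] False by auto
      then show ?thesis
        by (simp add: part_def)
    qed
    then show ?thesis
      using False by (simp add: extend_def)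
  qed
  have ret_indicator: "ret (indicator D) = indicator (\<theta> -` \<alpha> w ` D)" if D: "\<And>z. z \<in> D \<Longrightarrow> r z = w" for D w
  proof
    fix x
    have wS: "w \<in> S" if "\<alpha> (- w) (\<theta> x) \<in> D"
      using r(1)[of "\<alpha> (- w) (\<theta> x)"] D[OF that] by simp
    have "part u (indicator D) (\<alpha> (- u) (\<theta> x)) = (if u = w then indicator D (\<alpha> (- w) (\<theta> x)) else 0)" for u
      using D by (auto simp: part_def indicator_def)
    then have "ret (indicator D) x = (\<Sum>u\<in>S. if u = w then indicator D (\<alpha> (- w) (\<theta> x)) else 0)"
      by (simp add: ret_def)
    also have "\<dots> = indicator D (\<alpha> (- w) (\<theta> x))"
      using S(1) wS by (auto simp: indicator_def)
    also have "\<dots> = indicator (\<theta> -` \<alpha> w ` D) x"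
      using Z.act_vimage[of "- w" D] by (auto simp: indicator_def)
    finally show "ret (indicator D) x = indicator (\<theta> -` \<alpha> w ` D) x" .
  qed
  show ?thesis
  proof (rule that[of ret])
    show "ret (extend f) = f" for f
    proof
      fix x
      \<comment> \<open>On the range only \<open>w = 0\<close> occurs as a return, and off the range
        \<open>extend f\<close> vanishes.\<close>
      have "part w (extend f) (\<alpha> (- w) (\<theta> x)) = (if w = 0 then f x else 0)" for w
        using r(3)[of "\<alpha> (- w) (\<theta> x)"] r(3)[of "\<theta> x"] theta_inj by (auto simp: part_def extend_def)
      then show "ret (extend f) x = f x"
        using S by (simp add: ret_def)
    qed
    show "continuous_on UNIV (ret g)" if g: "continuous_on UNIV g" for g
    proof -
      have "continuous_on UNIV (\<lambda>x. part w g (\<alpha> (- w) (\<theta> x)))" for w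
        using continuous_on_compose2[OF continuous_on_compose2[OF part_cont[OF g] act_cont] theta_continuous] by simp
      then show ?thesis
        unfolding ret_def[abs_def] by (intro continuous_int_sum S)
    qed
    show "\<forall>x. 0 \<le> ret g x" if "\<forall>z. 0 \<le> g z" for g
      unfolding ret_def using that by (intro allI sum_nonneg) (simp add: part_def)
    show "(\<lambda>z. g z - extend (ret g) z) \<in> coboundary_subgroup \<alpha>" if g: "continuous_on UNIV g" for g
    proof -
      have "(\<lambda>z. \<Sum>w\<in>S. part w g z - part w g (\<alpha> (- w) z)) \<in> coboundary_subgroup \<alpha>"
        by (intro Z.coboundary_sum S Z.coboundary_translate part_cont g)
      then show ?thesis
        by (simp add: sum_subtractf sum_part ext_ret)
    qed
    show "ret b \<in> coboundary_subgroup \<phi>" if "b \<in> coboundary_subgroup \<alpha>" for b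
      using that
    proof (induction b rule: Z.coboundary_induct)
      case zero
      then show ?case
        by (simp add: ret_zero X.coboundary_zero)
    next
      case (generator A v)
      \<comment> \<open>\<open>A\<close> is cut according to the returns of \<open>z\<close> and of
        \<open>\<alpha> v z\<close>, so that on each piece both are single translations
        \<open>w\<close> and \<open>u\<close>.\<close>
      define D where "D = (\<lambda>(w, u). A \<inter> {z. r z \<in> {w}} \<inter> \<alpha> v -` {z. r z \<in> {u}})"
      have D: "open (D p)" "closed (D p)" for p
      proof -
        have "open (\<alpha> v -` {z. r z \<in> T})" "closed (\<alpha> v -` {z. r z \<in> T})" for T
          unfolding Z.act_vimage by (intro Z.open_act_image Z.closed_act_image r_open r_closed)+
        then show "open (D p)" "closed (D p)"
          using generator r_open r_closed unfolding D_def split_def by (intro open_Int closed_Int; blast)+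
      qed
      have ind: "indicator A z = (\<Sum>p\<in>S \<times> S. indicator (D p) z :: int)" for z
      proof -
        have "(\<Sum>p\<in>S \<times> S. indicator (D p) z :: int) =
            (\<Sum>p\<in>S \<times> S. if p = (r z, r (\<alpha> v z)) then indicator A z else 0)"
          by (rule sum.cong) (auto simp: D_def indicator_def)
        then show ?thesis
          using S(1) r(1) by simp
      qed
      have ind': "indicator (\<alpha> v ` A) z = (\<Sum>p\<in>S \<times> S. indicator (\<alpha> v ` D p) z :: int)" for z
      proof -
        have i: "indicator (\<alpha> v ` E) z = (indicator E (\<alpha> (- v) z) :: int)" for E
          using Z.act_vimage[of "- v" E] by (auto simp: indicator_def)
        show ?thesis
          unfolding i by (rule ind)
      qed
      have piece: "ret (\<lambda>z. indicator (D p) z - indicator (\<alpha> v ` D p) z) \<in> coboundary_subgroup \<phi>" for p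
      proof -
        obtain w u where p: "p = (w, u)"
          by (cases p)
        define P where "P = \<alpha> w ` D p"
        \<comment> \<open>The translation from the return of \<open>z\<close> to the return of
          \<open>\<alpha> v z\<close>: going back by \<open>w\<close>, then along \<open>v\<close>
          and \<open>u\<close>.\<close>
        define s where "s = u + v - w"
        have P: "open P" "closed P" "P \<subseteq> range \<theta>"
        proof -
          show "open P" "closed P"
            unfolding P_def by (intro Z.open_act_image Z.closed_act_image D)+
          show "P \<subseteq> range \<theta>"
            using r(2) by (auto simp: P_def p D_def)
        qed
        have sP: "\<alpha> s ` P = \<alpha> u ` \<alpha> v ` D p"
          by (simp add: P_def s_def image_image flip: Z.act_add)
        have "\<alpha> u ` \<alpha> v ` D p \<subseteq> range \<theta>"
          using r(2) by (auto simp: p D_def)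
        then have sP_range: "\<alpha> s ` P \<subseteq> range \<theta>"
          by (simp add: sP)
        let ?g = "\<lambda>x. theta_inv (\<alpha> s (\<theta> x))"
        have pw: "X.pwt (\<theta> -` P) ?g"
          by (rule pwt_pull[OF Z.pwt_act[OF P(1)] P(3) sP_range])
        have tg: "\<theta> (?g x) = \<alpha> s (\<theta> x)" if "x \<in> \<theta> -` P" for x
          by (rule f_inv_into_f) (use sP_range that in auto)
        have "inj_on ?g (\<theta> -` P)"
        proof (rule inj_onI)
          fix x y assume "x \<in> \<theta> -` P" "y \<in> \<theta> -` P" "?g x = ?g y"
          then have "\<alpha> s (\<theta> x) = \<alpha> s (\<theta> y)"
            using tg by metis
          then show "x = y"
            by simp
        qed
        moreover have "open (\<theta> -` P)" "closed (\<theta> -` P)"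
          using P theta_continuous by (auto intro: open_vimage closed_vimage)
        ultimately have "(\<lambda>x. indicator (\<theta> -` P) x - indicator (?g ` (\<theta> -` P)) x) \<in> coboundary_subgroup \<phi>"
          using pw by (intro X.pw_translation_coboundary)
        moreover have "?g ` (\<theta> -` P) = \<theta> -` \<alpha> s ` P"
        proof
          show "?g ` (\<theta> -` P) \<subseteq> \<theta> -` \<alpha> s ` P"
            using tg by auto
          show "\<theta> -` \<alpha> s ` P \<subseteq> ?g ` (\<theta> -` P)"
          proof
            fix y assume "y \<in> \<theta> -` \<alpha> s ` P"
            then obtain q where q: "q \<in> P" "\<theta> y = \<alpha> s q"
              by auto
            then obtain x where x: "q = \<theta> x"
              using P(3) by auto
            have "y = ?g x"
              using q(2) theta_inj by (simp flip: q(2) x)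
            then show "y \<in> ?g ` (\<theta> -` P)"
              using q x by blast
          qed
        qed
        moreover have "ret (indicator (D p)) = indicator (\<theta> -` P)"
          unfolding P_def by (rule ret_indicator) (auto simp: p D_def)
        moreover have "ret (indicator (\<alpha> v ` D p)) = indicator (\<theta> -` \<alpha> s ` P)"
          unfolding sP by (rule ret_indicator) (auto simp: p D_def)
        ultimately show ?thesis
          by (simp add: ret_diff)
      qed
      have "(\<lambda>x. \<Sum>p\<in>S \<times> S. ret (\<lambda>z. indicator (D p) z - indicator (\<alpha> v ` D p) z) x) \<in> coboundary_subgroup \<phi>"
        by (intro X.coboundary_sum piece finite_cartesian_product S)
      moreover have "(\<lambda>x. \<Sum>p\<in>S \<times> S. ret (\<lambda>z. indicator (D p) z - indicator (\<alpha> v ` D p) z) x) =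
          ret (\<lambda>z. \<Sum>p\<in>S \<times> S. indicator (D p) z - indicator (\<alpha> v ` D p) z)"
        using ret_sum[of "S \<times> S" "\<lambda>p z. indicator (D p) z - indicator (\<alpha> v ` D p) z"] S(1) by simp
      ultimately show ?case
        by (simp add: ind ind' sum_subtractf)
    next
      case (minus b)
      then show ?case
        by (simp add: ret_minus X.coboundary_minus)
    next
      case (add b c)
      then show ?case
        by (simp add: ret_add X.coboundary_add)
    qed
  qed
qed

text \<open>Extension by zero, taken modulo coboundaries, meets the description in
  \<open>induced_iso\<close> by the first isomorphism theorem: \<open>ret\<close> gives
  surjectivity, the kernel and the positive cone. It is unique because indicators of clopen sets
  generate all continuous functions.\<close>

lemma induced_iso_indicator:
  assumes A: "open A" "closed A"
  shows "induced_iso \<phi> \<alpha> \<theta> (dyn_class \<phi> (indicator A)) = dyn_class \<alpha> (indicator (\<theta> ` A))"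
proof -
  obtain ret :: "('c \<Rightarrow> int) \<Rightarrow> 'a \<Rightarrow> int" where
    ret_ext: "\<And>f. ret (extend f) = f"
    and ret_cont: "\<And>g. continuous_on UNIV g \<Longrightarrow> continuous_on UNIV (ret g)"
    and ret_pos: "\<And>g. \<forall>z. 0 \<le> g z \<Longrightarrow> \<forall>x. 0 \<le> ret g x"
    and ret_cob: "\<And>g. continuous_on UNIV g \<Longrightarrow> (\<lambda>z. g z - extend (ret g) z) \<in> coboundary_subgroup \<alpha>"
    and ret_B: "\<And>b. b \<in> coboundary_subgroup \<alpha> \<Longrightarrow> ret b \<in> coboundary_subgroup \<phi>"
    by (rule retraction) (rule that, assumption+)
  define k where "k f = dyn_class \<alpha> (extend f)" for f
  have k_ret: "k (ret g) = dyn_class \<alpha> g" if "continuous_on UNIV g" for g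
    unfolding k_def using ret_cob[OF that] by (metis Z.dyn_class_eq_iff)
  have hom: "group_hom cont_int_group (dyn_group \<alpha>) k"
  proof (rule group_hom.intro[OF cont_int.is_group Z.group_dyn_group group_hom_axioms.intro])
    show "k \<in> hom cont_int_group (dyn_group \<alpha>)"
      by (rule homI)
        (auto simp: cont_int_group_def k_def extend_add Z.dyn_class_mult extend_continuous Z.dyn_class_carrier)
  qed
  have k_onto: "k ` carrier cont_int_group = carrier (dyn_group \<alpha>)"
  proof
    show "k ` carrier cont_int_group \<subseteq> carrier (dyn_group \<alpha>)"
      by (auto simp: cont_int_group_def k_def extend_continuous Z.dyn_class_carrier)
    show "carrier (dyn_group \<alpha>) \<subseteq> k ` carrier cont_int_group"
    proof
      fix X assume "X \<in> carrier (dyn_group \<alpha>)"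
      then obtain g where g: "continuous_on UNIV g" "X = dyn_class \<alpha> g"
        by (auto simp: Z.carrier_dyn_group)
      then show "X \<in> k ` carrier cont_int_group"
        using k_ret[OF g(1)] ret_cont[OF g(1)] by (force simp: cont_int_group_def)
    qed
  qed
  \<comment> \<open>If \<open>extend f\<close> is a coboundary, so is its image under
    \<open>ret\<close>, which is \<open>f\<close>.\<close>
  have k_kernel: "kernel cont_int_group (dyn_group \<alpha>) k = coboundary_subgroup \<phi>"
  proof
    show "kernel cont_int_group (dyn_group \<alpha>) k \<subseteq> coboundary_subgroup \<phi>"
    proof
      fix f assume "f \<in> kernel cont_int_group (dyn_group \<alpha>) k"
      then have "dyn_class \<alpha> (extend f) = dyn_class \<alpha> (\<lambda>x. 0)"
        by (simp add: kernel_def k_def Z.dyn_class_one)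
      then have "extend f \<in> coboundary_subgroup \<alpha>"
        by (simp add: Z.dyn_class_eq_iff)
      then show "f \<in> coboundary_subgroup \<phi>"
        using ret_B[of "extend f"] by (simp add: ret_ext)
    qed
    show "coboundary_subgroup \<phi> \<subseteq> kernel cont_int_group (dyn_group \<alpha>) k"
    proof
      fix f assume f: "f \<in> coboundary_subgroup \<phi>"
      then have "dyn_class \<alpha> (extend f) = dyn_class \<alpha> (\<lambda>x. 0)"
        using extend_coboundary by (simp add: Z.dyn_class_eq_iff)
      then show "f \<in> kernel cont_int_group (dyn_group \<alpha>) k"
        using X.coboundary_continuous[OF f] by (simp add: kernel_def k_def Z.dyn_class_one cont_int_group_def)
    qed
  qed
  \<comment> \<open>The map \<open>k\<close> is constant on each coset, so \<open>the_elem\<close>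
    picks its value; restriction to the carrier gives the extensionality demanded by
    \<open>induced_iso\<close>.\<close>
  define h where "h = restrict (\<lambda>K. the_elem (k ` K)) (carrier (dyn_group \<phi>))"
  have h_class: "h (dyn_class \<phi> f) = dyn_class \<alpha> (extend f)" if f: "continuous_on UNIV f" for f
  proof -
    have "k ` dyn_class \<phi> f = {k f}"
    proof -
      have "k (\<lambda>x. b x + f x) = k f" if "b \<in> coboundary_subgroup \<phi>" for b
        using extend_coboundary[OF that] by (simp add: k_def extend_add Z.dyn_class_eq_iff)
      then show ?thesis
        using X.dyn_class_self[of f] by (auto simp: X.dyn_class_eq)
    qed
    then show ?thesis
      using X.dyn_class_carrier[OF f] by (simp add: h_def k_def)
  qed
  have "(\<lambda>K. the_elem (k ` K)) \<in> iso (dyn_group \<phi>) (dyn_group \<alpha>)"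
    using group_hom.FactGroup_iso_set[OF hom k_onto] unfolding k_kernel dyn_group_def[of \<phi>] .
  then have h_iso: "h \<in> iso (dyn_group \<phi>) (dyn_group \<alpha>)"
    unfolding h_def by (rule iso_restrict_carrier[OF X.group_dyn_group])
  have h_pos: "h ` dyn_pos \<phi> = dyn_pos \<alpha>"
  proof
    show "h ` dyn_pos \<phi> \<subseteq> dyn_pos \<alpha>"
    proof
      fix K assume "K \<in> h ` dyn_pos \<phi>"
      then obtain f where f: "continuous_on UNIV f" "\<forall>x. 0 \<le> f x" "K = h (dyn_class \<phi> f)"
        by (auto simp: X.dyn_pos_eq)
      moreover have "\<forall>z. 0 \<le> extend f z"
        using f(2) by (simp add: extend_def)
      ultimately show "K \<in> dyn_pos \<alpha>"
        using h_class[OF f(1)] extend_continuous[OF f(1)] by (auto simp: Z.dyn_pos_eq)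
    qed
    show "dyn_pos \<alpha> \<subseteq> h ` dyn_pos \<phi>"
    proof
      fix K assume "K \<in> dyn_pos \<alpha>"
      then obtain g where g: "continuous_on UNIV g" "\<forall>x. 0 \<le> g x" "K = dyn_class \<alpha> g"
        by (auto simp: Z.dyn_pos_eq)
      have "K = h (dyn_class \<phi> (ret g))"
        using k_ret[OF g(1)] h_class[OF ret_cont[OF g(1)]] g(3) by (simp add: k_def)
      moreover have "dyn_class \<phi> (ret g) \<in> dyn_pos \<phi>"
        unfolding X.dyn_pos_eq using ret_cont[OF g(1)] ret_pos[of g] g(2) by blast
      ultimately show "K \<in> h ` dyn_pos \<phi>"
        by blast
    qed
  qed
  have h_ext: "h \<in> extensional (carrier (dyn_group \<phi>))"
    unfolding h_def by (rule restrict_extensional)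
  define spec where "spec h' \<longleftrightarrow> h' \<in> og_iso (dyn_group \<phi>) (dyn_pos \<phi>) (dyn_group \<alpha>) (dyn_pos \<alpha>) \<and>
      h' \<in> extensional (carrier (dyn_group \<phi>)) \<and>
      (\<forall>A. open A \<and> closed A \<longrightarrow> h' (dyn_class \<phi> (indicator A)) = dyn_class \<alpha> (indicator (\<theta> ` A)))" for h'
  have spec_h: "spec h"
    unfolding spec_def og_iso_def using h_iso h_pos h_ext
    by (auto simp: h_class continuous_indicator_clopen extend_indicator)
  have unique: "h' = h" if h': "spec h'" for h'
  proof (rule extensionalityI)
    show "h' \<in> extensional (carrier (dyn_group \<phi>))" "h \<in> extensional (carrier (dyn_group \<phi>))"
      using h' spec_h by (auto simp: spec_def)
    interpret H: group_hom "dyn_group \<phi>" "dyn_group \<alpha>" h'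
      using h' X.group_dyn_group Z.group_dyn_group
      by (auto simp: spec_def og_iso_def iso_def intro!: group_hom.intro group_hom_axioms.intro)
    have eq: "h' (dyn_class \<phi> f) = dyn_class \<alpha> (extend f)" if "continuous_on UNIV f" for f
      using that X.compact_UNIV
    proof (induction f rule: cont_int_induct)
      case zero
      then show ?case
        using H.hom_one by (simp add: X.dyn_class_one Z.dyn_class_one extend_zero)
    next
      case (indicator A)
      then show ?case
        using h' by (simp add: spec_def extend_indicator)
    next
      case (minus f)
      then show ?case
        using H.hom_inv[OF X.dyn_class_carrier[OF minus(1)]]
        by (simp add: X.dyn_class_inv Z.dyn_class_inv extend_continuous extend_minus)
    next
      case (add f g)
      then show ?case
        using H.hom_mult[OF X.dyn_class_carrier[OF add(1)] X.dyn_class_carrier[OF add(2)]]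
        by (simp add: X.dyn_class_mult Z.dyn_class_mult extend_continuous extend_add)
    qed
    show "h' K = h K" if "K \<in> carrier (dyn_group \<phi>)" for K
      using that eq h_class by (auto simp: X.carrier_dyn_group)
  qed
  have "induced_iso \<phi> \<alpha> \<theta> = h"
    unfolding induced_iso_def using spec_h unique unfolding spec_def by (rule the_equality)
  then show ?thesis
    using h_class[OF continuous_indicator_clopen[OF A]] by (simp add: extend_indicator)
qed

end

subsection \<open>The orbit equivalence\<close>

lemma cantor_system_imp_cantor_action:
  fixes \<phi> :: "int ^ 'd::finite \<Rightarrow> 'a::topological_space \<Rightarrow> 'a"
  assumes "free_minimal_cantor_system \<phi>"
  shows "cantor_action \<phi>"
proof -
  have dyn: "dynamical_system \<phi>" and free: "free_action \<phi>" and minimal: "minimal_action \<phi>"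
    and cantor: "cantor_set (UNIV :: 'a set)"
    using assms by (auto simp: free_minimal_cantor_system_def)
  obtain h :: "'a \<Rightarrow> nat \<Rightarrow> bool" and k where h: "continuous_on UNIV h" "continuous_on UNIV k"
    "\<And>x. k (h x) = x" "\<And>y. h (k y) = y"
    using cantor unfolding cantor_set_def homeomorphic_def homeomorphism_def by auto
  have coord: "open {x. h x i = c}" "closed {x. h x i = c}" for i c
  proof -
    have "continuous_on UNIV (\<lambda>x. h x i)"
      using h(1) by (rule continuous_on_product_then_coordinatewise)
    then have "open ((\<lambda>x. h x i) -` {c})" "open ((\<lambda>x. h x i) -` (- {c}))"
      by (intro open_vimage open_discrete; assumption)+
    moreover have "(\<lambda>x. h x i) -` {c} = {x. h x i = c}" "(\<lambda>x. h x i) -` (- {c}) = - {x. h x i = c}"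
      by auto
    ultimately show "open {x. h x i = c}" "closed {x. h x i = c}"
      by (simp_all add: closed_def)
  qed
  show ?thesis
  proof
    show "\<phi> 0 p = p" for p
      using dyn by (simp add: dynamical_system_def)
    show "\<phi> (s + t) p = \<phi> s (\<phi> t p)" for s t p
      using dyn by (simp add: dynamical_system_def)
    show "open (\<phi> s ` U)" if "open U" for s U
      using dyn that homeomorphic_imp_open_map[of euclidean euclidean "\<phi> s"]
      by (simp add: dynamical_system_def open_map_def)
    show "v = 0" if "\<phi> v x = x" for v x
      using free that by (auto simp: free_action_def)
    show "\<exists>v. \<phi> v x \<in> U" if "open U" "U \<noteq> {}" for U x
      using minimal that open_Int_closure_eq_empty[OF that(1), of "action_orbit \<phi> x"]
      by (auto simp: minimal_action_def action_orbit_def)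
    show "compact (UNIV :: 'a set)"
      using dyn by (simp add: dynamical_system_def)
    show "Hausdorff_space (euclidean :: 'a topology)"
      unfolding Hausdorff_space_def
    proof (intro allI impI)
      fix x y :: 'a assume "x \<in> topspace euclidean \<and> y \<in> topspace euclidean \<and> x \<noteq> y"
      then have "h x \<noteq> h y"
        using h(3) by metis
      then obtain i where "h x i \<noteq> h y i"
        by auto
      then show "\<exists>U V. openin euclidean U \<and> openin euclidean V \<and> x \<in> U \<and> y \<in> V \<and> disjnt U V"
        by (intro exI[of _ "{z. h z i = h x i}"] exI[of _ "{z. h z i = h y i}"])
          (auto simp: coord disjnt_def)
    qed
    show "\<exists>N :: nat \<Rightarrow> 'a set. (\<forall>n. open (N n) \<and> closed (N n) \<and> z \<in> N n) \<and>
        (\<forall>U. open U \<longrightarrow> z \<in> U \<longrightarrow> (\<exists>n. N n \<subseteq> U))" for z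
    \<comment> \<open>Cylinder sets that fix the first \<open>n\<close> coordinates, pulled back
      from the Cantor space.\<close>
    proof (intro exI[of _ "\<lambda>n. \<Inter>i\<in>{..<n}. {x. h x i = h z i}"] conjI allI impI)
      fix n
      show "open (\<Inter>i\<in>{..<n}. {x. h x i = h z i})" "closed (\<Inter>i\<in>{..<n}. {x. h x i = h z i})"
        by (intro open_INT closed_INT ballI coord finite_lessThan)+
      show "z \<in> (\<Inter>i\<in>{..<n}. {x. h x i = h z i})"
        by simp
    next
      fix U assume U: "open U" "z \<in> U"
      have "openin (product_topology (\<lambda>i. euclidean) UNIV) (k -` U)" "h z \<in> k -` U"
        using open_vimage[OF U(1) h(2)] U(2) h(3) by (auto simp: open_fun_def)
      from product_topology_open_contains_basis[OF this]
      obtain V where V: "h z \<in> PiE UNIV V" "finite {i. V i \<noteq> UNIV}" "PiE UNIV V \<subseteq> k -` U"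
        by auto
      obtain n where n: "\<And>i. V i \<noteq> UNIV \<Longrightarrow> i < n"
        using finite_nat_set_iff_bounded V(2) by auto
      have "(\<Inter>i\<in>{..<n}. {x. h x i = h z i}) \<subseteq> U"
      proof
        fix x assume x: "x \<in> (\<Inter>i\<in>{..<n}. {x. h x i = h z i})"
        have "h x i \<in> V i" for i
          using x n[of i] V(1) by (cases "V i = UNIV") (auto simp: PiE_iff)
        then have "h x \<in> k -` U"
          using V(3) by (auto simp: PiE_iff subset_iff)
        then show "x \<in> U"
          using h(3) by simp
      qed
      then show "\<exists>n. (\<Inter>i\<in>{..<n}. {x. h x i = h z i}) \<subseteq> U"
        by blast
    qed
  qed
qed

theorem theorem3p21:
  fixes \<phi> :: "int ^ 'd::finite \<Rightarrow> 'a::topological_space \<Rightarrow> 'a"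
    and \<psi> :: "int ^ 'd \<Rightarrow> 'b::topological_space \<Rightarrow> 'b"
    and \<alpha> :: "int ^ 'd \<Rightarrow> 'c::topological_space \<Rightarrow> 'c"
    and \<theta>1 :: "'a \<Rightarrow> 'c" and \<theta>2 :: "'b \<Rightarrow> 'c" and x0 :: 'a
  assumes "free_minimal_cantor_system \<phi>"
    and "free_minimal_cantor_system \<psi>"
    and "free_minimal_cantor_system \<alpha>"
    and "bounded_orbit_injection \<phi> \<alpha> \<theta>1"
    and "bounded_orbit_injection \<psi> \<alpha> \<theta>2"
    and "induced_iso \<phi> \<alpha> \<theta>1 (dyn_class \<phi> (indicator UNIV)) \<otimes>\<^bsub>dyn_group \<alpha>\<^esub>
         inv\<^bsub>dyn_group \<alpha>\<^esub> (induced_iso \<psi> \<alpha> \<theta>2 (dyn_class \<psi> (indicator UNIV)))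
           \<in> infinitesimals (dyn_group \<alpha>) (dyn_pos \<alpha>)"
  shows "\<exists>(\<theta> :: 'a \<Rightarrow> 'b) (\<eta> :: 'a \<Rightarrow> int ^ 'd \<Rightarrow> int ^ 'd).
           orbit_equivalence \<phi> \<psi> \<theta> \<and>
           (\<forall>x y w. \<phi> w x = y \<longleftrightarrow> \<psi> (\<eta> x w) (\<theta> x) = \<theta> y) \<and>
           (\<forall>w. continuous_on (UNIV - {x0, \<phi> (- w) x0}) (\<lambda>x. \<eta> x w))"
proof -
  interpret X: cantor_action \<phi>
    by (rule cantor_system_imp_cantor_action[OF assms(1)])
  interpret Y: cantor_action \<psi>
    by (rule cantor_system_imp_cantor_action[OF assms(2)])
  interpret Z: cantor_action \<alpha>
    by (rule cantor_system_imp_cantor_action[OF assms(3)])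
  interpret E1: bounded_embedding \<phi> \<alpha> \<theta>1
    by unfold_locales (rule assms(4))
  interpret E2: bounded_embedding \<psi> \<alpha> \<theta>2
    by unfold_locales (rule assms(5))
  define A where "A = range \<theta>1"
  define B where "B = range \<theta>2"
  have A: "open A" "closed A" and B: "open B" "closed B"
    unfolding A_def B_def by (intro E1.theta_open E1.theta_closed E2.theta_open E2.theta_closed; simp)+
  have "dyn_class \<alpha> (indicator A) \<otimes>\<^bsub>dyn_group \<alpha>\<^esub> inv\<^bsub>dyn_group \<alpha>\<^esub> (dyn_class \<alpha> (indicator B))
      \<in> infinitesimals (dyn_group \<alpha>) (dyn_pos \<alpha>)"
    using assms(6) E1.induced_iso_indicator[of UNIV] E2.induced_iso_indicator[of UNIV]
    by (simp add: A_def B_def)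
  note close = Z.infinitesimal_imp_inf_close[OF A B this]
  have "B \<noteq> {}"
    by (simp add: B_def)
  \<comment> \<open>The target of the exceptional point is taken in its own orbit, so that the
    matching respects orbits there too.\<close>
  then obtain u where u: "\<alpha> u (\<theta>1 x0) \<in> B"
    using Z.minimal[OF B(1)] by blast
  have "Z.exhaust_state (\<theta>1 x0) (\<alpha> u (\<theta>1 x0)) A B"
    using A B close u by (simp add: Z.exhaust_state_def A_def)
  then obtain t where t: "bij_betw t A B" "t (\<theta>1 x0) = \<alpha> u (\<theta>1 x0)" "Z.pwt (A - {\<theta>1 x0}) t"
    "continuous_on A t" "\<And>U. open U \<Longrightarrow> U \<subseteq> A \<Longrightarrow> open (t ` U)"
    by (rule Z.exhausting_bijection) (rule that, assumption+)
  define \<theta> where "\<theta> x = inv_into UNIV \<theta>2 (t (\<theta>1 x))" for x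
  have \<theta>: "\<theta>2 (\<theta> x) = t (\<theta>1 x)" for x
  proof -
    have "t (\<theta>1 x) \<in> range \<theta>2"
      using t(1) by (auto simp: bij_betw_def A_def B_def)
    then show ?thesis
      unfolding \<theta>_def by (rule f_inv_into_f)
  qed
  have \<theta>_inj: "\<theta> x = \<theta> y \<longleftrightarrow> x = y" for x y
  proof
    assume "\<theta> x = \<theta> y"
    then have "t (\<theta>1 x) = t (\<theta>1 y)"
      by (simp flip: \<theta>)
    then have "\<theta>1 x = \<theta>1 y"
      using t(1) by (auto simp: bij_betw_def A_def dest: inj_onD)
    then show "x = y"
      by simp
  qed simp
  have \<theta>_surj: "\<exists>x. y = \<theta> x" for y
  proof -
    have "\<theta>2 y \<in> t ` A"
      using t(1) by (simp add: bij_betw_def B_def)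
    then obtain x where "\<theta>2 y = t (\<theta>1 x)"
      by (auto simp: A_def)
    then show ?thesis
      by (metis \<theta> E2.theta_eq)
  qed
  have t_orbit: "\<exists>v. t (\<theta>1 x) = \<alpha> v (\<theta>1 x)" for x
  proof (cases "x = x0")
    case False
    then have "\<theta>1 x \<in> A - {\<theta>1 x0}"
      by (simp add: A_def)
    with t(3) show ?thesis
      by (metis pw_translationE)
  qed (use t(2) in auto)
  \<comment> \<open>The map \<open>t\<close> moves each point of \<open>A\<close> within its
    \<open>\<alpha>\<close>-orbit, so being in one orbit is the same before and after applying
    it.\<close>
  have orbit: "(\<exists>w. \<phi> w x = y) \<longleftrightarrow> (\<exists>v. \<psi> v (\<theta> x) = \<theta> y)" for x y
  proof -
    obtain v w where v: "t (\<theta>1 x) = \<alpha> v (\<theta>1 x)" and w: "t (\<theta>1 y) = \<alpha> w (\<theta>1 y)"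
      using t_orbit by metis
    have "(\<exists>s. \<alpha> s (\<theta>1 x) = \<theta>1 y) \<longleftrightarrow> (\<exists>s. \<alpha> s (\<alpha> v (\<theta>1 x)) = \<alpha> w (\<theta>1 y))"
    proof
      assume "\<exists>s. \<alpha> s (\<theta>1 x) = \<theta>1 y"
      then obtain s where s: "\<alpha> s (\<theta>1 x) = \<theta>1 y"
        by blast
      have "\<alpha> (w + s + - v) (\<alpha> v (\<theta>1 x)) = \<alpha> w (\<theta>1 y)"
        unfolding Z.act_add by (simp add: s)
      then show "\<exists>s. \<alpha> s (\<alpha> v (\<theta>1 x)) = \<alpha> w (\<theta>1 y)" ..
    next
      assume "\<exists>s. \<alpha> s (\<alpha> v (\<theta>1 x)) = \<alpha> w (\<theta>1 y)"
      then obtain s where s: "\<alpha> s (\<alpha> v (\<theta>1 x)) = \<alpha> w (\<theta>1 y)"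
        by blast
      have "\<alpha> (- w + s + v) (\<theta>1 x) = \<theta>1 y"
        unfolding Z.act_add by (simp add: s)
      then show "\<exists>s. \<alpha> s (\<theta>1 x) = \<theta>1 y" ..
    qed
    then show ?thesis
      unfolding E1.theta_orbit E2.theta_orbit \<theta> v w .
  qed
  have \<theta>_cont: "continuous_on UNIV \<theta>"
    unfolding continuous_on_open_vimage[OF open_UNIV]
  proof (intro allI impI)
    fix W :: "'b set" assume "open W"
    then have "open (t -` (\<theta>2 ` W) \<inter> A)"
      using t(4) continuous_on_open_vimage[OF A(1)] E2.theta_open by blast
    then have "open (\<theta>1 -` (t -` (\<theta>2 ` W) \<inter> A))"
      by (rule open_vimage[OF _ E1.theta_continuous])
    also have "\<theta>1 -` (t -` (\<theta>2 ` W) \<inter> A) = \<theta> -` W \<inter> UNIV"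
      by (auto simp: A_def simp flip: \<theta>)
    finally show "open (\<theta> -` W \<inter> UNIV)" .
  qed
  have \<theta>_open: "open (\<theta> ` W)" if "open W" for W
  proof -
    have "open (t ` \<theta>1 ` W)"
      using that by (intro t(5) E1.theta_open) (auto simp: A_def)
    then have "open (\<theta>2 -` t ` \<theta>1 ` W)"
      by (rule open_vimage[OF _ E2.theta_continuous])
    also have "\<theta>2 -` t ` \<theta>1 ` W = \<theta> ` W"
      unfolding image_image by (auto simp flip: \<theta>)
    finally show ?thesis .
  qed
  have \<theta>_range: "range \<theta> = UNIV"
    using \<theta>_surj by blast
  have "homeomorphic_map euclidean euclidean \<theta>"
    by (rule bijective_open_imp_homeomorphic_map)
      (use \<theta>_cont \<theta>_open \<theta>_inj \<theta>_range in \<open>auto simp: open_map_def inj_on_def\<close>)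
  moreover have "\<theta> ` action_orbit \<phi> x = action_orbit \<psi> (\<theta> x)" for x
  proof
    show "\<theta> ` action_orbit \<phi> x \<subseteq> action_orbit \<psi> (\<theta> x)"
    proof
      fix y assume "y \<in> \<theta> ` action_orbit \<phi> x"
      then obtain w where w: "y = \<theta> (\<phi> w x)"
        by (auto simp: action_orbit_def)
      obtain v where "\<psi> v (\<theta> x) = y"
        unfolding w using orbit[of x "\<phi> w x"] by blast
      then show "y \<in> action_orbit \<psi> (\<theta> x)"
        by (auto simp: action_orbit_def)
    qed
    show "action_orbit \<psi> (\<theta> x) \<subseteq> \<theta> ` action_orbit \<phi> x"
    proof
      fix y assume "y \<in> action_orbit \<psi> (\<theta> x)"
      then obtain v where "y = \<psi> v (\<theta> x)"
        by (auto simp: action_orbit_def)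
      moreover obtain z where "y = \<theta> z"
        using \<theta>_surj by blast
      ultimately obtain w where "\<phi> w x = z"
        using orbit[of x z] by metis
      then show "y \<in> \<theta> ` action_orbit \<phi> x"
        using \<open>y = \<theta> z\<close> by (auto simp: action_orbit_def)
    qed
  qed
  ultimately have "orbit_equivalence \<phi> \<psi> \<theta>"
    by (simp add: orbit_equivalence_def)
  moreover have "\<exists>v. \<psi> v (\<theta> x) = \<theta> (\<phi> w x)" for x w
    using orbit by blast
  then obtain \<eta> where \<eta>: "\<And>x w. \<psi> (\<eta> x w) (\<theta> x) = \<theta> (\<phi> w x)"
    by metis
  have "\<forall>x y w. \<phi> w x = y \<longleftrightarrow> \<psi> (\<eta> x w) (\<theta> x) = \<theta> y"
    by (simp add: \<eta> \<theta>_inj)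
  moreover have "continuous_on (UNIV - {x0, \<phi> (- w) x0}) (\<lambda>x. \<eta> x w)" for w
  proof (rule continuous_on_open_discrete)
    show "open (UNIV - {x0, \<phi> (- w) x0})"
    proof -
      have "open (- ({x0} \<union> {\<phi> (- w) x0}))"
        by (intro open_Compl closed_Un X.closed_singleton_base)
      moreover have "- ({x0} \<union> {\<phi> (- w) x0}) = UNIV - {x0, \<phi> (- w) x0}"
        by auto
      ultimately show ?thesis
        by (simp only:)
    qed
    fix x assume x: "x \<in> UNIV - {x0, \<phi> (- w) x0}"
    have "\<phi> w x \<noteq> x0"
    proof
      assume "\<phi> w x = x0"
      then have "x = \<phi> (- w) x0"
        by (metis X.act_minus_left)
      then show False
        using x by simp
    qed
    \<comment> \<open>The two excluded points are exactly those for which \<open>x\<close> or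
      \<open>\<phi> w x\<close> is \<open>x0\<close>; otherwise \<open>t\<close> is a local
      translation at both ends.\<close>
    then have 1: "\<theta>1 x \<in> A - {\<theta>1 x0}" and 2: "\<theta>1 (\<phi> w x) \<in> A - {\<theta>1 x0}"
      using x by (auto simp: A_def)
    obtain s U where U: "open U" "\<theta>1 x \<in> U" "\<And>q. q \<in> U \<Longrightarrow> t q = \<alpha> s q"
      using pw_translationE[OF t(3) 1] by metis
    obtain s' U' where U': "open U'" "\<theta>1 (\<phi> w x) \<in> U'" "\<And>q. q \<in> U' \<Longrightarrow> t q = \<alpha> s' q"
      using pw_translationE[OF t(3) 2] by metis
    obtain v where "\<alpha> v (\<theta>1 x) = \<theta>1 (\<phi> w x)"
      using E1.theta_orbit[of x "\<phi> w x"] by blast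
    then obtain V where V: "open V" "x \<in> V" "\<And>y. y \<in> V \<Longrightarrow> \<alpha> v (\<theta>1 y) = \<theta>1 (\<phi> w y)"
      by (rule E1.cocycle_locally_constant) (rule that, assumption+)
    define N where "N = \<theta>1 -` U \<inter> V \<inter> (\<lambda>y. \<theta>1 (\<phi> w y)) -` U'"
    have "continuous_on UNIV (\<lambda>y. \<theta>1 (\<phi> w y))"
      by (rule continuous_on_compose2[OF E1.theta_continuous X.pwt_continuous_on[OF X.pwt_act[OF open_UNIV]]]) simp
    then have N: "open N" "x \<in> N"
      using U(1,2) U'(1,2) V(1,2) E1.theta_continuous unfolding N_def by (auto intro!: open_Int open_vimage)
    \<comment> \<open>Near \<open>x\<close> a single translation works: back along \<open>t\<close>
      by \<open>s\<close>, across by the cocycle value \<open>v\<close> of \<open>\<theta>1\<close>,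
      and forward along \<open>t\<close> by \<open>s'\<close>.\<close>
    have N_eq: "\<alpha> (s' + v + - s) (\<theta>2 (\<theta> y)) = \<theta>2 (\<theta> (\<phi> w y))" if "y \<in> N" for y
      using that U(3)[of "\<theta>1 y"] U'(3)[of "\<theta>1 (\<phi> w y)"] V(3)[of y]
      unfolding \<theta> Z.act_add by (simp add: N_def)
    then have "\<alpha> (s' + v + - s) (\<theta>2 (\<theta> x)) = \<theta>2 (\<psi> (\<eta> x w) (\<theta> x))"
      using N(2) by (simp add: \<eta>)
    \<comment> \<open>Boundedness of \<open>\<theta>2\<close> converts this fixed
      \<open>\<alpha>\<close>-translation into a fixed \<open>\<psi>\<close>-translation near
      \<open>\<theta> x\<close>.\<close>
    then obtain W where W: "open W" "\<theta> x \<in> W"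
      "\<And>y. y \<in> W \<Longrightarrow> \<alpha> (s' + v + - s) (\<theta>2 y) = \<theta>2 (\<psi> (\<eta> x w) y)"
      by (rule E2.cocycle_locally_constant) (rule that, assumption+)
    \<comment> \<open>Freeness of \<open>\<psi>\<close> identifies the two vectors that move
      \<open>\<theta> y\<close> to the same point.\<close>
    have const: "\<eta> y w = \<eta> x w" if "y \<in> N \<inter> \<theta> -` W" for y
    proof -
      have "\<theta>2 (\<psi> (\<eta> x w) (\<theta> y)) = \<theta>2 (\<psi> (\<eta> y w) (\<theta> y))"
        using W(3)[of "\<theta> y"] N_eq[of y] that by (simp add: \<eta>)
      then show ?thesis
        by simp
    qed
    show "\<exists>U. open U \<and> x \<in> U \<and> (\<forall>y\<in>U \<inter> (UNIV - {x0, \<phi> (- w) x0}). \<eta> y w = \<eta> x w)"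
    proof (intro exI conjI ballI)
      show "open (N \<inter> \<theta> -` W)"
        by (intro open_Int N open_vimage W \<theta>_cont)
      show "x \<in> N \<inter> \<theta> -` W"
        using N(2) W(2) by simp
      show "\<eta> y w = \<eta> x w" if "y \<in> N \<inter> \<theta> -` W \<inter> (UNIV - {x0, \<phi> (- w) x0})" for y
        using that const by blast
    qed
  qed
  ultimately show ?thesis
    by blast
qed

end
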